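(* Let $d\ge 2$ and $2\le k<l$ be integers with $k$ and $l$ relatively prime, and let $X_{d,k,l}\subset\mathbb{A}^4_{\mathbb{C}}$ be the hypersurface defined by $P_{d,k,l}=x^dy+z^k+t^l+x=0$. Then every automorphism of $X_{d,k,l}$ extends to an automorphism of $\mathbb{A}^4_{\mathbb{C}}$.
   Context: Here $x,y,z,t$ are the coordinates of $\mathbb{A}^4_{\mathbb{C}}$, and automorphisms are automorphisms of complex algebraic varieties. An automorphism of $X_{d,k,l}$, corresponding to a $\mathbb{C}$-algebra automorphism $\tilde\varphi$ of $\mathbb{C}[X_{d,k,l}]=\mathbb{C}[x,y,z,t]/(P_{d,k,l})$, extends to $\mathbb{A}^4_{\mathbb{C}}$ if there is a $\mathbb{C}$-algebra automorphism $\Phi$ of $\mathbb{C}[x,y,z,t]$ which preserves the ideal $(P_{d,k,l})$ and induces $\tilde\varphi$ on $\mathbb{C}[X_{d,k,l}]$. *)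

theory Defs
  imports Complex_Main "HOL-Algebra.QuotRing" "HOL-Algebra.Algebraic_Closure_Type"
    "HOL-Computational_Algebra.Polynomial"
begin

text \<open>
  The polynomial ring in four variables over the complex numbers, realised as the iterated
  polynomial ring with \<open>x\<close> innermost, then \<open>z\<close>, then \<open>t\<close>, and \<open>y\<close> outermost.
  Up to the canonical isomorphism the order of the variables is immaterial.
\<close>

type_synonym poly4 = "complex poly poly poly poly"

definition const4 :: "complex \<Rightarrow> poly4" where
  "const4 c = [:[:[:[:c:]:]:]:]"

definition var_x :: poly4 where "var_x = [:[:[:[:0, 1:]:]:]:]"
definition var_z :: poly4 where "var_z = [:[:[:0, 1:]:]:]"
definition var_t :: poly4 where "var_t = [:[:0, 1:]:]"
definition var_y :: poly4 where "var_y = [:0, 1:]"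

abbreviation poly4_ring :: "poly4 ring" where
  "poly4_ring \<equiv> ring_of_type_algebra"

text \<open>
  A complex algebra is a ring \<open>R\<close> together with its structure map \<open>\<iota>\<close> from the complex
  numbers; an algebra automorphism is a ring automorphism compatible with \<open>\<iota>\<close>.
  As usual in HOL-Algebra, such a map is only meaningful on the carrier of \<open>R\<close>.
\<close>

definition alg_aut :: "('a, 'm) ring_scheme \<Rightarrow> (complex \<Rightarrow> 'a) \<Rightarrow> ('a \<Rightarrow> 'a) set" where
  "alg_aut R \<iota> = {h \<in> ring_iso R R. \<forall>c. h (\<iota> c) = \<iota> c}"

definition P :: "nat \<Rightarrow> nat \<Rightarrow> nat \<Rightarrow> poly4" where
  "P d k l = var_x ^ d * var_y + var_z ^ k + var_t ^ l + var_x"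

definition I_X :: "nat \<Rightarrow> nat \<Rightarrow> nat \<Rightarrow> poly4 set" where
  "I_X d k l = PIdl\<^bsub>poly4_ring\<^esub> (P d k l)"

definition coord_ring :: "nat \<Rightarrow> nat \<Rightarrow> nat \<Rightarrow> poly4 set ring" where
  "coord_ring d k l = poly4_ring Quot (I_X d k l)"

definition residue_class :: "nat \<Rightarrow> nat \<Rightarrow> nat \<Rightarrow> poly4 \<Rightarrow> poly4 set" where
  "residue_class d k l f = I_X d k l +>\<^bsub>poly4_ring\<^esub> f"

text \<open>
  Automorphisms of the affine variety \<open>X\<close> defined by \<open>P d k l\<close> are represented by the
  corresponding (contravariantly) algebra automorphisms of its coordinate ring; likewise
  automorphisms of affine 4-space by algebra automorphisms of the polynomial ring.
\<close>

definition Aut_X :: "nat \<Rightarrow> nat \<Rightarrow> nat \<Rightarrow> (poly4 set \<Rightarrow> poly4 set) set" where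
  "Aut_X d k l = alg_aut (coord_ring d k l) (\<lambda>c. residue_class d k l (const4 c))"

definition Aut_A4 :: "(poly4 \<Rightarrow> poly4) set" where
  "Aut_A4 = alg_aut poly4_ring const4"

definition extends_to_A4 :: "nat \<Rightarrow> nat \<Rightarrow> nat \<Rightarrow> (poly4 set \<Rightarrow> poly4 set) \<Rightarrow> bool" where
  "extends_to_A4 d k l \<phi> \<longleftrightarrow>
     (\<exists>\<Phi> \<in> Aut_A4. \<Phi> ` I_X d k l = I_X d k l \<and>
        (\<forall>f. \<phi> (residue_class d k l f) = residue_class d k l (\<Phi> f)))"

end

theory Submission
  imports Defs "HOL-Library.Poly_Mapping"
begin

text \<open>
  Let \<open>A\<close> be the coordinate ring of \<open>X\<close> and \<open>B = \<complex>[x, z, t] \<subseteq> A\<close>. The automorphism \<open>\<phi>\<close> conjugates the two elementary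
  additive group actions on \<open>X\<close> (moving \<open>z\<close>, respectively \<open>t\<close>, and \<open>y\<close>), whose invariants contain \<open>x, t\<close>,
  respectively \<open>x, z\<close>. Hence \<open>\<phi> B = B\<close> as soon as the invariants of any nontrivial additive group action lie in
  \<open>B\<close>. Give \<open>x, z, t\<close> the weights \<open>-1, l\<epsilon>, k\<epsilon>\<close> with a small irrational \<open>\<epsilon>\<close>, so that the leading forms
  satisfy \<open>x\<^sup>d y + z\<^sup>k + t\<^sup>l = 0\<close> and are homogeneous for a two-dimensional grading. An invariant outside \<open>B\<close> has a
  leading form divisible by \<open>y\<close>, so \<open>y\<close> is invariant under the associated graded action. By homogeneity that
  action has a further invariant among \<open>x, z, t, z\<^sup>k - \<zeta> t\<^sup>l\<close>, and then all variables are invariant, because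
  \<open>f U\<^sup>a + g V\<^sup>b = c \<noteq> 0\<close> with \<open>a, b \<ge> 2\<close> has only constant polynomial solutions; but the graded action is
  nontrivial.

  So \<open>\<phi>\<close> restricts to an automorphism of \<open>B\<close> with \<open>x \<mapsto> \<mu> x\<close> preserving the ideal \<open>(x\<^sup>d, r)\<close>, where
  \<open>r = z\<^sup>k + t\<^sup>l + x\<close>. Modulo \<open>x\<close> it preserves the cuspidal curve, and a weighted degree estimate for Jacobians
  shows that it is a torus element, which extends. If \<open>\<phi>\<close> is the identity modulo \<open>x\<^sup>n\<close>, its next term is the
  Hamiltonian vector field of some \<open>r h\<close>. The flow of \<open>(r - c) h\<close> at time \<open>x\<^sup>n\<close> agrees modulo \<open>x\<^sup>d\<close> with a
  product of shears with coefficients in \<open>\<complex>[c, x]\<close>, which preserves \<open>(x\<^sup>d, r - c)\<close>; substituting \<open>P\<close> for \<open>c\<close>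
  turns it into an automorphism of affine space fixing \<open>P\<close>. Dividing it out improves \<open>n\<close>, and for \<open>n = d\<close> the
  automorphism extends by a translation of \<open>y\<close>.
\<close>

text \<open>An automorphism of \<open>X\<close> only controls the ideal \<open>(x^d, r)\<close> of
  \<open>\<complex>[x, z, t]\<close>, while its extension must multiply \<open>P\<close> by a
  scalar. The parameter \<open>c\<close> bridges this gap: if \<open>r - c\<close> goes to
  \<open>(r - c) u + x^d v\<close>, then putting \<open>P\<close> for \<open>c\<close> turns
  \<open>r - c\<close> into \<open>- x^d y\<close>, and \<open>y \<mapsto> u y - v\<close> fixes
  \<open>P\<close>. A Hamiltonian flow is in general not polynomial, and its truncation is
  multiplicative with Jacobian one only modulo \<open>x^d\<close>. It can be matched order by order
  because shears are the flows of powers of linear forms, and these powers span all polynomials in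
  characteristic zero.

  For the invariants, irrationality of \<open>\<epsilon>\<close> lets one real degree see both
  gradings, and smallness puts every normal monomial containing \<open>y\<close> above those without
  it. If \<open>y\<close> generated all homogeneous invariants, the images of \<open>z^k\<close> and
  \<open>t^l\<close> would have proportional top coefficients, so some
  \<open>z^k - \<zeta> t^l\<close> would drop in the degree of the parameter; but its weight alone
  determines that degree.\<close>

lemma dvd_sub_swap: "a dvd b - c \<Longrightarrow> a dvd c - b" for a b c :: "'a::comm_ring_1"
  by (metis dvd_minus_iff minus_diff_eq)

section \<open>Ring homomorphisms between type-class rings\<close>

text \<open>Unital ring homomorphisms as bare functions on types. Compatibility with scalars is kept
  as a separate equation on constants, so that maps between rings with different scalars
  fit.\<close>

definition rhom :: "('a::comm_ring_1 \<Rightarrow> 'b::comm_ring_1) \<Rightarrow> bool" where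
  "rhom h \<longleftrightarrow> h 1 = 1 \<and> (\<forall>a b. h (a + b) = h a + h b) \<and> (\<forall>a b. h (a * b) = h a * h b)"

lemma rhomI:
  assumes "h 1 = 1" "\<And>a b. h (a + b) = h a + h b" "\<And>a b. h (a * b) = h a * h b"
  shows "rhom h"
  using assms by (simp add: rhom_def)

lemma rhom_1: "rhom h \<Longrightarrow> h 1 = 1"
  and rhom_add: "rhom h \<Longrightarrow> h (a + b) = h a + h b"
  and rhom_mult: "rhom h \<Longrightarrow> h (a * b) = h a * h b"
  by (auto simp only: rhom_def)

lemma rhom_0: assumes "rhom h" shows "h 0 = 0"
  using rhom_add[OF assms, of 0 0] by simp

lemma rhom_uminus: assumes "rhom h" shows "h (- a) = - h a"
  using rhom_add[OF assms, of a "- a"] by (simp add: rhom_0[OF assms] eq_neg_iff_add_eq_0 add.commute)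

lemma rhom_diff: assumes "rhom h" shows "h (a - b) = h a - h b"
  using rhom_add[OF assms, of a "- b"] by (simp add: rhom_uminus[OF assms])

lemma rhom_power: assumes "rhom h" shows "h (a ^ n) = h a ^ n"
  by (induction n) (simp_all add: rhom_mult[OF assms] rhom_1[OF assms])

lemma rhom_of_nat: assumes "rhom h" shows "h (of_nat n) = of_nat n"
  by (induction n) (simp_all add: rhom_add[OF assms] rhom_1[OF assms] rhom_0[OF assms])

lemma rhom_sum: assumes "rhom h" shows "h (sum f S) = (\<Sum>i\<in>S. h (f i))"
  by (induction S rule: infinite_finite_induct) (simp_all add: rhom_add[OF assms] rhom_0[OF assms])

lemma rhom_dvd: assumes "rhom h" "a dvd b" shows "h a dvd h b"
  using assms(2) by (auto simp: rhom_mult[OF assms(1)] elim!: dvdE)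

lemmas rhom_simps = rhom_add rhom_mult rhom_uminus rhom_diff rhom_power rhom_sum rhom_of_nat rhom_0 rhom_1

lemma rhom_id: "rhom (\<lambda>a. a)"
  by (simp add: rhom_def)

lemma rhom_comp: "rhom f \<Longrightarrow> rhom g \<Longrightarrow> rhom (\<lambda>a. f (g a))"
  by (simp add: rhom_def)

lemma rhom_const_poly: "rhom (\<lambda>a. [:a:])"
  by (simp add: rhom_def one_pCons)

lemma rhom_poly: "rhom (\<lambda>p. poly p a)"
  by (simp add: rhom_def)

lemma rhom_coeff_0: "rhom (\<lambda>p. coeff p 0)"
  by (simp add: rhom_def coeff_mult)

lemma rhom_map_poly:
  assumes "rhom h"
  shows "rhom (map_poly h)"
proof (rule rhomI)
  note hs = rhom_simps[OF assms]
  show "map_poly h 1 = 1"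
    by (simp add: hs)
  show add: "map_poly h (a + b) = map_poly h a + map_poly h b" for a b
    by (intro poly_eqI) (simp add: coeff_map_poly hs)
  show "map_poly h (a * b) = map_poly h a * map_poly h b" for a b
    by (intro poly_eqI) (simp add: coeff_map_poly coeff_mult hs)
qed

text \<open>Universal property of a polynomial ring: the extension of \<open>h\<close> that sends
  the variable to \<open>b\<close>. The substitutions \<open>hom3\<close>, \<open>hom4\<close> and
  \<open>subst2\<close> iterate it.\<close>

definition lift_hom :: "('a::comm_ring_1 \<Rightarrow> 'b::comm_ring_1) \<Rightarrow> 'b \<Rightarrow> 'a poly \<Rightarrow> 'b" where
  "lift_hom h b p = poly (map_poly h p) b"

lemma rhom_lift_hom: "rhom h \<Longrightarrow> rhom (lift_hom h b)"
  unfolding lift_hom_def using rhom_comp[OF rhom_poly rhom_map_poly] by blast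

lemma lift_hom_const: assumes "rhom h" shows "lift_hom h b [:a:] = h a"
  by (simp add: lift_hom_def map_poly_pCons rhom_simps[OF assms])

lemma lift_hom_X: assumes "rhom h" shows "lift_hom h b [:0, 1:] = b"
  by (simp add: lift_hom_def map_poly_pCons rhom_simps[OF assms])

lemma pCons_eq: "pCons (a::'a::comm_ring_1) p = [:a:] + [:0, 1:] * p"
  by simp

lemma rhom_poly_eqI:
  assumes "rhom f" "rhom g" "\<And>a. f [:a:] = g [:a:]" "f [:0, 1:] = g [:0, 1:]"
  shows "f p = g p"
proof (induction p)
  case 0
  then show ?case by (simp add: rhom_0[OF assms(1)] rhom_0[OF assms(2)])
next
  case (pCons a p)
  then show ?case
    by (subst (1 2) pCons_eq)
      (simp only: rhom_simps[OF assms(1)] rhom_simps[OF assms(2)] assms(3,4))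
qed

lemma poly_gen_induct [case_names const X add mult]:
  fixes p :: "'a::comm_ring_1 poly"
  assumes "\<And>a. Q [:a:]" "Q [:0, 1:]"
    "\<And>p q. Q p \<Longrightarrow> Q q \<Longrightarrow> Q (p + q)" "\<And>p q. Q p \<Longrightarrow> Q q \<Longrightarrow> Q (p * q)"
  shows "Q p"
proof (induction p)
  case 0
  then show ?case using assms(1)[of 0] by simp
next
  case (pCons a p)
  then show ?case
    using assms by (subst pCons_eq) blast
qed

lemma mult_eq_1_poly:
  fixes p q :: "'a::idom poly"
  assumes "p * q = 1"
  shows "\<exists>a b. p = [:a:] \<and> q = [:b:] \<and> a * b = 1"
proof -
  have "p \<noteq> 0" "q \<noteq> 0" using assms by auto
  then have "degree p + degree q = 0"
    using assms by (metis degree_1 degree_mult_eq)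
  then obtain a b where "p = [:a:]" "q = [:b:]"
    by (metis add_is_0 degree_0_id)
  then show ?thesis using assms by (simp add: one_pCons mult.commute)
qed

section \<open>The two iterated polynomial rings\<close>

type_synonym poly3 = "complex poly poly poly"

lemma poly3_gen_induct [case_names const x z t add mult]:
  fixes p :: poly3
  assumes c: "\<And>a. Q [:[:[:a:]:]:]" and x: "Q [:[:[:0, 1:]:]:]" and z: "Q [:[:0, 1:]:]" and t: "Q [:0, 1:]"
    and add: "\<And>p q. Q p \<Longrightarrow> Q q \<Longrightarrow> Q (p + q)" and mult: "\<And>p q. Q p \<Longrightarrow> Q q \<Longrightarrow> Q (p * q)"
  shows "Q p"
proof (induction p rule: poly_gen_induct)
  case (const a)
  show ?case
  proof (induction a rule: poly_gen_induct)
    case (const a)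
    show ?case
    proof (induction a rule: poly_gen_induct)
      case (add p q)
      then show ?case using assms(5)[of "[:[:p:]:]" "[:[:q:]:]"] by simp
    next
      case (mult p q)
      then show ?case using assms(6)[of "[:[:p:]:]" "[:[:q:]:]"] by (simp add: mult.commute)
    qed (use c x in auto)
  next
    case (add p q)
    then show ?case using assms(5)[of "[:p:]" "[:q:]"] by simp
  next
    case (mult p q)
    then show ?case using assms(6)[of "[:p:]" "[:q:]"] by (simp add: mult.commute)
  qed (use z in auto)
qed (use t add mult in auto)

lemma poly4_gen_induct [case_names const x z t y add mult]:
  fixes p :: poly4
  assumes c: "\<And>a. Q (const4 a)" and x: "Q var_x" and z: "Q var_z" and t: "Q var_t" and y: "Q var_y"
    and add: "\<And>p q. Q p \<Longrightarrow> Q q \<Longrightarrow> Q (p + q)" and mult: "\<And>p q. Q p \<Longrightarrow> Q q \<Longrightarrow> Q (p * q)"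
  shows "Q p"
proof (induction p rule: poly_gen_induct)
  case (const a)
  show ?case
  proof (induction a rule: poly3_gen_induct)
    case (add p q)
    then show ?case using assms(6)[of "[:p:]" "[:q:]"] by simp
  next
    case (mult p q)
    then show ?case using assms(7)[of "[:p:]" "[:q:]"] by (simp add: mult.commute)
  qed (use c x z t in \<open>auto simp: const4_def var_x_def var_z_def var_t_def\<close>)
qed (use y add mult in \<open>auto simp: var_y_def\<close>)

lemma rhom_poly3_eqI:
  fixes f g :: "poly3 \<Rightarrow> 'a::comm_ring_1"
  assumes "rhom f" "rhom g" "\<And>c. f [:[:[:c:]:]:] = g [:[:[:c:]:]:]" "f [:[:[:0, 1:]:]:] = g [:[:[:0, 1:]:]:]"
    "f [:[:0, 1:]:] = g [:[:0, 1:]:]" "f [:0, 1:] = g [:0, 1:]"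
  shows "f p = g p"
  by (induction p rule: poly3_gen_induct)
    (simp_all only: rhom_simps[OF assms(1)] rhom_simps[OF assms(2)] assms(3-))

lemma rhom_poly4_eqI:
  fixes f g :: "poly4 \<Rightarrow> 'a::comm_ring_1"
  assumes "rhom f" "rhom g" "\<And>c. f (const4 c) = g (const4 c)" "f var_x = g var_x"
    "f var_z = g var_z" "f var_t = g var_t" "f var_y = g var_y"
  shows "f p = g p"
  by (induction p rule: poly4_gen_induct)
    (simp_all only: rhom_simps[OF assms(1)] rhom_simps[OF assms(2)] assms(3-))

definition hom3 :: "(complex \<Rightarrow> 'a::comm_ring_1) \<Rightarrow> 'a \<Rightarrow> 'a \<Rightarrow> 'a \<Rightarrow> poly3 \<Rightarrow> 'a" where
  "hom3 h x z t = lift_hom (lift_hom (lift_hom h x) z) t"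

definition hom4 :: "(complex \<Rightarrow> 'a::comm_ring_1) \<Rightarrow> 'a \<Rightarrow> 'a \<Rightarrow> 'a \<Rightarrow> 'a \<Rightarrow> poly4 \<Rightarrow> 'a" where
  "hom4 h x z t y = lift_hom (hom3 h x z t) y"

lemma rhom_hom3: "rhom h \<Longrightarrow> rhom (hom3 h x z t)"
  unfolding hom3_def by (intro rhom_lift_hom)

lemma rhom_hom4: "rhom h \<Longrightarrow> rhom (hom4 h x z t y)"
  unfolding hom4_def by (intro rhom_lift_hom rhom_hom3)

lemma hom3_gen:
  assumes "rhom h"
  shows "hom3 h x z t [:[:[:c:]:]:] = h c" "hom3 h x z t [:[:[:0, 1:]:]:] = x"
    "hom3 h x z t [:[:0, 1:]:] = z" "hom3 h x z t [:0, 1:] = t"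
  using assms by (simp_all add: hom3_def rhom_lift_hom lift_hom_const lift_hom_X)

lemma hom4_gen:
  assumes "rhom h"
  shows "hom4 h x z t y (const4 c) = h c" "hom4 h x z t y var_x = x"
    "hom4 h x z t y var_z = z" "hom4 h x z t y var_t = t" "hom4 h x z t y var_y = y"
    "hom4 h x z t y [:b:] = hom3 h x z t b"
  using assms by (simp_all add: hom4_def rhom_hom3 hom3_gen lift_hom_const lift_hom_X const4_def var_x_def var_z_def var_t_def var_y_def)

lemma rhom_const4: "rhom const4"
  by (simp add: rhom_def const4_def one_pCons)

section \<open>Two-variable polynomials over a domain: derivations and brackets\<close>

definition Zv :: "'a::comm_ring_1 poly poly" where "Zv = [:[:0, 1:]:]"
definition Tv :: "'a::comm_ring_1 poly poly" where "Tv = [:0, 1:]"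

definition cst :: "'a::comm_ring_1 \<Rightarrow> 'a poly poly" where "cst a = [:[:a:]:]"

lemma rhom_cst: "rhom cst"
  by (simp add: rhom_def cst_def one_pCons)

lemmas cst_simps = rhom_simps[OF rhom_cst]

lemma poly2_gen_induct [case_names const z t add mult]:
  fixes p :: "'a::comm_ring_1 poly poly"
  assumes c: "\<And>a. Q (cst a)" and z: "Q Zv" and t: "Q Tv"
    and add: "\<And>p q. Q p \<Longrightarrow> Q q \<Longrightarrow> Q (p + q)" and mult: "\<And>p q. Q p \<Longrightarrow> Q q \<Longrightarrow> Q (p * q)"
  shows "Q p"
proof (induction p rule: poly_gen_induct)
  case (const a)
  show ?case
  proof (induction a rule: poly_gen_induct)
    case (add p q)
    then show ?case using assms(4)[of "[:p:]" "[:q:]"] by simp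
  next
    case (mult p q)
    then show ?case using assms(5)[of "[:p:]" "[:q:]"] by (simp add: mult.commute)
  qed (use c z in \<open>auto simp: cst_def Zv_def\<close>)
qed (use t add mult in \<open>auto simp: Tv_def\<close>)

lemma rhom_poly2_eqI:
  fixes f g :: "'a::comm_ring_1 poly poly \<Rightarrow> 'b::comm_ring_1"
  assumes "rhom f" "rhom g" "\<And>c. f (cst c) = g (cst c)" "f Zv = g Zv" "f Tv = g Tv"
  shows "f p = g p"
  by (induction p rule: poly2_gen_induct)
    (simp_all only: rhom_simps[OF assms(1)] rhom_simps[OF assms(2)] assms(3-))

definition subst2 :: "('a::comm_ring_1 \<Rightarrow> 'b::comm_ring_1) \<Rightarrow> 'b \<Rightarrow> 'b \<Rightarrow> 'a poly poly \<Rightarrow> 'b" where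
  "subst2 h z t = lift_hom (lift_hom h z) t"

lemma rhom_subst2: "rhom h \<Longrightarrow> rhom (subst2 h z t)"
  unfolding subst2_def by (intro rhom_lift_hom)

lemma subst2_gen:
  assumes "rhom h"
  shows "subst2 h z t (cst a) = h a" "subst2 h z t Zv = z" "subst2 h z t Tv = t"
  using assms by (simp_all add: subst2_def cst_def Zv_def Tv_def rhom_lift_hom lift_hom_const lift_hom_X)

lemma rhom_dvd_diff:
  fixes f g :: "'a::comm_ring_1 poly poly \<Rightarrow> 'b::comm_ring_1"
  assumes "rhom f" "rhom g" "\<And>c. m dvd f (cst c) - g (cst c)" "m dvd f Zv - g Zv" "m dvd f Tv - g Tv"
  shows "m dvd f p - g p"
proof (induction p rule: poly2_gen_induct)
  case (add p q)
  have "f (p + q) - g (p + q) = (f p - g p) + (f q - g q)"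
    by (simp add: rhom_simps[OF assms(1)] rhom_simps[OF assms(2)])
  then show ?case using add by simp
next
  case (mult p q)
  have "f (p * q) - g (p * q) = (f p - g p) * f q + g p * (f q - g q)"
    by (simp add: rhom_simps[OF assms(1)] rhom_simps[OF assms(2)] algebra_simps)
  then show ?case using mult by simp
qed (use assms in auto)

definition dz :: "'a::idom poly poly \<Rightarrow> 'a poly poly" where "dz = map_poly pderiv"
definition dt :: "'a::idom poly poly \<Rightarrow> 'a poly poly" where "dt = pderiv"

lemma dz_add: "dz (f + g) = dz f + dz g"
  by (rule poly_eqI) (simp add: dz_def coeff_map_poly pderiv_add)

lemma dz_mult: "dz (f * g) = dz f * g + f * dz g"
proof (rule poly_eqI)
  fix n
  have s: "pderiv (sum h A) = (\<Sum>i\<in>A. pderiv (h i))" for h :: "nat \<Rightarrow> 'a poly" and A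
    by (induction A rule: infinite_finite_induct) (simp_all add: pderiv_add)
  show "coeff (dz (f * g)) n = coeff (dz f * g + f * dz g) n"
    unfolding dz_def
    by (simp add: coeff_map_poly coeff_mult s pderiv_mult flip: sum.distrib)
      (simp add: algebra_simps)
qed

lemma dt_add: "dt (f + g) = dt f + dt g"
  by (simp add: dt_def pderiv_add)

lemma dt_mult: "dt (f * g) = dt f * g + f * dt g"
  by (simp add: dt_def pderiv_mult algebra_simps)

lemma dz_gen: "dz (cst a) = 0" "dz Zv = 1" "dz Tv = 0" "dz 0 = 0" "dz 1 = 0"
  by (simp_all add: dz_def cst_def Zv_def Tv_def map_poly_pCons pderiv_pCons one_pCons)

lemma dt_gen: "dt (cst a) = 0" "dt Zv = 0" "dt Tv = 1" "dt 0 = 0" "dt 1 = 0"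
  by (simp_all add: dt_def cst_def Zv_def Tv_def pderiv_pCons one_pCons)

lemma dz_uminus: "dz (- f) = - dz f"
  using dz_add[of f "- f"] by (simp add: dz_gen eq_neg_iff_add_eq_0 add.commute)

lemma dt_uminus: "dt (- f) = - dt f"
  using dt_add[of f "- f"] by (simp add: dt_gen eq_neg_iff_add_eq_0 add.commute)

lemma dz_diff: "dz (f - g) = dz f - dz g"
  using dz_add[of f "- g"] by (simp add: dz_uminus)

lemma dt_diff: "dt (f - g) = dt f - dt g"
  using dt_add[of f "- g"] by (simp add: dt_uminus)

lemma dz_power: "dz (f ^ Suc n) = of_nat (Suc n) * f ^ n * dz f"
  by (induction n) (simp_all add: dz_mult algebra_simps)

lemma dt_power: "dt (f ^ Suc n) = of_nat (Suc n) * f ^ n * dt f"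
  by (induction n) (simp_all add: dt_mult algebra_simps)

lemma dz_of_nat: "dz (of_nat n) = 0"
  by (induction n) (simp_all add: dz_gen dz_add)

lemma dt_of_nat: "dt (of_nat n) = 0"
  by (induction n) (simp_all add: dt_gen dt_add)

lemma dz_sum: "dz (sum f A) = (\<Sum>i\<in>A. dz (f i))"
  by (induction A rule: infinite_finite_induct) (simp_all add: dz_gen dz_add)

lemma dt_sum: "dt (sum f A) = (\<Sum>i\<in>A. dt (f i))"
  by (induction A rule: infinite_finite_induct) (simp_all add: dt_gen dt_add)

lemma dz_cst_power: "dz (cst a ^ n) = 0" and dt_cst_power: "dt (cst a ^ n) = 0"
  by (simp_all add: dz_gen dt_gen flip: cst_simps)

lemmas dz_simps = dz_add dz_mult dz_gen dz_uminus dz_diff dz_cst_power dz_of_nat dz_sum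
lemmas dt_simps = dt_add dt_mult dt_gen dt_uminus dt_diff dt_cst_power dt_of_nat dt_sum

lemma dz_dt_commute: "dz (dt f) = dt (dz f)"
  by (induction f rule: poly2_gen_induct) (simp_all add: dz_simps dt_simps)

lemma dz_dvd: "cst a ^ n dvd f \<Longrightarrow> cst a ^ n dvd dz f"
  by (auto simp: dz_simps elim!: dvdE)

lemma dt_dvd: "cst a ^ n dvd f \<Longrightarrow> cst a ^ n dvd dt f"
  by (auto simp: dt_simps elim!: dvdE)

text \<open>The Jacobian determinant in \<open>z\<close> and \<open>t\<close>, read also as the
  Poisson bracket: \<open>f \<mapsto> bracket f h\<close> is the Hamiltonian vector field of
  \<open>h\<close>.\<close>

definition bracket :: "'a::idom poly poly \<Rightarrow> 'a poly poly \<Rightarrow> 'a poly poly" where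
  "bracket f g = dz f * dt g - dt f * dz g"

lemma bracket_cong:
  assumes "cst a ^ n dvd f - f'" "cst a ^ n dvd g - g'"
  shows "cst a ^ n dvd bracket f g - bracket f' g'"
proof -
  have "bracket f g - bracket f' g' = (dz (f - f') * dt g + dz f' * dt (g - g'))
      - (dt (f - f') * dz g + dt f' * dz (g - g'))"
    by (simp add: bracket_def dz_simps dt_simps algebra_simps)
  then show ?thesis
    using assms by (simp only: dvd_diff dvd_add dvd_mult dvd_mult2 dz_dvd dt_dvd)
qed

lemma chain_rule:
  assumes T: "rhom T" and c: "\<And>a. T (cst a) = cst (\<theta> a)"
  shows "dz (T f) = T (dz f) * dz (T Zv) + T (dt f) * dz (T Tv)"
    and "dt (T f) = T (dz f) * dt (T Zv) + T (dt f) * dt (T Tv)"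
proof -
  note Ts = rhom_simps[OF T]
  show "dz (T f) = T (dz f) * dz (T Zv) + T (dt f) * dz (T Tv)"
    by (induction f rule: poly2_gen_induct) (simp_all add: Ts c dz_simps dt_simps algebra_simps)
  show "dt (T f) = T (dz f) * dt (T Zv) + T (dt f) * dt (T Tv)"
    by (induction f rule: poly2_gen_induct) (simp_all add: Ts c dz_simps dt_simps algebra_simps)
qed

lemma bracket_chain:
  assumes T: "rhom T" and c: "\<And>a. T (cst a) = cst (\<theta> a)"
  shows "bracket (T f) (T g) = T (bracket f g) * bracket (T Zv) (T Tv)"
  unfolding bracket_def chain_rule[OF assms, of f] chain_rule[OF assms, of g]
  by (simp add: rhom_simps[OF T] algebra_simps)

section \<open>Lifting special automorphisms modulo a power of a scalar\<close>

definition aut2 :: "('a::idom poly poly \<Rightarrow> 'a poly poly) \<Rightarrow> ('a poly poly \<Rightarrow> 'a poly poly) \<Rightarrow> bool" where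
  "aut2 T S \<longleftrightarrow> rhom T \<and> rhom S \<and> (\<forall>a. T (cst a) = cst a) \<and> (\<forall>a. S (cst a) = cst a) \<and>
     (\<forall>f. T (S f) = f) \<and> (\<forall>f. S (T f) = f)"

lemma aut2_comp: "aut2 T S \<Longrightarrow> aut2 T' S' \<Longrightarrow> aut2 (\<lambda>f. T (T' f)) (\<lambda>f. S' (S f))"
  by (simp add: aut2_def rhom_comp)

lemma aut2_id: "aut2 (\<lambda>f. f) (\<lambda>f. f)"
  by (simp add: aut2_def rhom_id)

lemma aut2_sym: "aut2 T S \<Longrightarrow> aut2 S T"
  by (simp add: aut2_def)

text \<open>\<open>T\<close> agrees with the time \<open>\<xi>\<^sup>n\<close> flow of the Hamiltonian vector field of \<open>h\<close> modulo \<open>\<xi>\<^bsup>n+1\<^esup>\<close>.\<close>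

definition tangent :: "'a::idom \<Rightarrow> nat \<Rightarrow> 'a poly poly \<Rightarrow> ('a poly poly \<Rightarrow> 'a poly poly) \<Rightarrow> bool" where
  "tangent \<xi> n h T \<longleftrightarrow> cst \<xi> ^ Suc n dvd T Zv - (Zv + cst \<xi> ^ n * dt h) \<and>
     cst \<xi> ^ Suc n dvd T Tv - (Tv - cst \<xi> ^ n * dz h)"

lemma near_id:
  assumes "rhom T" "\<And>a. T (cst a) = cst a" "m dvd T Zv - Zv" "m dvd T Tv - Tv"
  shows "m dvd T f - f"
  by (rule rhom_dvd_diff[OF assms(1) rhom_id]) (use assms in auto)

lemma tangent_near_id:
  assumes "rhom T" "\<And>a. T (cst a) = cst a" "tangent \<xi> n h T"
  shows "cst \<xi> ^ n dvd T f - f"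
proof (rule near_id[OF assms(1,2)])
  have *: "cst \<xi> ^ n dvd cst \<xi> ^ Suc n" by (simp add: le_imp_power_dvd)
  have "T Zv - Zv = (T Zv - (Zv + cst \<xi> ^ n * dt h)) + cst \<xi> ^ n * dt h"
    "T Tv - Tv = (T Tv - (Tv - cst \<xi> ^ n * dz h)) - cst \<xi> ^ n * dz h"
    by simp_all
  moreover have "cst \<xi> ^ n dvd T Zv - (Zv + cst \<xi> ^ n * dt h)" "cst \<xi> ^ n dvd T Tv - (Tv - cst \<xi> ^ n * dz h)"
    using assms(3) * unfolding tangent_def by (meson dvd_trans)+
  ultimately show "cst \<xi> ^ n dvd T Zv - Zv" "cst \<xi> ^ n dvd T Tv - Tv"
    by (metis dvd_add dvd_diff dvd_triv_left)+
qed

text \<open>First-order terms add up: \<open>T\<close> changes the first-order term of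
  \<open>T'\<close> only by multiples of \<open>\<xi>^(2n)\<close>, and \<open>2n\<close> is at
  least \<open>n + 1\<close>.\<close>

lemma tangent_comp:
  assumes T: "rhom T" "\<And>a. T (cst a) = cst a" and n: "n \<ge> 1"
    and t: "tangent \<xi> n h T" "tangent \<xi> n h' T'"
  shows "tangent \<xi> n (h + h') (\<lambda>f. T (T' f))"
proof -
  note Ts = rhom_simps[OF T(1)]
  have TX: "T (cst \<xi> ^ m) = cst \<xi> ^ m" for m
    by (simp add: Ts T(2))
  have XX: "cst \<xi> ^ Suc n dvd cst \<xi> ^ n * cst \<xi> ^ n"
    unfolding power_add[symmetric] using n by (intro le_imp_power_dvd) simp
  have d: "cst \<xi> ^ Suc n dvd cst \<xi> ^ n * (T f - f)" for f
    using tangent_near_id[OF T t(1), of f] XX by (meson dvd_refl dvd_trans mult_dvd_mono)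
  obtain w where w: "T' Zv - (Zv + cst \<xi> ^ n * dt h') = cst \<xi> ^ Suc n * w"
    using t(2) unfolding tangent_def by (elim conjE dvdE)
  obtain w' where w': "T' Tv - (Tv - cst \<xi> ^ n * dz h') = cst \<xi> ^ Suc n * w'"
    using t(2) unfolding tangent_def by (elim conjE dvdE)
  have "T' Zv = Zv + cst \<xi> ^ n * dt h' + cst \<xi> ^ Suc n * w"
    using w by (simp add: algebra_simps)
  then have "T (T' Zv) = T Zv + cst \<xi> ^ n * T (dt h') + cst \<xi> ^ Suc n * T w"
    by (simp only: rhom_add[OF T(1)] rhom_mult[OF T(1)] TX)
  then have e1: "T (T' Zv) - (Zv + cst \<xi> ^ n * dt (h + h')) =
      (T Zv - (Zv + cst \<xi> ^ n * dt h)) + cst \<xi> ^ n * (T (dt h') - dt h') + cst \<xi> ^ Suc n * T w"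
    by (simp add: dt_add algebra_simps)
  have d1: "cst \<xi> ^ Suc n dvd T (T' Zv) - (Zv + cst \<xi> ^ n * dt (h + h'))" unfolding e1
    by (rule dvd_add[OF dvd_add]) (use t(1) d in \<open>auto simp: tangent_def simp del: power_Suc\<close>)
  have "T' Tv = Tv - cst \<xi> ^ n * dz h' + cst \<xi> ^ Suc n * w'"
    using w' by (simp add: algebra_simps)
  then have "T (T' Tv) = T Tv - cst \<xi> ^ n * T (dz h') + cst \<xi> ^ Suc n * T w'"
    by (simp only: rhom_add[OF T(1)] rhom_diff[OF T(1)] rhom_mult[OF T(1)] TX)
  then have e2: "T (T' Tv) - (Tv - cst \<xi> ^ n * dz (h + h')) =
      (T Tv - (Tv - cst \<xi> ^ n * dz h)) - cst \<xi> ^ n * (T (dz h') - dz h') + cst \<xi> ^ Suc n * T w'"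
    by (simp add: dz_add algebra_simps)
  have d2: "cst \<xi> ^ Suc n dvd T (T' Tv) - (Tv - cst \<xi> ^ n * dz (h + h'))" unfolding e2
    by (rule dvd_add[OF dvd_diff]) (use t(1) d in \<open>auto simp: tangent_def simp del: power_Suc\<close>)
  from d1 d2 show ?thesis
    unfolding tangent_def by blast
qed

text \<open>The potentials whose flow is matched to first order by a polynomial automorphism of
  Jacobian one. The inverse is carried along with its own estimates, so that composing two
  realizations is immediate.\<close>

definition realizable :: "'a::idom \<Rightarrow> nat \<Rightarrow> 'a poly poly \<Rightarrow> bool" where
  "realizable \<xi> n h \<longleftrightarrow> (\<exists>T S. aut2 T S \<and> bracket (T Zv) (T Tv) = 1 \<and> bracket (S Zv) (S Tv) = 1 \<and>
     tangent \<xi> n h T \<and> tangent \<xi> n (- h) S)"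

lemma bracket_comp:
  assumes "aut2 T S" "aut2 T' S'" "bracket (T Zv) (T Tv) = 1" "bracket (T' Zv) (T' Tv) = 1"
  shows "bracket (T (T' Zv)) (T (T' Tv)) = 1"
proof -
  have T: "rhom T" "\<And>a. T (cst a) = cst a" using assms by (auto simp: aut2_def)
  show ?thesis
    using bracket_chain[OF T(1), of "\<lambda>a. a"] T(2) assms(3,4) by (simp add: rhom_simps[OF T(1)])
qed

lemma realizable_add:
  assumes "n \<ge> 1" "realizable \<xi> n h" "realizable \<xi> n h'"
  shows "realizable \<xi> n (h + h')"
proof -
  obtain T S where 1: "aut2 T S" "bracket (T Zv) (T Tv) = 1" "bracket (S Zv) (S Tv) = 1"
     "tangent \<xi> n h T" "tangent \<xi> n (- h) S" using assms unfolding realizable_def by blast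
  obtain T' S' where 2: "aut2 T' S'" "bracket (T' Zv) (T' Tv) = 1" "bracket (S' Zv) (S' Tv) = 1"
     "tangent \<xi> n h' T'" "tangent \<xi> n (- h') S'" using assms unfolding realizable_def by blast
  have "tangent \<xi> n (h + h') (\<lambda>f. T (T' f))"
    using tangent_comp[of T n \<xi> h h' T'] 1 2 assms(1) by (auto simp: aut2_def)
  moreover have "tangent \<xi> n (- (h + h')) (\<lambda>f. S' (S f))"
  proof -
    have eq: "- (h + h') = - h' + - h" by simp
    show ?thesis
      unfolding eq by (rule tangent_comp) (use 1 2 assms(1) in \<open>auto simp: aut2_def\<close>)
  qed
  moreover have "bracket (T (T' Zv)) (T (T' Tv)) = 1" "bracket (S' (S Zv)) (S' (S Tv)) = 1"
    using 1 2 bracket_comp[of T S T' S'] bracket_comp[of S' T' S T] by (auto intro: aut2_sym)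
  ultimately show ?thesis
    unfolding realizable_def using aut2_comp[OF 1(1) 2(1)] by blast
qed

text \<open>The Hamiltonian field of a function of \<open>L = z + a t\<close> is a multiple of
  \<open>a \<partial>z - \<partial>t\<close> by a function of \<open>L\<close>, and it kills
  \<open>L\<close>. Its flow is therefore a shear along the level lines of \<open>L\<close>, linear
  in time and inverted by changing the sign of \<open>\<gamma>\<close>.\<close>

lemma realizable_shear:
  "realizable \<xi> n (cst \<gamma> * (Zv + cst a * Tv) ^ m)"
proof (cases m)
  case 0
  then show ?thesis
    unfolding realizable_def tangent_def
    by (intro exI[of _ "\<lambda>f. f"]) (simp add: aut2_id bracket_def dz_simps dt_simps)
next
  case (Suc j)
  define L :: "'a poly poly" where "L = Zv + cst a * Tv"
  define w where "w \<gamma> = of_nat (Suc j) * cst \<gamma> * L ^ j" for \<gamma>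
  define E where "E = cst \<xi> ^ n"
  define h where "h \<gamma> = cst \<gamma> * L ^ Suc j" for \<gamma>
  have L: "dz L = 1" "dt L = cst a"
    by (simp_all add: L_def dz_simps dt_simps)
  have hz: "dz (h \<gamma>) = w \<gamma>" for \<gamma>
    by (simp add: h_def dz_mult dz_gen dz_power w_def L algebra_simps del: power_Suc)
  have ht: "dt (h \<gamma>) = cst a * w \<gamma>" for \<gamma>
    by (simp add: h_def dt_mult dt_gen dt_power w_def L algebra_simps del: power_Suc)
  define T where "T \<gamma> = subst2 cst (Zv + E * (cst a * w \<gamma>)) (Tv - E * w \<gamma>)" for \<gamma>
  have rT: "rhom (T \<gamma>)" for \<gamma>
    by (simp add: T_def rhom_subst2 rhom_cst)
  have Tg: "T \<gamma> (cst b) = cst b" "T \<gamma> Zv = Zv + E * (cst a * w \<gamma>)" "T \<gamma> Tv = Tv - E * w \<gamma>" for \<gamma> b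
    by (simp_all only: T_def subst2_gen[OF rhom_cst])
  have TL: "T \<gamma> L = L" for \<gamma>
    unfolding L_def rhom_add[OF rT] rhom_mult[OF rT] Tg by (simp add: algebra_simps)
  have Tw: "T \<gamma> (w \<gamma>') = w \<gamma>'" for \<gamma> \<gamma>'
    by (simp add: w_def rhom_simps[OF rT] Tg TL)
  have TE: "T \<gamma> E = E" for \<gamma>
    by (simp add: E_def rhom_simps[OF rT] Tg)
  have wm: "w (- \<gamma>) = - w \<gamma>" for \<gamma>
    by (simp add: w_def cst_simps)
  have inv: "T \<gamma> (T (- \<gamma>) f) = f" for f \<gamma>
  proof (rule rhom_poly2_eqI[OF rhom_comp[OF rT rT] rhom_id])
    show "T \<gamma> (T (- \<gamma>) Zv) = Zv"
      unfolding Tg(2)[of "- \<gamma>"] rhom_add[OF rT] rhom_mult[OF rT] TE wm rhom_uminus[OF rT] Tw Tg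
      by (simp add: algebra_simps)
    show "T \<gamma> (T (- \<gamma>) Tv) = Tv"
      unfolding Tg(3)[of "- \<gamma>"] rhom_diff[OF rT] rhom_mult[OF rT] TE wm rhom_uminus[OF rT] Tw Tg
      by (simp add: algebra_simps)
  qed (simp add: Tg)
  have aut: "aut2 (T \<gamma>) (T (- \<gamma>))"
    using inv[of \<gamma>] inv[of "- \<gamma>"] by (simp add: aut2_def rT Tg)
  have wt: "dt (w \<gamma>) = cst a * dz (w \<gamma>)" for \<gamma>
    using ht[of \<gamma>] hz[of \<gamma>] dz_dt_commute[of "h \<gamma>"] by (simp add: dz_simps)
  have ED: "dz E = 0" "dt E = 0" by (simp_all add: E_def dz_simps dt_simps)
  have br: "bracket (T \<gamma> Zv) (T \<gamma> Tv) = 1" for \<gamma>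
    unfolding Tg bracket_def
    by (simp add: dz_simps dt_simps ED wt algebra_simps)
  have hm: "- h \<gamma> = h (- \<gamma>)" for \<gamma> by (simp add: h_def cst_simps)
  have tan: "tangent \<xi> n (h \<gamma>) (T \<gamma>)" for \<gamma>
    unfolding tangent_def Tg hz ht E_def by simp
  have "realizable \<xi> n (h \<gamma>)"
    unfolding realizable_def hm using aut br tan by blast
  then show ?thesis by (simp add: h_def L_def Suc)
qed

text \<open>Domains containing the rational numbers. The condition by divisibility passes to
  polynomial rings, which are needed as scalars: polynomials in \<open>x\<close>, and polynomials in
  \<open>x\<close> and \<open>c\<close>.\<close>

class rat_domain = idom + ring_char_0 +
  assumes of_nat_dvd_1: "n \<noteq> 0 \<Longrightarrow> of_nat n dvd 1"
begin

lemma of_nat_inverse: "n \<noteq> 0 \<Longrightarrow> \<exists>c. of_nat n * c = 1"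
  using of_nat_dvd_1[of n] by (metis dvdE)

end

instance complex :: rat_domain
  by standard (simp add: dvd_field_iff)

instance poly :: (rat_domain) rat_domain
proof
  fix n :: nat assume "n \<noteq> 0"
  then obtain c :: 'a where "of_nat n * c = 1" using of_nat_inverse by blast
  then have "of_nat n * [:c:] = 1" by (simp add: of_nat_poly one_pCons mult.commute)
  then show "(of_nat n :: 'a poly) dvd 1" by (metis dvd_triv_left)
qed

text \<open>Comparing the values at \<open>a\<close> and \<open>2a\<close> removes the leading coefficient.\<close>

lemma coeffs_in_submodule:
  fixes c :: "nat \<Rightarrow> 'a::rat_domain poly poly"
  assumes add: "\<And>f g. W f \<Longrightarrow> W g \<Longrightarrow> W (f + g)" and scal: "\<And>a f. W f \<Longrightarrow> W (cst a * f)"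
    and zero: "W 0"
  shows "(\<And>a. W (\<Sum>i\<le>n. of_nat a ^ i * c i)) \<Longrightarrow> i \<le> n \<Longrightarrow> W (c i)"
proof (induction n arbitrary: c i)
  case 0
  show ?case using 0(1)[of 0] 0(2) by simp
next
  case (Suc n)
  have minus: "W f \<Longrightarrow> W (- f)" for f
    using scal[of f "- 1"] by (simp add: cst_simps)
  have diff: "W f \<Longrightarrow> W g \<Longrightarrow> W (f - g)" for f g
    using add[of f "- g"] minus[of g] by simp
  define N where "N = Suc n"
  have nat: "W (of_nat k * f)" if "W f" for k f
    using scal[OF that, of "of_nat k"] by (simp add: cst_simps)
  have *: "W (of_nat (2 ^ N - 2 ^ i) * c i)" if "i \<le> n" for i
  proof (rule Suc.IH[OF _ that])
    fix a :: nat
    have "(\<Sum>i\<le>n. of_nat a ^ i * (of_nat (2 ^ N - 2 ^ i) * c i)) =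
        of_nat (2 ^ N) * (\<Sum>i\<le>N. of_nat a ^ i * c i) - (\<Sum>i\<le>N. of_nat (2 * a) ^ i * c i)"
    proof -
      have "(\<Sum>i\<le>n. of_nat a ^ i * (of_nat (2 ^ N - 2 ^ i) * c i)) =
          (\<Sum>i\<le>n. of_nat (2 ^ N) * (of_nat a ^ i * c i) - of_nat (2 * a) ^ i * c i)"
      proof (intro sum.cong refl)
        fix i assume "i \<in> {..n}"
        then have "2 ^ i \<le> (2::nat) ^ N" by (intro power_increasing) (auto simp: N_def)
        then have e: "(of_nat (2 ^ N - 2 ^ i) :: 'a poly poly) = of_nat (2 ^ N) - of_nat (2 ^ i)"
          by (rule of_nat_diff)
        show "of_nat a ^ i * (of_nat (2 ^ N - 2 ^ i) * c i) =
            of_nat (2 ^ N) * (of_nat a ^ i * c i) - of_nat (2 * a) ^ i * c i"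
          unfolding e by (simp add: power_mult_distrib algebra_simps)
      qed
      also have "\<dots> = of_nat (2 ^ N) * (\<Sum>i\<le>n. of_nat a ^ i * c i) - (\<Sum>i\<le>n. of_nat (2 * a) ^ i * c i)"
        by (simp only: sum_subtractf sum_distrib_left)
      also have "\<dots> = of_nat (2 ^ N) * (\<Sum>i\<le>N. of_nat a ^ i * c i) - (\<Sum>i\<le>N. of_nat (2 * a) ^ i * c i)"
        unfolding N_def sum.atMost_Suc by (simp add: power_mult_distrib algebra_simps)
      finally show ?thesis .
    qed
    also have "W \<dots>"
      using Suc.prems(1) by (intro diff nat) (simp_all only: N_def)
    finally show "W (\<Sum>i\<le>n. of_nat a ^ i * (of_nat (2 ^ N - 2 ^ i) * c i))" .
  qed
  have low: "W (c i)" if "i \<le> n" for i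
  proof -
    have "(2::nat) ^ i < 2 ^ N" using that by (intro power_strict_increasing) (auto simp: N_def)
    then obtain u :: 'a where u: "of_nat (2 ^ N - 2 ^ i) * u = 1"
      using of_nat_inverse[of "2 ^ N - 2 ^ i"] by auto
    have "cst u * (of_nat (2 ^ N - 2 ^ i) * c i) = cst (of_nat (2 ^ N - 2 ^ i) * u) * c i"
      by (simp only: cst_simps ac_simps)
    also have "\<dots> = c i" by (simp add: u cst_simps)
    finally show ?thesis using scal[OF *[OF that], of u] by (simp only:)
  qed
  show ?case
  proof (cases "i \<le> n")
    case False
    then have i: "i = N" using Suc.prems by (simp add: N_def)
    have "W (sum c S)" if "finite S" "S \<subseteq> {..n}" for S
      using that by (induction S) (auto intro: add zero low)
    then have "W ((\<Sum>i\<le>Suc n. of_nat 1 ^ i * c i) - (\<Sum>i\<le>n. c i))"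
      using Suc.prems(1)[of 1] by (intro diff) auto
    then show ?thesis by (simp add: i N_def)
  qed (rule low)
qed

text \<open>Powers of the linear forms \<open>z + a t\<close> span all polynomials: comparing the
  binomial expansion for all natural \<open>a\<close> isolates each monomial up to a binomial
  coefficient, which is invertible.\<close>

lemma realizable_all:
  fixes f :: "'a::rat_domain poly poly"
  assumes n: "n \<ge> 1"
  shows "realizable \<xi> n f"
proof -
  \<comment> \<open>Sums of realizable potentials are handled by composition, but scaling a
    potential is no operation on automorphisms. Quantifying over \<open>\<gamma>\<close> builds
    closure under scalars into \<open>W\<close>.\<close>
  define W where "W f \<longleftrightarrow> (\<forall>\<gamma>. realizable \<xi> n (cst \<gamma> * f))" for f :: "'a poly poly"
  have add: "W f \<Longrightarrow> W g \<Longrightarrow> W (f + g)" for f g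
    unfolding W_def distrib_left using realizable_add[OF n] by blast
  have scal: "W (cst a * f)" if "W f" for a f
    unfolding W_def
  proof
    fix \<gamma>
    have "realizable \<xi> n (cst (\<gamma> * a) * f)" using that by (simp add: W_def)
    then show "realizable \<xi> n (cst \<gamma> * (cst a * f))" by (simp add: cst_simps mult.assoc)
  qed
  have pow: "W ((Zv + cst a * Tv) ^ m)" for a m
    unfolding W_def using realizable_shear by blast
  have zero: "W 0"
    using scal[OF pow[of 0 0], of 0] by (simp add: cst_simps)
  have mon: "W (Tv ^ i * Zv ^ j)" for i j
  proof -
    have "W (of_nat ((i + j) choose i) * (Tv ^ i * Zv ^ (i + j - i)))"
    proof (rule coeffs_in_submodule[where W = W and n = "i + j" and i = i and
          c = "\<lambda>k. of_nat ((i + j) choose k) * (Tv ^ k * Zv ^ (i + j - k))", OF add scal zero])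
      fix a :: nat
      have "(Zv + cst (of_nat a) * Tv) ^ (i + j) =
          (\<Sum>k\<le>i + j. of_nat a ^ k * (of_nat ((i + j) choose k) * (Tv ^ k * Zv ^ (i + j - k))) :: 'a poly poly)"
        unfolding add.commute[of Zv] binomial_ring
        by (intro sum.cong refl) (simp add: power_mult_distrib cst_simps mult_ac)
      then show "W (\<Sum>k\<le>i + j. of_nat a ^ k * (of_nat ((i + j) choose k) * (Tv ^ k * Zv ^ (i + j - k))))"
        using pow[of "of_nat a" "i + j"] by simp
    qed auto
    moreover obtain u :: 'a where u: "of_nat ((i + j) choose i) * u = 1"
      using of_nat_inverse[of "(i + j) choose i"] by auto
    ultimately have "W (cst u * (of_nat ((i + j) choose i) * (Tv ^ i * Zv ^ j)))"
      using scal by simp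
    also have "cst u * (of_nat ((i + j) choose i) * (Tv ^ i * Zv ^ j)) =
        cst (of_nat ((i + j) choose i) * u) * (Tv ^ i * Zv ^ j)"
      by (simp only: cst_simps ac_simps)
    finally show ?thesis by (simp add: u cst_simps)
  qed
  \<comment> \<open>Induction over generators has a product case, which \<open>W\<close> does not
    admit. Asking that \<open>f\<close> times every monomial lie in \<open>W\<close> repairs this:
    multiplication by \<open>z\<close> or \<open>t\<close> only shifts the monomial.\<close>
  define U where "U f \<longleftrightarrow> (\<forall>i j. W (f * (Tv ^ i * Zv ^ j)))" for f :: "'a poly poly"
  have "U g \<Longrightarrow> U (f * g)" for g
  proof (induction f arbitrary: g rule: poly2_gen_induct)
    case (const a)
    then show ?case using scal by (simp add: U_def mult.assoc)
  next
    case z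
    show ?case unfolding U_def
    proof (intro allI)
      fix i j
      have "W (g * (Tv ^ i * Zv ^ Suc j))" using z by (simp add: U_def del: power_Suc)
      then show "W (Zv * g * (Tv ^ i * Zv ^ j))" by (simp add: mult_ac)
    qed
  next
    case t
    show ?case unfolding U_def
    proof (intro allI)
      fix i j
      have "W (g * (Tv ^ Suc i * Zv ^ j))" using t by (simp add: U_def del: power_Suc)
      then show "W (Tv * g * (Tv ^ i * Zv ^ j))" by (simp add: mult_ac)
    qed
  next
    case (add p q)
    then show ?case using assms add.IH[OF add.prems] unfolding U_def
      by (simp add: distrib_right \<open>\<And>f g. W f \<Longrightarrow> W g \<Longrightarrow> W (f + g)\<close>)
  next
    case (mult p q)
    then show ?case by (simp add: mult.assoc)
  qed
  moreover have "U 1" using mon by (simp add: U_def)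
  ultimately have "U f" by fastforce
  then have "W f" using U_def[of f] by (metis mult.right_neutral power_0)
  then show ?thesis unfolding W_def by (metis cst_simps(9) mult_1)
qed

section \<open>Integration, and lifting endomorphisms of Jacobian one modulo a power of
  \<open>\<xi>\<close>\<close>

definition antideriv :: "'a::rat_domain poly \<Rightarrow> 'a poly" where
  "antideriv p = (SOME h. pderiv h = p)"

lemma pderiv_antideriv: "pderiv (antideriv p) = p"
proof -
  have "\<exists>h. pderiv h = p"
  proof -
    obtain u where u: "\<And>n. n \<noteq> 0 \<Longrightarrow> of_nat n * u n = (1::'a)"
      using of_nat_inverse by metis
    have s: "pderiv (sum h A) = (\<Sum>i\<in>A. pderiv (h i))" for h :: "nat \<Rightarrow> 'a poly" and A
      by (induction A rule: infinite_finite_induct) (simp_all add: pderiv_add)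
    have "pderiv (\<Sum>i\<le>degree p. monom (u (Suc i) * coeff p i) (Suc i)) = (\<Sum>i\<le>degree p. monom (coeff p i) i)"
      unfolding s pderiv_monom
      by (intro sum.cong refl) (use u in \<open>simp add: mult.assoc[symmetric] del: of_nat_Suc\<close>)
    then show ?thesis by (metis poly_as_sum_of_monoms)
  qed
  then show ?thesis unfolding antideriv_def by (rule someI_ex)
qed

text \<open>The Poincare lemma modulo \<open>\<xi>\<close>: integrate \<open>a\<close> in
  \<open>t\<close>; the \<open>t\<close>-derivative of the remaining defect is divisible by
  \<open>\<xi>\<close>, so in characteristic zero the defect is free of \<open>t\<close> modulo
  \<open>\<xi>\<close> and can be integrated in \<open>z\<close>.\<close>

lemma potential_mod:
  fixes a b :: "'a::rat_domain poly poly"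
  assumes "cst \<xi> dvd dz a + dt b"
  shows "\<exists>h. cst \<xi> dvd dt h - a \<and> cst \<xi> dvd dz h + b"
proof -
  define h1 where "h1 = antideriv a"
  have h1: "dt h1 = a" by (simp add: h1_def dt_def pderiv_antideriv)
  define g where "g = b + dz h1"
  have g: "cst \<xi> dvd dt g"
    using assms by (simp add: g_def dt_add dz_dt_commute[symmetric] h1 add.commute)
  define g0 where "g0 = coeff g 0"
  have gg: "cst \<xi> dvd g - [:g0:]"
    unfolding cst_def const_poly_dvd_iff[of "[:\<xi>:]"]
  proof
    fix n
    show "[:\<xi>:] dvd coeff (g - [:g0:]) n"
    proof (cases n)
      case (Suc m)
      obtain u :: "'a poly" where u: "of_nat (Suc m) * u = 1"
        using of_nat_inverse by blast
      have "[:\<xi>:] dvd coeff (dt g) m"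
        using g unfolding cst_def const_poly_dvd_iff[of "[:\<xi>:]"] by blast
      then have "[:\<xi>:] dvd (of_nat (Suc m) * u) * coeff g (Suc m)"
        by (simp add: dt_def coeff_pderiv mult_ac del: of_nat_Suc)
      then show ?thesis using Suc by (simp add: u del: of_nat_Suc)
    qed (simp add: g0_def)
  qed
  define q where "q = [:antideriv g0:]"
  have q: "dz q = [:g0:]" "dt q = 0"
    by (simp_all add: q_def dz_def dt_def map_poly_pCons pderiv_antideriv pderiv_pCons)
  show ?thesis
  proof (intro exI conjI)
    show "cst \<xi> dvd dt (h1 - q) - a" by (simp add: dt_diff h1 q)
    have "dz (h1 - q) + b = g - [:g0:]" by (simp add: dz_diff q g_def)
    then show "cst \<xi> dvd dz (h1 - q) + b" using gg by simp
  qed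
qed

text \<open>The divergence is the coefficient of \<open>\<xi>^m\<close> in the Jacobian determinant;
  the quadratic terms carry \<open>\<xi>^(2m)\<close>, hence at least
  \<open>\<xi>^(m+1)\<close>.\<close>

lemma divergence_free:
  fixes a b :: "'a::rat_domain poly poly"
  assumes "\<xi> \<noteq> 0" "m \<ge> 1" "cst \<xi> ^ Suc m dvd bracket (Zv + cst \<xi> ^ m * a) (Tv + cst \<xi> ^ m * b) - 1"
  shows "cst \<xi> dvd dz a + dt b"
proof -
  define E where "E = cst \<xi>"
  have E0: "E \<noteq> 0" using assms by (simp add: E_def cst_def)
  have ED: "dz (E ^ n) = 0" "dt (E ^ n) = 0" for n by (simp_all add: E_def dz_simps dt_simps)
  have EE: "E ^ (2 * m) = E ^ m * E ^ m" by (simp add: mult_2 power_add)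
  have "bracket (Zv + E ^ m * a) (Tv + E ^ m * b) - 1 =
      E ^ m * (dz a + dt b) + E ^ (2 * m) * (dz a * dt b - dt a * dz b)"
    unfolding EE by (simp add: bracket_def dz_simps dt_simps ED algebra_simps)
  moreover have "E ^ Suc m dvd E ^ (2 * m)"
    using assms(2) by (intro le_imp_power_dvd) simp
  ultimately have "E ^ m * E dvd E ^ m * (dz a + dt b)"
    using assms(3) unfolding E_def[symmetric] by (metis dvd_add_left_iff dvd_mult2 power_Suc2)
  then show ?thesis
    using E0 unfolding E_def[symmetric] by (simp add: dvd_mult_cancel_left)
qed

text \<open>Successive approximation. The error at order \<open>m\<close> is divergence free, hence
  Hamiltonian modulo \<open>\<xi>\<close>, hence the first-order term of an automorphism of Jacobian
  one. Composing with the inverse of that automorphism raises \<open>m\<close> and keeps the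
  Jacobian condition.\<close>

lemma lift_special_endomorphism:
  fixes \<alpha> \<beta> :: "'a::rat_domain poly poly"
  assumes "\<xi> \<noteq> 0" "m \<ge> 1" "cst \<xi> ^ m dvd \<alpha> - Zv" "cst \<xi> ^ m dvd \<beta> - Tv"
    "cst \<xi> ^ N dvd bracket \<alpha> \<beta> - 1"
  shows "\<exists>T S. aut2 T S \<and> bracket (T Zv) (T Tv) = 1 \<and> bracket (S Zv) (S Tv) = 1 \<and>
     cst \<xi> ^ N dvd T Zv - \<alpha> \<and> cst \<xi> ^ N dvd T Tv - \<beta>"
  using assms
proof (induction "N - m" arbitrary: m \<alpha> \<beta>)
  case 0
  then have "cst \<xi> ^ N dvd cst \<xi> ^ m" by (intro le_imp_power_dvd) simp
  then have "cst \<xi> ^ N dvd \<alpha> - Zv" "cst \<xi> ^ N dvd \<beta> - Tv"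
    using 0(4,5) dvd_trans by blast+
  then have "cst \<xi> ^ N dvd Zv - \<alpha>" "cst \<xi> ^ N dvd Tv - \<beta>"
    by (blast intro: dvd_sub_swap)+
  then show ?case
    by (intro exI[of _ "\<lambda>f. f"]) (simp add: aut2_id bracket_def dz_simps dt_simps)
next
  case (Suc j)
  define E where "E = cst \<xi>"
  have E0: "E \<noteq> 0" using Suc.prems by (simp add: E_def cst_def)
  have ED: "dz (E ^ n) = 0" "dt (E ^ n) = 0" for n by (simp_all add: E_def dz_simps dt_simps)
  obtain a where a: "\<alpha> = Zv + E ^ m * a" using Suc.prems(3)
    by (metis E_def dvdE add.commute diff_add_cancel)
  obtain b where b: "\<beta> = Tv + E ^ m * b" using Suc.prems(4)
    by (metis E_def dvdE add.commute diff_add_cancel)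
  have jm: "j = N - Suc m" using Suc.hyps(2) by simp
  have mN: "Suc m \<le> N" using Suc.hyps(2) by simp
  have "cst \<xi> ^ Suc m dvd bracket \<alpha> \<beta> - 1"
    using Suc.prems(5) le_imp_power_dvd[OF mN] by (blast intro: dvd_trans)
  then have "E dvd dz a + dt b"
    using divergence_free[OF Suc.prems(1,2)] unfolding a b E_def by blast
  then obtain h where h: "E dvd dt h - a" "E dvd dz h + b"
    using potential_mod unfolding E_def by blast
  obtain T1 S1 where 1: "aut2 T1 S1" "bracket (T1 Zv) (T1 Tv) = 1" "bracket (S1 Zv) (S1 Tv) = 1"
     "tangent \<xi> m h T1" "tangent \<xi> m (- h) S1"
    using realizable_all[OF Suc.prems(2), of \<xi> h] unfolding realizable_def by blast
  have S1: "rhom S1" "\<And>a. S1 (cst a) = cst a" using 1 by (auto simp: aut2_def)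
  note Ss = rhom_simps[OF S1(1)]
  have near: "E ^ m dvd S1 f - f" for f
    unfolding E_def by (rule tangent_near_id[OF S1 1(5)])
  have pd: "E ^ Suc m dvd E ^ m * f" if "E dvd f" for f
    unfolding power_Suc2 using that by (rule mult_dvd_mono[OF dvd_refl])
  have "E dvd E ^ m" using Suc.prems(2) by (simp add: dvd_power)
  then have d: "E ^ Suc m dvd E ^ m * (S1 f - f)" for f
    using near[of f] by (intro pd) (rule dvd_trans)
  have SE: "S1 (E ^ m) = E ^ m" by (simp add: E_def Ss S1)
  \<comment> \<open>Three errors, each of order \<open>m + 1\<close>: of \<open>S1\<close> against
    its first-order term, of \<open>S1\<close> against the identity on \<open>a\<close>, and of the
    potential \<open>h\<close>, which fits \<open>a\<close> only modulo
    \<open>\<xi>\<close>.\<close>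
  have ea: "S1 \<alpha> - Zv = (S1 Zv - (Zv + E ^ m * dt (- h))) + E ^ m * (S1 a - a) - E ^ m * (dt h - a)"
    unfolding a rhom_add[OF S1(1)] rhom_mult[OF S1(1)] SE by (simp add: dt_uminus algebra_simps)
  have a': "E ^ Suc m dvd S1 \<alpha> - Zv" unfolding ea
    using 1(5) pd[OF h(1)] d[of a] unfolding tangent_def E_def[symmetric]
    by (intro dvd_diff[OF dvd_add]) blast+
  have eb: "S1 \<beta> - Tv = (S1 Tv - (Tv - E ^ m * dz (- h))) + E ^ m * (S1 b - b) + E ^ m * (dz h + b)"
    unfolding b rhom_add[OF S1(1)] rhom_mult[OF S1(1)] SE by (simp add: dz_uminus algebra_simps)
  have b': "E ^ Suc m dvd S1 \<beta> - Tv" unfolding eb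
    using 1(5) pd[OF h(2)] d[of b] unfolding tangent_def E_def[symmetric]
    by (intro dvd_add[OF dvd_add]) blast+
  have br: "bracket (S1 \<alpha>) (S1 \<beta>) = S1 (bracket \<alpha> \<beta>)"
    using bracket_chain[OF S1(1), of "\<lambda>a. a" \<alpha> \<beta>] S1(2) 1(3) by simp
  have "S1 (cst \<xi> ^ N) dvd S1 (bracket \<alpha> \<beta> - 1)"
    by (rule rhom_dvd[OF S1(1) Suc.prems(5)])
  then have "cst \<xi> ^ N dvd bracket (S1 \<alpha>) (S1 \<beta>) - 1"
    by (simp add: br Ss S1)
  then obtain T2 S2 where 2: "aut2 T2 S2" "bracket (T2 Zv) (T2 Tv) = 1" "bracket (S2 Zv) (S2 Tv) = 1"
    "cst \<xi> ^ N dvd T2 Zv - S1 \<alpha>" "cst \<xi> ^ N dvd T2 Tv - S1 \<beta>"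
    using Suc.hyps(1)[of "Suc m" "S1 \<alpha>" "S1 \<beta>"] jm Suc.prems(1) a' b'
    unfolding E_def by auto
  have T1: "rhom T1" "\<And>a. T1 (cst a) = cst a" "\<And>f. T1 (S1 f) = f" using 1 by (auto simp: aut2_def)
  have "T1 (cst \<xi> ^ N) dvd T1 (T2 Zv - S1 \<alpha>)" "T1 (cst \<xi> ^ N) dvd T1 (T2 Tv - S1 \<beta>)"
    using 2 by (intro rhom_dvd[OF T1(1)]; simp)+
  then have "cst \<xi> ^ N dvd T1 (T2 Zv) - \<alpha>" "cst \<xi> ^ N dvd T1 (T2 Tv) - \<beta>"
    by (simp_all add: rhom_simps[OF T1(1)] T1)
  moreover have "bracket (T1 (T2 Zv)) (T1 (T2 Tv)) = 1" "bracket (S2 (S1 Zv)) (S2 (S1 Tv)) = 1"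
    using 1 2 bracket_comp[of T1 S1 T2 S2] bracket_comp[of S2 T2 S1 T1] by (auto intro: aut2_sym)
  ultimately show ?case
    using aut2_comp[OF 1(1) 2(1)] by blast
qed

section \<open>Truncated exponentials of Hamiltonian vector fields\<close>

definition nat_inv :: "nat \<Rightarrow> 'a::rat_domain" where
  "nat_inv n = (SOME c. of_nat n * c = 1)"

lemma nat_inv: "n \<noteq> 0 \<Longrightarrow> of_nat n * (nat_inv n :: 'a::rat_domain) = 1"
  unfolding nat_inv_def by (rule someI_ex) (rule of_nat_inverse)

text \<open>The divided power \<open>D^n f / n!\<close> of the derivation
  \<open>D f = bracket f g\<close>.\<close>

primrec exp_coeff :: "'a::rat_domain poly poly \<Rightarrow> 'a poly poly \<Rightarrow> nat \<Rightarrow> 'a poly poly" where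
  "exp_coeff g f 0 = f"
| "exp_coeff g f (Suc n) = cst (nat_inv (Suc n)) * bracket (exp_coeff g f n) g"

lemma exp_coeff_Suc: "of_nat (Suc n) * exp_coeff g f (Suc n) = bracket (exp_coeff g f n) g"
proof -
  have "of_nat (Suc n) * exp_coeff g f (Suc n) = cst (of_nat (Suc n) * nat_inv (Suc n)) * bracket (exp_coeff g f n) g"
    by (simp only: exp_coeff.simps cst_simps ac_simps)
  then show ?thesis by (simp only: nat_inv[OF nat.distinct(2)] cst_simps mult_1)
qed

lemma bracket_add: "bracket (f + f') g = bracket f g + bracket f' g" "bracket f (g + g') = bracket f g + bracket f g'"
  by (simp_all add: bracket_def dz_simps dt_simps algebra_simps)

lemma bracket_mult: "bracket (f * f') g = bracket f g * f' + f * bracket f' g"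
  by (simp add: bracket_def dz_simps dt_simps algebra_simps)

lemma bracket_const:
  assumes "dz c = 0" "dt c = 0"
  shows "bracket (c * f) g = c * bracket f g" "bracket f (c * g) = c * bracket f g" "bracket c g = 0"
  using assms by (simp_all add: bracket_def dz_simps dt_simps algebra_simps)

lemma bracket_0: "bracket 0 g = 0" "bracket f 0 = 0"
  by (simp_all add: bracket_def dz_gen dt_gen)

lemma bracket_self: "bracket f f = 0"
  by (simp add: bracket_def)

lemma jacobi: "bracket (bracket f h) g = bracket (bracket f g) h + bracket f (bracket h g)"
  by (simp add: bracket_def dz_simps dt_simps dz_dt_commute algebra_simps)

text \<open>Leibniz formula for divided powers. The abstract operation covers both the product and
  the bracket itself, for which the derivation rule is the Jacobi identity; so the flow is shown to
  be multiplicative and to preserve Jacobians by one argument.\<close>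

lemma exp_coeff_biadditive:
  fixes op :: "'a::rat_domain poly poly \<Rightarrow> 'a poly poly \<Rightarrow> 'a poly poly"
  assumes add: "\<And>a b c. op (a + b) c = op a c + op b c" "\<And>a b c. op a (b + c) = op a b + op a c"
    and leib: "\<And>a b. bracket (op a b) g = op (bracket a g) b + op a (bracket b g)"
  shows "exp_coeff g (op a b) n = (\<Sum>i\<le>n. op (exp_coeff g a i) (exp_coeff g b (n - i)))"
proof (induction n)
  case (Suc n)
  define A where "A = exp_coeff g a"
  define B where "B = exp_coeff g b"
  have nl: "op (of_nat k * x) y = of_nat k * op x y" and nr: "op x (of_nat k * y) = of_nat k * op x y" for k x y
  proof -
    have "op 0 y = 0" "op x 0 = 0" using add(1)[of 0 0 y] add(2)[of x 0 0] by simp_all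
    then show "op (of_nat k * x) y = of_nat k * op x y" "op x (of_nat k * y) = of_nat k * op x y"
      by (induction k) (simp_all add: distrib_right add)
  qed
  have bs: "bracket (sum h S) g = (\<Sum>i\<in>S. bracket (h i) g)" for h :: "nat \<Rightarrow> 'a poly poly" and S
    by (induction S rule: infinite_finite_induct) (simp_all add: bracket_0 bracket_add)
  \<comment> \<open>Multiplying by \<open>n + 1\<close> shifts the divided powers without inverses;
    the binomial weights \<open>i\<close> and \<open>n + 1 - i\<close> of the two sums then add up
    to the same factor, which is cancelled.\<close>
  have "of_nat (Suc n) * exp_coeff g (op a b) (Suc n) = (\<Sum>i\<le>n. bracket (op (A i) (B (n - i))) g)"
    by (simp only: exp_coeff_Suc Suc.IH bs A_def B_def)
  also have "\<dots> = (\<Sum>i\<le>n. of_nat (Suc i) * op (A (Suc i)) (B (n - i)))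
      + (\<Sum>i\<le>n. of_nat (Suc (n - i)) * op (A i) (B (Suc (n - i))))"
    unfolding leib A_def B_def exp_coeff_Suc[symmetric] nl nr by (simp only: sum.distrib)
  also have "(\<Sum>i\<le>n. of_nat (Suc i) * op (A (Suc i)) (B (n - i))) =
      (\<Sum>i\<le>Suc n. of_nat i * op (A i) (B (Suc n - i)))"
    by (simp add: sum.atMost_Suc_shift del: sum.atMost_Suc)
  also have "(\<Sum>i\<le>n. of_nat (Suc (n - i)) * op (A i) (B (Suc (n - i)))) =
      (\<Sum>i\<le>Suc n. of_nat (Suc n - i) * op (A i) (B (Suc n - i)))"
    by (simp add: Suc_diff_le add_diff_eq)
  also have "(\<Sum>i\<le>Suc n. of_nat i * op (A i) (B (Suc n - i))) + \<dots> =
      (\<Sum>i\<le>Suc n. of_nat (Suc n) * op (A i) (B (Suc n - i)))"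
    unfolding sum.distrib[symmetric]
  proof (intro sum.cong refl)
    fix i assume "i \<in> {..Suc n}"
    then have "of_nat (Suc n) = (of_nat i + of_nat (Suc n - i) :: 'a poly poly)"
      by (metis atMost_iff le_add_diff_inverse of_nat_add)
    then show "of_nat i * op (A i) (B (Suc n - i)) + of_nat (Suc n - i) * op (A i) (B (Suc n - i)) =
        of_nat (Suc n) * op (A i) (B (Suc n - i))"
      by (simp only: distrib_right)
  qed
  finally show ?case
    unfolding sum_distrib_left[symmetric] A_def B_def
    by (metis mult_cancel_left of_nat_eq_0_iff nat.distinct(2))
qed simp

definition exp_trunc :: "'a::rat_domain poly poly \<Rightarrow> 'a \<Rightarrow> nat \<Rightarrow> 'a poly poly \<Rightarrow> 'a poly poly" where
  "exp_trunc g s N f = (\<Sum>j<N. cst s ^ j * exp_coeff g f j)"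

text \<open>In the product of two truncated exponentials the terms of total degree below
  \<open>N\<close> form the truncated exponential of the product, and all others carry
  \<open>s^N\<close>.\<close>

lemma exp_trunc_biadditive:
  fixes op :: "'a::rat_domain poly poly \<Rightarrow> 'a poly poly \<Rightarrow> 'a poly poly"
  assumes add: "\<And>a b c. op (a + b) c = op a c + op b c" "\<And>a b c. op a (b + c) = op a b + op a c"
    and leib: "\<And>a b. bracket (op a b) g = op (bracket a g) b + op a (bracket b g)"
    and scal: "\<And>a b c. op (cst c * a) b = cst c * op a b" "\<And>a b c. op a (cst c * b) = cst c * op a b"
  shows "cst s ^ N dvd exp_trunc g s N (op a b) - op (exp_trunc g s N a) (exp_trunc g s N b)"
proof -
  define A where "A = exp_coeff g a"
  define B where "B = exp_coeff g b"
  define F where "F = (\<lambda>(i, j). cst s ^ (i + j) * op (A i) (B j))"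
  have z: "op 0 y = 0" "op x 0 = 0" for x y
    using add(1)[of 0 0 y] add(2)[of x 0 0] by simp_all
  have sl: "op (sum h S) y = (\<Sum>i\<in>S. op (h i) y)" for h :: "nat \<Rightarrow> 'a poly poly" and S y
    by (induction S rule: infinite_finite_induct) (simp_all add: add z)
  have sr: "op x (sum h S) = (\<Sum>i\<in>S. op x (h i))" for h :: "nat \<Rightarrow> 'a poly poly" and S x
    by (induction S rule: infinite_finite_induct) (simp_all add: add z)
  have cl: "op (cst c ^ i * x) y = cst c ^ i * op x y" "op x (cst c ^ i * y) = cst c ^ i * op x y" for c i x y
    using scal[where c = "c ^ i"] by (simp_all add: cst_simps)
  have "op (exp_trunc g s N a) (exp_trunc g s N b) = (\<Sum>i<N. \<Sum>j<N. F (i, j))"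
    unfolding exp_trunc_def sl cl A_def[symmetric] B_def[symmetric]
    by (intro sum.cong refl) (simp add: sr cl F_def power_add sum_distrib_left mult.assoc)
  also have "\<dots> = sum F ({..<N} \<times> {..<N})"
    by (simp add: sum.cartesian_product)
  also have "\<dots> = sum F {(i, j). i + j < N} + sum F ({..<N} \<times> {..<N} - {(i, j). i + j < N})"
    by (subst sum.subset_diff[of "{(i, j). i + j < N}"]) (auto simp: add.commute)
  also have "sum F {(i, j). i + j < N} = (\<Sum>k<N. \<Sum>i\<le>k. F (i, k - i))"
    using sum.triangle_reindex[of "\<lambda>i j. F (i, j)" N] by simp
  also have "\<dots> = exp_trunc g s N (op a b)"
    by (simp add: exp_trunc_def exp_coeff_biadditive[OF add leib] F_def A_def B_def sum_distrib_left)
  finally have eq: "op (exp_trunc g s N a) (exp_trunc g s N b) =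
      exp_trunc g s N (op a b) + sum F ({..<N} \<times> {..<N} - {(i, j). i + j < N})" .
  have "cst s ^ N dvd sum F ({..<N} \<times> {..<N} - {(i, j). i + j < N})"
    by (rule dvd_sum) (auto simp: F_def intro!: dvd_mult2 le_imp_power_dvd)
  then show ?thesis by (simp add: eq)
qed

text \<open>\<open>\<alpha>\<close> and \<open>\<beta>\<close> are the truncated flow of
  \<open>g\<close> at time \<open>\<xi>^n\<close>, evaluated on the coordinates. The truncation is
  only multiplicative modulo \<open>\<xi>^N\<close>, so its effect on \<open>r\<close> is stated for
  any homomorphism \<open>T\<close> that agrees with it on coordinates to that order. The cofactor
  is 1 modulo \<open>\<xi>\<close> because every later term of the exponential carries
  \<open>\<xi>\<close>.\<close>

lemma exp_flow:
  fixes r w g :: "'a::rat_domain poly poly"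
  assumes n: "n \<ge> 1" and N: "N \<ge> 1" and r: "bracket r g = r * w"
  shows "\<exists>\<alpha> \<beta>. cst \<xi> ^ Suc n dvd \<alpha> - (Zv + cst \<xi> ^ n * dt g) \<and> cst \<xi> ^ Suc n dvd \<beta> - (Tv - cst \<xi> ^ n * dz g) \<and>
    cst \<xi> ^ N dvd bracket \<alpha> \<beta> - 1 \<and>
    (\<forall>T. rhom T \<and> (\<forall>a. T (cst a) = cst a) \<and> cst \<xi> ^ N dvd T Zv - \<alpha> \<and> cst \<xi> ^ N dvd T Tv - \<beta> \<longrightarrow>
      (\<exists>u. cst \<xi> ^ N dvd T r - r * u \<and> cst \<xi> dvd u - 1))"
proof -
  \<comment> \<open>At least \<open>N\<close> terms are needed for the precision; two more allow the
    terms of order 0 and 1 to be split off for every \<open>N\<close>.\<close>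
  define M where "M = N + 2"
  define s where "s = \<xi> ^ n"
  define E where "E = exp_trunc g s M"
  have sN: "cst \<xi> ^ N dvd cst s ^ M"
  proof -
    have "1 * M \<le> n * M" using n by (rule mult_le_mono1)
    then have "N \<le> n * M" by (simp add: M_def)
    then show ?thesis unfolding s_def cst_simps power_mult[symmetric] by (rule le_imp_power_dvd)
  qed
  have s2: "cst \<xi> ^ Suc n dvd cst s ^ j" if "j \<ge> 2" for j
  proof -
    have "Suc n \<le> n * 2" "n * 2 \<le> n * j" using n that by simp_all
    then have "Suc n \<le> n * j" by linarith
    then show ?thesis unfolding s_def cst_simps power_mult[symmetric] by (rule le_imp_power_dvd)
  qed
  have s1: "cst \<xi> dvd cst s ^ j" if "j \<ge> 1" for j
    using n that by (simp add: s_def cst_simps flip: power_mult)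
  have split2: "exp_trunc g s M f = f + cst s * bracket f g + (\<Sum>j<N. cst s ^ (j + 2) * exp_coeff g f (j + 2))" for f
  proof -
    have "cst (nat_inv (Suc 0)) = (1 :: 'a poly poly)"
      using nat_inv[of 1, where 'a = 'a] by (simp add: cst_simps)
    then show ?thesis
      unfolding exp_trunc_def M_def
      by (simp add: sum.lessThan_Suc_shift numeral_2_eq_2 add.assoc del: sum.lessThan_Suc)
  qed
  have tan: "cst \<xi> ^ Suc n dvd E f - (f + cst \<xi> ^ n * bracket f g)" for f
  proof -
    have "E f - (f + cst \<xi> ^ n * bracket f g) = (\<Sum>j<N. cst s ^ (j + 2) * exp_coeff g f (j + 2))"
      unfolding E_def split2 by (simp add: s_def cst_simps)
    also have "cst \<xi> ^ Suc n dvd \<dots>"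
      by (rule dvd_sum) (rule dvd_mult2, rule s2, simp)
    finally show ?thesis .
  qed
  have Eadd: "E (a + b) = E a + E b" for a b
  proof -
    have "exp_coeff g (a + b) n = exp_coeff g a n + exp_coeff g b n" for n
      by (induction n) (simp_all add: bracket_add distrib_left)
    then show ?thesis by (simp add: E_def exp_trunc_def distrib_left sum.distrib)
  qed
  have Ec: "E (cst a) = cst a" for a
  proof -
    have "bracket (exp_coeff g (cst a) n) g = 0" for n
      by (induction n) (simp_all add: bracket_const dz_gen dt_gen bracket_0)
    then have "exp_coeff g (cst a) (Suc n) = 0" for n
      by simp
    then show ?thesis
      by (simp add: E_def exp_trunc_def M_def sum.lessThan_Suc_shift del: sum.lessThan_Suc exp_coeff.simps(2))
  qed
  have Emult: "cst \<xi> ^ N dvd E (a * b) - E a * E b" for a b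
    unfolding E_def
    by (rule dvd_trans[OF sN], rule exp_trunc_biadditive) (simp_all add: algebra_simps bracket_mult)
  have Ebr: "cst \<xi> ^ N dvd E (bracket a b) - bracket (E a) (E b)" for a b
    unfolding E_def
    by (rule dvd_trans[OF sN], rule exp_trunc_biadditive[where op = bracket, OF bracket_add jacobi])
      (simp_all only: bracket_const dz_gen dt_gen)
  have "bracket Zv g = dt g" "bracket Tv g = - dz g" by (simp_all add: bracket_def dz_gen dt_gen)
  then have A: "cst \<xi> ^ Suc n dvd E Zv - (Zv + cst \<xi> ^ n * dt g)" "cst \<xi> ^ Suc n dvd E Tv - (Tv - cst \<xi> ^ n * dz g)"
      using tan[of Zv] tan[of Tv] by simp_all
    have "E 1 = 1" using Ec[of 1] by (simp add: cst_simps)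
    moreover have "bracket Zv Tv = (1 :: 'a poly poly)" by (simp add: bracket_def dz_gen dt_gen)
    ultimately have "E (bracket Zv Tv) = 1" by (simp only:)
    then have B: "cst \<xi> ^ N dvd bracket (E Zv) (E Tv) - 1"
      using dvd_sub_swap[OF Ebr[of Zv Tv]] by (simp only:)
  have C: "\<exists>u. cst \<xi> ^ N dvd T r - r * u \<and> cst \<xi> dvd u - 1"
    if T: "rhom T \<and> (\<forall>a. T (cst a) = cst a) \<and> cst \<xi> ^ N dvd T Zv - E Zv \<and> cst \<xi> ^ N dvd T Tv - E Tv" for T
  proof -
    have Tr: "rhom T" using T by simp
    have "cst \<xi> ^ N dvd T f - E f" for f
    proof (induction f rule: poly2_gen_induct)
      case (add p q)
      have "T (p + q) - E (p + q) = (T p - E p) + (T q - E q)" by (simp add: rhom_add[OF Tr] Eadd)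
      then show ?case using add by simp
    next
      case (mult p q)
      have "T (p * q) - E (p * q) = ((T p - E p) * T q + E p * (T q - E q)) - (E (p * q) - E p * E q)"
        by (simp add: rhom_mult[OF Tr] algebra_simps)
      then show ?case using mult Emult[of p q] by (metis dvd_add dvd_diff dvd_mult dvd_mult2)
    qed (use T Ec in auto)
    moreover have "\<exists>u. E r = r * u \<and> cst \<xi> dvd u - 1"
    proof -
      \<comment> \<open>Tangency to \<open>r = 0\<close> propagates to all iterates, since the
        derivation sends \<open>r u\<close> to \<open>r (w u + bracket u g)\<close>.\<close>
      have "\<exists>u. exp_coeff g r j = r * u" for j
      proof (induction j)
        case 0
        show ?case by (intro exI[of _ 1]) simp
      next
        case (Suc j)
        then obtain u where u: "exp_coeff g r j = r * u" by blast
        have "exp_coeff g r (Suc j) = r * (cst (nat_inv (Suc j)) * (w * u + bracket u g))"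
          by (simp add: u bracket_mult r algebra_simps)
        then show ?case by blast
      qed
      then obtain u where u: "\<And>j. exp_coeff g r j = r * u j" by metis
      define v where "v = 1 + cst s * w + (\<Sum>j<N. cst s ^ (j + 2) * u (j + 2))"
      have "E r = r * v"
        unfolding E_def split2 v_def r u by (simp add: algebra_simps sum_distrib_left)
      moreover have "cst \<xi> dvd v - 1"
        unfolding v_def using s1[of 1] s1 by (auto intro!: dvd_add dvd_sum dvd_mult2 simp del: power_Suc)
      ultimately show ?thesis by blast
    qed
    ultimately show ?thesis by metis
  qed
  show ?thesis using A B C by blast
qed

section \<open>Automorphisms of affine space preserving the hypersurface\<close>

lemma rhom_poly_dvd_diff:
  fixes f g :: "'a::comm_ring_1 poly \<Rightarrow> 'b::comm_ring_1"
  assumes "rhom f" "rhom g" "\<And>c. m dvd f [:c:] - g [:c:]" "m dvd f [:0, 1:] - g [:0, 1:]"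
  shows "m dvd f p - g p"
proof (induction p rule: poly_gen_induct)
  case (add p q)
  have "f (p + q) - g (p + q) = (f p - g p) + (f q - g q)"
    by (simp add: rhom_simps[OF assms(1)] rhom_simps[OF assms(2)])
  then show ?case using add by simp
next
  case (mult p q)
  have "f (p * q) - g (p * q) = (f p - g p) * f q + g p * (f q - g q)"
    by (simp add: rhom_simps[OF assms(1)] rhom_simps[OF assms(2)] algebra_simps)
  then show ?case using mult by simp
qed (use assms in auto)

text \<open>The ring of functions in \<open>x, z, t\<close> is a ring of polynomials in \<open>z\<close> and \<open>t\<close> over the polynomials in \<open>x\<close>.\<close>

definition Xb :: poly3 where "Xb = cst [:0, 1:]"
definition Rb :: "nat \<Rightarrow> nat \<Rightarrow> poly3" where "Rb k l = Zv ^ k + Tv ^ l + Xb"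

definition const3 :: "complex \<Rightarrow> poly3" where "const3 a = cst [:a:]"

lemma rhom_const3: "rhom const3"
  unfolding const3_def by (rule rhom_comp[OF rhom_cst rhom_const_poly])

lemma var_const_poly: "var_x = [:Xb:]" "var_z = [:Zv:]" "var_t = [:Tv:]" "const4 a = [:const3 a:]"
  by (simp_all add: var_x_def var_z_def var_t_def const4_def const3_def Xb_def Zv_def Tv_def cst_def)

lemma const_poly_simps:
  "[:a + b:] = [:a:] + [:b:]" "[:a * b:] = [:a:] * [:b:]" "[:a - b:] = [:a:] - [:b:]" "[:a ^ n:] = [:a:] ^ n" "[:1:] = 1"
  for a b :: "'a::comm_ring_1"
  using rhom_add[OF rhom_const_poly, of a b] rhom_mult[OF rhom_const_poly, of a b] rhom_diff[OF rhom_const_poly, of a b]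
    rhom_power[OF rhom_const_poly, of a n] by (simp_all add: one_pCons)

lemma P_eq: "P d k l = [:Rb k l:] + [:Xb ^ d:] * var_y"
  by (simp only: P_def var_const_poly Rb_def const_poly_simps) (simp add: algebra_simps)

lemma P_eq_pCons: "P d k l = [:Rb k l, Xb ^ d:]"
  by (simp add: P_eq var_y_def)

lemma hom4_gen':
  assumes "rhom h"
  shows "hom4 h x z t y (const4 c) = h c" "hom4 h x z t y [:Xb:] = x"
    "hom4 h x z t y [:Zv:] = z" "hom4 h x z t y [:Tv:] = t" "hom4 h x z t y var_y = y"
  using hom4_gen[OF assms, of x z t y] by (simp_all add: var_const_poly)

lemma rhom_poly3_eqI':
  fixes f g :: "poly3 \<Rightarrow> 'a::comm_ring_1"
  assumes "rhom f" "rhom g" "\<And>c. f (const3 c) = g (const3 c)" "f Xb = g Xb" "f Zv = g Zv" "f Tv = g Tv"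
  shows "f p = g p"
  by (rule rhom_poly3_eqI) (use assms in \<open>simp_all add: const3_def Xb_def Zv_def Tv_def cst_def\<close>)

lemma rhom_poly4_eqI':
  fixes f g :: "poly4 \<Rightarrow> 'a::comm_ring_1"
  assumes f: "rhom f" and g: "rhom g" and "\<And>c. f (const4 c) = g (const4 c)" "f [:Xb:] = g [:Xb:]"
    "f [:Zv:] = g [:Zv:]" "f [:Tv:] = g [:Tv:]" "f var_y = g var_y"
  shows "f p = g p"
  by (rule rhom_poly4_eqI) (use assms in \<open>simp_all add: var_const_poly\<close>)

text \<open>The comparison with \<open>g\<close> concerns only \<open>x, z, t\<close>; the class of
  \<open>y\<close> is then determined, since \<open>x^d y = - r\<close> on \<open>X\<close> and
  \<open>P\<close> is prime. The scalar \<open>c\<close> differs from 1 only for torus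
  elements.\<close>

definition extendable :: "nat \<Rightarrow> nat \<Rightarrow> nat \<Rightarrow> (poly3 \<Rightarrow> poly3) \<Rightarrow> bool" where
  "extendable d k l g \<longleftrightarrow> (\<exists>\<Phi> \<Psi> c. rhom \<Phi> \<and> rhom \<Psi> \<and> (\<forall>a. \<Phi> (const4 a) = const4 a) \<and>
     (\<forall>a. \<Psi> (const4 a) = const4 a) \<and> (\<forall>f. \<Phi> (\<Psi> f) = f) \<and> (\<forall>f. \<Psi> (\<Phi> f) = f) \<and> c \<noteq> 0 \<and>
     \<Phi> (P d k l) = const4 c * P d k l \<and> (\<forall>b. P d k l dvd \<Phi> [:b:] - [:g b:]))"

lemma extendable_comp:
  assumes "extendable d k l g" "extendable d k l g'"
  shows "extendable d k l (\<lambda>b. g (g' b))"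
proof -
  obtain \<Phi> \<Psi> c where 1: "rhom \<Phi>" "rhom \<Psi>" "\<And>a. \<Phi> (const4 a) = const4 a" "\<And>a. \<Psi> (const4 a) = const4 a"
    "\<And>f. \<Phi> (\<Psi> f) = f" "\<And>f. \<Psi> (\<Phi> f) = f" "c \<noteq> 0" "\<Phi> (P d k l) = const4 c * P d k l"
    "\<And>b. P d k l dvd \<Phi> [:b:] - [:g b:]"
    using assms(1) unfolding extendable_def by metis
  obtain \<Phi>' \<Psi>' c' where 2: "rhom \<Phi>'" "rhom \<Psi>'" "\<And>a. \<Phi>' (const4 a) = const4 a" "\<And>a. \<Psi>' (const4 a) = const4 a"
    "\<And>f. \<Phi>' (\<Psi>' f) = f" "\<And>f. \<Psi>' (\<Phi>' f) = f" "c' \<noteq> 0" "\<Phi>' (P d k l) = const4 c' * P d k l"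
    "\<And>b. P d k l dvd \<Phi>' [:b:] - [:g' b:]"
    using assms(2) unfolding extendable_def by metis
  have "P d k l dvd \<Phi> (\<Phi>' [:b:]) - [:g (g' b):]" for b
  proof -
    have "P d k l dvd \<Phi> (P d k l)" by (simp add: 1)
    also have "\<dots> dvd \<Phi> (\<Phi>' [:b:] - [:g' b:])" by (rule rhom_dvd[OF 1(1) 2(9)])
    finally have "P d k l dvd (\<Phi> (\<Phi>' [:b:]) - \<Phi> [:g' b:]) + (\<Phi> [:g' b:] - [:g (g' b):])"
      unfolding rhom_diff[OF 1(1)] using 1(9) by (rule dvd_add)
    then show ?thesis by (simp only: add_diff_eq diff_add_cancel)
  qed
  moreover have "\<Phi> (\<Phi>' (P d k l)) = const4 (c' * c) * P d k l"
    by (simp add: 1 2 rhom_simps[OF 1(1)] rhom_mult[OF rhom_const4] mult.assoc)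
  ultimately show ?thesis
    unfolding extendable_def using 1 2
    by (intro exI[of _ "\<lambda>f. \<Phi> (\<Phi>' f)"] exI[of _ "\<lambda>f. \<Psi>' (\<Psi> f)"] exI[of _ "c' * c"]) (simp add: rhom_comp)
qed

lemma Xb_nz: "Xb \<noteq> 0"
  by (simp add: Xb_def cst_def)

text \<open>The image of \<open>y\<close> takes care of itself: if \<open>F G\<close> fixes
  \<open>P\<close> and \<open>x, z, t\<close>, it fixes \<open>x^d y\<close>, and \<open>x^d\<close>
  can be cancelled.\<close>

lemma hom4_inverse:
  assumes F: "rhom F" and G: "rhom G" and P: "F (G (P d k l)) = P d k l"
    and c: "\<And>a. F (G (const4 a)) = const4 a" and g: "F (G [:Xb:]) = [:Xb:]" "F (G [:Zv:]) = [:Zv:]" "F (G [:Tv:]) = [:Tv:]"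
  shows "F (G f) = f"
proof -
  have FG: "rhom (\<lambda>f. F (G f))" by (rule rhom_comp[OF F G])
  note s = rhom_simps[OF FG]
  have R: "F (G [:Rb k l:]) = [:Rb k l:]"
    unfolding Rb_def const_poly_simps s g ..
  have "[:Xb ^ d:] * F (G var_y) = F (G (P d k l - [:Rb k l:]))"
    by (simp add: P_eq s g const_poly_simps del: pCons_one mult_pCons_left)
  also have "\<dots> = [:Xb ^ d:] * var_y"
    unfolding s P R by (simp only: P_eq add_diff_cancel_left')
  finally have y: "F (G var_y) = var_y"
    using Xb_nz by (metis mult_cancel_left pCons_eq_0_iff power_not_zero)
  show ?thesis
    by (rule rhom_poly4_eqI'[OF FG rhom_id]) (simp_all only: c g y)
qed

lemma shift_cancel: "a + b * c + b * (e - c) = a + b * e" for a b c e :: "'a::comm_ring_1"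
  by (simp add: algebra_simps)

text \<open>The case reached when the identity holds modulo \<open>x^d\<close>: the change
  \<open>x^d v\<close> of \<open>r\<close> is absorbed by \<open>y \<mapsto> y - v\<close>.\<close>

lemma extendable_shift:
  assumes a: "aut2 g g'" and v: "g (Rb k l) = Rb k l + Xb ^ d * v" and v': "g' (Rb k l) = Rb k l + Xb ^ d * v'"
  shows "extendable d k l g"
proof -
  define F where "F g v = hom4 const4 [:Xb:] [:g Zv:] [:g Tv:] (var_y - [:v:])" for g :: "poly3 \<Rightarrow> poly3" and v
  have Fr: "rhom (F g v)" for g v unfolding F_def by (rule rhom_hom4[OF rhom_const4])
  have Fb: "F g v [:b:] = [:g b:]" if g: "aut2 g g'" for g g' v b
  proof -
    have gr: "rhom g" "\<And>a. g (cst a) = cst a" using g by (auto simp: aut2_def)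
    show ?thesis
      by (rule rhom_poly3_eqI'[OF rhom_comp[OF Fr rhom_const_poly] rhom_comp[OF rhom_const_poly gr(1)]])
        (simp_all only: F_def hom4_gen'[OF rhom_const4] flip: var_const_poly(4),
         simp_all add: const3_def Xb_def gr var_const_poly)
  qed
  have FP: "F g v (P d k l) = P d k l" if g: "aut2 g g'" and v: "g (Rb k l) = Rb k l + Xb ^ d * v" for g g' v
  proof -
    have X: "g (Xb ^ d) = Xb ^ d"
      using g unfolding Xb_def cst_simps(5)[symmetric] by (simp add: aut2_def)
    have y: "F g v var_y = var_y - [:v:]" by (simp only: F_def hom4_gen'[OF rhom_const4])
    show ?thesis
      unfolding P_eq rhom_add[OF Fr] rhom_mult[OF Fr] Fb[OF g] v X y
      by (simp only: const_poly_simps shift_cancel)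
  qed
  have inv: "F g v (F g' v' f) = f" if "aut2 g g'" "g (Rb k l) = Rb k l + Xb ^ d * v" "g' (Rb k l) = Rb k l + Xb ^ d * v'" for f g g' v v'
  proof (rule hom4_inverse[OF Fr Fr])
    note s = aut2_sym[OF that(1)]
    have gg: "g (g' f) = f" for f using that(1) by (simp add: aut2_def)
    show "F g v (F g' v' (P d k l)) = P d k l" using FP that s by simp
    show "F g v (F g' v' (const4 a)) = const4 a" for a
      by (simp only: var_const_poly Fb[OF that(1)] Fb[OF s] gg)
  qed (use aut2_sym[OF that(1)] that(1) in \<open>simp_all only: Fb[OF that(1)] Fb[OF aut2_sym[OF that(1)]], simp_all add: aut2_def\<close>)
  show ?thesis
    unfolding extendable_def
  proof (rule exI[where x = "F g v"], rule exI[where x = "F g' v'"], rule exI[where x = 1], intro conjI allI)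
    show "F g v (F g' v' f) = f" "F g' v' (F g v f) = f" for f
      using inv a aut2_sym[OF a] v v' by blast+
    have "aut2 g' g" using a by (rule aut2_sym)
    then show "F g v (const4 b) = const4 b" "F g' v' (const4 b) = const4 b" for b
      using a by (simp_all only: var_const_poly Fb) (simp_all add: aut2_def const3_def)
    show "F g v (P d k l) = const4 1 * P d k l"
      using FP[OF a v] by (simp add: rhom_1[OF rhom_const4])
    show "P d k l dvd F g v [:b:] - [:g b:]" for b
      by (simp only: Fb[OF a]) simp
  qed (simp_all add: Fr)
qed

text \<open>Scalars of the family: polynomials in \<open>x\<close> whose coefficients are polynomials in a parameter \<open>c\<close>, which
  is later specialised to \<open>P\<close> (giving an automorphism of affine space) and to \<open>0\<close> (its restriction).\<close>

type_synonym fam = "complex poly poly poly poly"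

definition Xi :: "complex poly poly" where "Xi = [:0, 1:]"
definition Cc :: "complex poly poly" where "Cc = [:[:0, 1:]:]"
definition Rf :: "nat \<Rightarrow> nat \<Rightarrow> fam" where "Rf k l = Zv ^ k + Tv ^ l + cst Xi - cst Cc"

definition to_space :: "nat \<Rightarrow> nat \<Rightarrow> nat \<Rightarrow> fam \<Rightarrow> poly4" where
  "to_space d k l = subst2 (lift_hom (lift_hom const4 (P d k l)) [:Xb:]) [:Zv:] [:Tv:]"

definition special :: "fam \<Rightarrow> poly3" where
  "special = subst2 (lift_hom (lift_hom const3 0) Xb) Zv Tv"

definition emb :: "poly3 \<Rightarrow> fam" where
  "emb = subst2 (lift_hom (\<lambda>a. cst [:[:a:]:]) (cst Xi)) Zv Tv"

lemma rhom_to_space: "rhom (to_space d k l)"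
  unfolding to_space_def by (intro rhom_subst2 rhom_lift_hom rhom_const4)

lemma rhom_special: "rhom special"
  unfolding special_def by (intro rhom_subst2 rhom_lift_hom rhom_const3)

lemma rhom_emb_const: "rhom (\<lambda>a. cst [:[:a:]:])"
  by (intro rhom_comp[OF rhom_cst] rhom_comp[OF rhom_const_poly] rhom_const_poly)

lemma rhom_emb: "rhom emb"
  unfolding emb_def by (intro rhom_subst2 rhom_lift_hom rhom_emb_const)

lemma to_space_gen: "to_space d k l (cst [:[:a:]:]) = const4 a" "to_space d k l (cst Xi) = [:Xb:]"
  "to_space d k l (cst Cc) = P d k l" "to_space d k l Zv = [:Zv:]" "to_space d k l Tv = [:Tv:]"
  by (simp_all add: to_space_def subst2_gen rhom_lift_hom rhom_const4 lift_hom_const lift_hom_X Xi_def Cc_def)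

lemma special_gen: "special (cst [:[:a:]:]) = const3 a" "special (cst Xi) = Xb"
  "special (cst Cc) = 0" "special Zv = Zv" "special Tv = Tv"
  by (simp_all add: special_def subst2_gen rhom_lift_hom rhom_const3 lift_hom_const lift_hom_X Xi_def Cc_def)

lemma emb_gen: "emb (const3 a) = cst [:[:a:]:]" "emb Xb = cst Xi" "emb Zv = Zv" "emb Tv = Tv"
  by (simp_all add: emb_def subst2_gen rhom_lift_hom rhom_emb_const lift_hom_const lift_hom_X Xb_def const3_def)

lemma rhom_fam_eqI:
  fixes f g :: "fam \<Rightarrow> 'a::comm_ring_1"
  assumes f: "rhom f" and g: "rhom g" and "\<And>a. f (cst [:[:a:]:]) = g (cst [:[:a:]:])" "f (cst Xi) = g (cst Xi)"
    "f (cst Cc) = g (cst Cc)" "f Zv = g Zv" "f Tv = g Tv"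
  shows "f p = g p"
proof (rule rhom_poly2_eqI[OF f g])
  fix c
  show "f (cst c) = g (cst c)"
  proof (rule rhom_poly_eqI[OF rhom_comp[OF f rhom_cst] rhom_comp[OF g rhom_cst]])
    fix a
    show "f (cst [:a:]) = g (cst [:a:])"
      by (rule rhom_poly_eqI[OF rhom_comp[OF f rhom_comp[OF rhom_cst rhom_const_poly]]
            rhom_comp[OF g rhom_comp[OF rhom_cst rhom_const_poly]]]) (use assms in \<open>simp_all add: Cc_def\<close>)
  qed (use assms in \<open>simp add: Xi_def\<close>)
qed (use assms in auto)

lemma special_emb: "special (emb b) = b"
  by (rule rhom_poly3_eqI'[OF rhom_comp[OF rhom_special rhom_emb] rhom_id]) (simp_all add: emb_gen special_gen)

lemma to_space_emb: "to_space d k l (emb b) = [:b:]"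
  by (rule rhom_poly3_eqI'[OF rhom_comp[OF rhom_to_space rhom_emb] rhom_const_poly])
    (simp_all add: emb_gen to_space_gen var_const_poly)

text \<open>The two specialisations of \<open>c\<close>, to \<open>P\<close> and to 0, agree modulo
  \<open>P\<close>. This is why the family restricts on \<open>X\<close> to its member at
  \<open>c = 0\<close>.\<close>

lemma to_space_special: "P d k l dvd to_space d k l f - [:special f:]"
proof (rule rhom_dvd_diff[OF rhom_to_space rhom_comp[OF rhom_const_poly rhom_special]])
  fix c
  show "P d k l dvd to_space d k l (cst c) - [:special (cst c):]"
  proof (rule rhom_poly_dvd_diff[OF rhom_comp[OF rhom_to_space rhom_cst]
        rhom_comp[OF rhom_const_poly rhom_comp[OF rhom_special rhom_cst]]])
    fix a
    show "P d k l dvd to_space d k l (cst [:a:]) - [:special (cst [:a:]):]"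
    proof (rule rhom_poly_dvd_diff[OF rhom_comp[OF rhom_to_space rhom_comp[OF rhom_cst rhom_const_poly]]
        rhom_comp[OF rhom_const_poly rhom_comp[OF rhom_special rhom_comp[OF rhom_cst rhom_const_poly]]]])
      show "P d k l dvd to_space d k l (cst [:[:0, 1:]:]) - [:special (cst [:[:0, 1:]:]):]"
        using to_space_gen(3)[of d k l] special_gen(3) by (simp add: Cc_def)
    qed (simp add: to_space_gen special_gen var_const_poly)
  qed (use to_space_gen(2)[of d k l] special_gen(2) in \<open>simp add: Xi_def\<close>)
qed (simp_all add: to_space_gen special_gen)

lemma special_Rf: "special (Rf k l) = Rb k l"
  by (simp add: Rf_def Rb_def rhom_simps[OF rhom_special] special_gen)

lemma emb_Rb: "emb (Rb k l) = Rf k l + cst Cc"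
  by (simp add: Rf_def Rb_def rhom_simps[OF rhom_emb] emb_gen)

text \<open>Under \<open>c \<mapsto> P\<close> the element \<open>r - c\<close> becomes
  \<open>- x^d y\<close>, so the assumption on \<open>T\<close> says that its image is
  \<open>- x^d (u y - v)\<close>. This dictates the image of \<open>y\<close>, and \<open>P\<close>,
  being the image of the parameter \<open>c\<close>, stays fixed.\<close>

lemma extendable_family:
  assumes a: "aut2 T S" and T: "T (Rf k l) = Rf k l * u + cst Xi ^ d * v"
    and S: "S (Rf k l) = Rf k l * u' + cst Xi ^ d * v'"
  shows "extendable d k l (\<lambda>b. special (T (emb b)))"
proof -
  define \<sigma> where "\<sigma> = to_space d k l"
  have \<sigma>r: "rhom \<sigma>" by (simp add: \<sigma>_def rhom_to_space)
  note ss = rhom_simps[OF \<sigma>r]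
  have \<sigma>: "\<sigma> (cst [:[:a:]:]) = const4 a" "\<sigma> (cst Xi) = [:Xb:]" "\<sigma> (cst Cc) = P d k l" "\<sigma> Zv = [:Zv:]" "\<sigma> Tv = [:Tv:]" for a
    unfolding \<sigma>_def by (rule to_space_gen)+
  define F where "F T u v = hom4 const4 [:Xb:] (\<sigma> (T Zv)) (\<sigma> (T Tv)) (\<sigma> u * var_y - \<sigma> v)" for T :: "fam \<Rightarrow> fam" and u v
  have Fr: "rhom (F T u v)" for T u v unfolding F_def by (rule rhom_hom4[OF rhom_const4])
  have Fg: "F T u v (const4 a) = const4 a" "F T u v [:Xb:] = [:Xb:]" "F T u v [:Zv:] = \<sigma> (T Zv)" "F T u v [:Tv:] = \<sigma> (T Tv)"
    "F T u v var_y = \<sigma> u * var_y - \<sigma> v" for T u v a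
    by (simp_all only: F_def hom4_gen'[OF rhom_const4])
  have R\<sigma>: "\<sigma> (Rf k l) = - ([:Xb:] ^ d * var_y)"
    unfolding Rf_def ss \<sigma> P_eq Rb_def const_poly_simps by (simp only: algebra_simps) simp
  have FP: "F T u v (P d k l) = P d k l"
    if "aut2 T S" and v: "T (Rf k l) = Rf k l * u + cst Xi ^ d * v" for T S u v
  proof -
    have Tr: "rhom T" "\<And>a. T (cst a) = cst a" using that by (auto simp: aut2_def)
    have "\<sigma> (T (Rf k l)) = \<sigma> (T Zv) ^ k + \<sigma> (T Tv) ^ l + [:Xb:] - P d k l"
      unfolding Rf_def rhom_simps[OF Tr(1)] Tr(2) ss \<sigma> ..
    moreover have "\<sigma> (T (Rf k l)) = - ([:Xb:] ^ d * var_y) * \<sigma> u + [:Xb:] ^ d * \<sigma> v"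
      unfolding v ss \<sigma> R\<sigma> ..
    ultimately have "\<sigma> (T Zv) ^ k + \<sigma> (T Tv) ^ l + [:Xb:] = P d k l - [:Xb:] ^ d * (\<sigma> u * var_y - \<sigma> v)"
      by (simp add: algebra_simps)
    moreover have "F T u v (P d k l) = \<sigma> (T Zv) ^ k + \<sigma> (T Tv) ^ l + [:Xb:] + [:Xb:] ^ d * (\<sigma> u * var_y - \<sigma> v)"
      unfolding P_eq Rb_def const_poly_simps rhom_simps[OF Fr] Fg ..
    ultimately show ?thesis by simp
  qed
  \<comment> \<open>The map of affine space intertwines the specialisation with \<open>T\<close>, so
    that inverses of \<open>T\<close> give inverses of the extension.\<close>
  have F\<sigma>: "F T u v (\<sigma> f) = \<sigma> (T f)"
    if "aut2 T S" and v: "T (Rf k l) = Rf k l * u + cst Xi ^ d * v" for T S u v f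
  proof -
    have Tr: "rhom T" "\<And>a. T (cst a) = cst a" using that by (auto simp: aut2_def)
    show ?thesis
      by (rule rhom_fam_eqI[OF rhom_comp[OF Fr \<sigma>r] rhom_comp[OF \<sigma>r Tr(1)]])
        (simp_all only: Tr(2) \<sigma> Fg FP[OF that])
  qed
  have inv: "F T u v (F S u' v' f) = f" if "aut2 T S" "T (Rf k l) = Rf k l * u + cst Xi ^ d * v"
    "S (Rf k l) = Rf k l * u' + cst Xi ^ d * v'" for f T S u v u' v'
  proof (rule hom4_inverse[OF Fr Fr])
    have TS: "T (S f) = f" for f using that(1) by (simp add: aut2_def)
    show "F T u v (F S u' v' (P d k l)) = P d k l"
      by (simp only: FP[OF aut2_sym[OF that(1)] that(3)] FP[OF that(1,2)])
  qed (use that(1) in \<open>simp_all only: Fg F\<sigma>[OF that(1,2)], simp_all add: aut2_def \<sigma>\<close>)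
  show ?thesis
    unfolding extendable_def
  proof (rule exI[where x = "F T u v"], rule exI[where x = "F S u' v'"], rule exI[where x = 1], intro conjI allI)
    show "F T u v (F S u' v' f) = f" "F S u' v' (F T u v f) = f" for f
      using inv a aut2_sym[OF a] T S by blast+
    show "F T u v (P d k l) = const4 1 * P d k l"
      using FP[OF a T] by (simp add: rhom_1[OF rhom_const4])
    show "P d k l dvd F T u v [:b:] - [:special (T (emb b)):]" for b
      using to_space_special[of d k l "T (emb b)"] F\<sigma>[OF a T, of "emb b"]
      by (simp add: \<sigma>_def to_space_emb)
  qed (simp_all add: Fr Fg)
qed

section \<open>Hamiltonian vector fields tangent to a cuspidal curve\<close>

definition R0 :: "nat \<Rightarrow> nat \<Rightarrow> complex poly poly" where "R0 k l = Zv ^ k + Tv ^ l"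

text \<open>Restriction to the parametrised curve \<open>s \<mapsto> (\<zeta> s^l, s^k)\<close>,
  which lies on \<open>z^k + t^l = 0\<close> as soon as \<open>\<zeta>^k = - 1\<close>.\<close>

definition curve :: "complex \<Rightarrow> nat \<Rightarrow> nat \<Rightarrow> complex poly poly \<Rightarrow> complex poly" where
  "curve \<zeta> k l = subst2 (\<lambda>a. [:a:]) (monom \<zeta> l) (monom 1 k)"

lemma rhom_curve: "rhom (curve \<zeta> k l)"
  unfolding curve_def by (rule rhom_subst2[OF rhom_const_poly])

lemma curve_gen: "curve \<zeta> k l (cst a) = [:a:]" "curve \<zeta> k l Zv = monom \<zeta> l" "curve \<zeta> k l Tv = monom 1 k"
  by (simp_all add: curve_def subst2_gen[OF rhom_const_poly])

lemma coeff_curve: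
  "coeff (curve \<zeta> k l f) n = (\<Sum>j\<le>degree f. \<Sum>i\<le>degree (coeff f j).
     if l * i + k * j = n then coeff (coeff f j) i * \<zeta> ^ i else 0)"
proof -
  have a: "f = (\<Sum>j\<le>degree f. [:coeff f j:] * Tv ^ j)"
    using poly_as_sum_of_monoms[of f] by (simp add: Tv_def monom_altdef)
  have b: "[:p:] = (\<Sum>i\<le>degree p. cst (coeff p i) * Zv ^ i)" for p :: "complex poly"
  proof -
    have "[:p:] = [:\<Sum>i\<le>degree p. [:coeff p i:] * [:0, 1:] ^ i:]"
      using poly_as_sum_of_monoms[of p] by (simp add: monom_altdef)
    then show ?thesis
      by (simp add: rhom_simps[OF rhom_const_poly] cst_def Zv_def del: mult_pCons_left)
  qed
  have "f = (\<Sum>j\<le>degree f. (\<Sum>i\<le>degree (coeff f j). cst (coeff (coeff f j) i) * Zv ^ i) * Tv ^ j)"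
    unfolding b[symmetric] by (rule a)
  then have "curve \<zeta> k l f = curve \<zeta> k l (\<Sum>j\<le>degree f. (\<Sum>i\<le>degree (coeff f j). cst (coeff (coeff f j) i) * Zv ^ i) * Tv ^ j)"
    by (rule arg_cong)
  also have "\<dots> = (\<Sum>j\<le>degree f. \<Sum>i\<le>degree (coeff f j). monom (coeff (coeff f j) i * \<zeta> ^ i) (l * i + k * j))"
    unfolding rhom_simps[OF rhom_curve] curve_gen sum_distrib_right
    by (simp add: monom_power mult_monom smult_monom)
  finally show ?thesis
    by (simp add: coeff_sum)
qed

lemma exponent_unique:
  fixes k l i j i' j' :: nat
  assumes "coprime k l" "l * i + k * j = l * i' + k * j'" "j < l" "j' < l"
  shows "i = i' \<and> j = j'"
proof -
  have "int k * (int j - int j') = int l * (int i' - int i)"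
    using assms(2) by (simp add: algebra_simps flip: of_nat_mult of_nat_add)
  then have "int l dvd int k * (int j - int j')" by simp
  then have "int l dvd int j - int j'"
    using assms(1) by (simp add: coprime_dvd_mult_right_iff coprime_commute)
  then have "j = j'"
    using assms(3,4) dvd_imp_le_int[of "int j - int j'" "int l"] by linarith
  then show ?thesis using assms by auto
qed

lemma R0_monic:
  assumes "l > 0"
  shows "degree (R0 k l) = l" "lead_coeff (R0 k l) = 1"
proof -
  have e: "R0 k l = [:[:0, 1:] ^ k:] + monom 1 l"
    by (simp add: R0_def Zv_def Tv_def monom_altdef const_poly_simps)
  show d: "degree (R0 k l) = l"
    unfolding e using assms by (subst degree_add_eq_right) (simp_all add: degree_monom_eq)
  show "lead_coeff (R0 k l) = 1"
    unfolding d unfolding e using assms by (cases l) simp_all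
qed

text \<open>Divide by \<open>R0\<close>, monic of degree \<open>l\<close> in \<open>t\<close>. In
  the remainder the exponent of \<open>t\<close> is below \<open>l\<close>, so by coprimality
  distinct monomials have distinct orders \<open>l i + k j\<close> on the curve and nothing can
  cancel.\<close>

lemma curve_kernel:
  assumes "coprime k l" "l > 0" "\<zeta> ^ k = - 1" "\<zeta> \<noteq> 0" "curve \<zeta> k l f = 0"
  shows "R0 k l dvd f"
proof -
  obtain q r where qr: "pseudo_divmod f (R0 k l) = (q, r)" by (cases "pseudo_divmod f (R0 k l)")
  have nz: "R0 k l \<noteq> 0" using R0_monic[OF assms(2)] by (metis leading_coeff_0_iff zero_neq_one)
  have f: "f = R0 k l * q + r" "r = 0 \<or> degree r < l"
    using pseudo_divmod[OF nz qr] R0_monic[OF assms(2), of k] by simp_all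
  have "curve \<zeta> k l (R0 k l) = 0"
    unfolding R0_def rhom_simps[OF rhom_curve] curve_gen
    by (simp add: monom_power assms(3) mult.commute flip: minus_monom)
  then have r0: "curve \<zeta> k l r = 0"
    using assms(5) unfolding f(1) rhom_simps[OF rhom_curve] by simp
  have "r = 0"
  proof (rule ccontr)
    assume nr: "r \<noteq> 0"
    then have dl: "degree r < l" using f by blast
    define j0 where "j0 = degree r"
    define i0 where "i0 = degree (coeff r j0)"
    have c0: "coeff (coeff r j0) i0 \<noteq> 0" using nr by (simp add: i0_def j0_def)
    have "0 = coeff (curve \<zeta> k l r) (l * i0 + k * j0)" by (simp add: r0)
    also have "\<dots> = (\<Sum>j\<le>degree r. \<Sum>i\<le>degree (coeff r j).
       if i = i0 \<and> j = j0 then coeff (coeff r j) i * \<zeta> ^ i else 0)"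
      unfolding coeff_curve
    proof (intro sum.cong refl)
      fix j i assume "j \<in> {..degree r}"
      then have "j < l" "j0 < l" using dl by (auto simp: j0_def)
      then have "l * i + k * j = l * i0 + k * j0 \<longleftrightarrow> i = i0 \<and> j = j0"
        using exponent_unique[OF assms(1), of i j i0 j0] by auto
      then show "(if l * i + k * j = l * i0 + k * j0 then coeff (coeff r j) i * \<zeta> ^ i else 0) =
          (if i = i0 \<and> j = j0 then coeff (coeff r j) i * \<zeta> ^ i else 0)" by simp
    qed
    also have "\<dots> = (\<Sum>j\<le>degree r. if j = j0 then coeff (coeff r j0) i0 * \<zeta> ^ i0 else 0)"
      by (intro sum.cong refl) (auto simp: i0_def)
    also have "\<dots> = coeff (coeff r j0) i0 * \<zeta> ^ i0"
      by (simp add: j0_def)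
    finally show False using c0 assms(4) by simp
  qed
  then show ?thesis using f by simp
qed

lemma pderiv_curve:
  "pderiv (curve \<zeta> k l f) = curve \<zeta> k l (dz f) * monom (of_nat l * \<zeta>) (l - 1) + curve \<zeta> k l (dt f) * monom (of_nat k) (k - 1)"
proof (induction f rule: poly2_gen_induct)
  case (const a)
  then show ?case by (simp add: curve_gen dz_gen dt_gen rhom_0[OF rhom_curve])
next
  case z
  then show ?case by (simp add: curve_gen dz_gen dt_gen rhom_simps[OF rhom_curve] pderiv_monom)
next
  case t
  then show ?case by (simp add: curve_gen dz_gen dt_gen rhom_simps[OF rhom_curve] pderiv_monom)
next
  case (add p q)
  then show ?case
    by (simp add: dz_add dt_add rhom_simps[OF rhom_curve] pderiv_add algebra_simps)
next
  case (mult p q)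
  then show ?case
    by (simp add: dz_mult dt_mult rhom_simps[OF rhom_curve] pderiv_mult algebra_simps)
qed

text \<open>Along the curve the Hamiltonian field of \<open>R0\<close> is proportional to the
  velocity of the parametrisation. The assumption therefore says that \<open>h\<close> has
  derivative zero along the curve; it is a constant there, and the difference lies in the kernel of
  the restriction.\<close>

lemma hamiltonian_tangent_to_curve:
  assumes "coprime k l" "k > 0" "l > 0" "bracket (R0 k l) h = R0 k l * w"
  shows "\<exists>c h1. h = cst c + R0 k l * h1"
proof -
  obtain \<zeta> :: complex where z: "\<zeta> ^ k = - 1"
  proof -
    have "\<not> constant (poly (monom 1 k + [:1:] :: complex poly))"
      using assms(2) by (simp add: constant_degree degree_add_eq_left degree_monom_eq)
    then obtain \<zeta> where "poly (monom 1 k + [:1:]) \<zeta> = (0::complex)"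
      using fundamental_theorem_of_algebra by blast
    then show ?thesis using that by (simp add: poly_monom eq_neg_iff_add_eq_0)
  qed
  then have z0: "\<zeta> \<noteq> 0" using assms(2) by (metis neg_equal_0_iff_equal one_neq_zero power_0_left less_numeral_extra(3))
  define \<theta> where "\<theta> = curve \<zeta> k l"
  note ts = rhom_simps[OF rhom_curve[of \<zeta> k l], folded \<theta>_def]
  have g: "\<theta> (cst a) = [:a:]" "\<theta> Zv = monom \<zeta> l" "\<theta> Tv = monom 1 k" for a
    by (simp_all add: \<theta>_def curve_gen)
  obtain k' l' where kl: "k = Suc k'" "l = Suc l'" using assms(2,3) by (metis gr0_implies_Suc)
  have R: "\<theta> (R0 k l) = 0"
    unfolding R0_def ts g by (simp add: monom_power z mult.commute flip: minus_monom)
  have b: "bracket (R0 k l) h = of_nat k * Zv ^ k' * dt h - of_nat l * Tv ^ l' * dz h"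
    unfolding bracket_def R0_def kl dz_add dt_add dz_power dt_power by (simp add: dz_gen dt_gen)
  have "\<theta> (bracket (R0 k l) h) = 0"
    unfolding assms(4) ts R by simp
  then have e: "of_nat k * monom \<zeta> l ^ k' * \<theta> (dt h) = of_nat l * monom 1 k ^ l' * \<theta> (dz h)"
    unfolding b by (simp add: ts g)
  \<comment> \<open>The derivative of the equation \<open>z^k + t^l = 0\<close> along the
    parametrisation, up to the factor \<open>k\<close>; here \<open>\<zeta>^k = - 1\<close>
    enters.\<close>
  have e1: "monom \<zeta> l ^ k' * monom (of_nat l * \<zeta>) (l - 1) = - (of_nat l * monom 1 (k - 1) * monom 1 k ^ l')"
  proof -
    have zz: "\<zeta> * (\<zeta> ^ k' * c) = - c" for c
      using z by (simp add: kl flip: mult.assoc)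
    show ?thesis
      by (simp add: kl monom_power mult_monom of_nat_monom mult_ac add_ac minus_monom zz)
  qed
  have "monom \<zeta> l ^ k' * pderiv (\<theta> h) = monom \<zeta> l ^ k' * monom (of_nat l * \<zeta>) (l - 1) * \<theta> (dz h) +
      monom 1 (k - 1) * (of_nat k * monom \<zeta> l ^ k' * \<theta> (dt h))"
    unfolding \<theta>_def pderiv_curve by (simp add: of_nat_monom mult_monom algebra_simps smult_monom)
  also have "\<dots> = 0"
    unfolding e e1 by (simp add: algebra_simps)
  finally have "pderiv (\<theta> h) = 0" using z0 by (simp add: monom_eq_0_iff)
  then obtain c where "\<theta> h = [:c:]" using pderiv_iszero by blast
  then have "\<theta> (h - cst c) = 0" by (simp add: ts g)
  then have "R0 k l dvd h - cst c"
    unfolding \<theta>_def using curve_kernel[OF assms(1,3) z z0] by blast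
  then show ?thesis by (metis add.commute diff_eq_eq dvdE)
qed

section \<open>Extending automorphisms congruent to the identity\<close>

definition at0 :: "poly3 \<Rightarrow> complex poly poly" where
  "at0 = subst2 (\<lambda>p. cst (poly p 0)) Zv Tv"

lemma rhom_at0: "rhom at0"
  unfolding at0_def by (intro rhom_subst2 rhom_comp[OF rhom_cst rhom_poly])

lemma at0_gen: "at0 (cst p) = cst (poly p 0)" "at0 Zv = Zv" "at0 Tv = Tv" "at0 Xb = 0"
  by (simp_all add: at0_def subst2_gen rhom_comp[OF rhom_cst rhom_poly] Xb_def cst_simps)

lemma dz_at0: "dz (at0 f) = at0 (dz f)" and dt_at0: "dt (at0 f) = at0 (dt f)"
  by (induction f rule: poly2_gen_induct)
    (simp_all add: at0_gen dz_simps dt_simps rhom_simps[OF rhom_at0])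

lemma bracket_at0: "bracket (at0 f) (at0 g) = at0 (bracket f g)"
  by (simp add: bracket_def dz_at0 dt_at0 rhom_simps[OF rhom_at0])

definition lift0 :: "complex poly poly \<Rightarrow> poly3" where "lift0 = subst2 const3 Zv Tv"

lemma rhom_lift0: "rhom lift0"
  unfolding lift0_def by (rule rhom_subst2[OF rhom_const3])

lemma lift0_gen: "lift0 (cst a) = const3 a" "lift0 Zv = Zv" "lift0 Tv = Tv"
  by (simp_all add: lift0_def subst2_gen[OF rhom_const3])

lemma Xb_dvd_minus_lift0: "Xb dvd f - lift0 (at0 f)"
proof (rule rhom_dvd_diff[OF rhom_id rhom_comp[OF rhom_lift0 rhom_at0]])
  fix c :: "complex poly"
  have "[:0, 1:] dvd c - [:poly c 0:]"
    using poly_eq_0_iff_dvd[of "c - [:poly c 0:]" 0] by simp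
  then have "cst [:0, 1:] dvd cst (c - [:poly c 0:])" by (rule rhom_dvd[OF rhom_cst])
  then show "Xb dvd cst c - lift0 (at0 (cst c))"
    by (simp add: Xb_def at0_gen lift0_gen const3_def cst_simps)
qed (simp_all add: at0_gen lift0_gen)

lemma Xb_dvd_iff: "Xb dvd f \<longleftrightarrow> at0 f = 0"
proof
  assume "Xb dvd f"
  then show "at0 f = 0" by (auto simp: rhom_simps[OF rhom_at0] at0_gen elim!: dvdE)
next
  assume "at0 f = 0"
  then show "Xb dvd f" using Xb_dvd_minus_lift0[of f] by (simp add: rhom_simps[OF rhom_lift0])
qed

lemma Xb_power_dvd_cancel:
  assumes "Xb ^ n dvd r * f" "at0 r \<noteq> 0"
  shows "Xb ^ n dvd f"
  using assms(1)
proof (induction n arbitrary: f)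
  case (Suc n)
  then have "Xb dvd r * f" by (metis dvd_mult_left power_Suc)
  then have "Xb dvd f"
    using assms(2) by (simp add: Xb_dvd_iff rhom_simps[OF rhom_at0])
  then obtain g where g: "f = Xb * g" by (rule dvdE)
  have "Xb * Xb ^ n dvd Xb * (r * g)" using Suc.prems by (simp add: g mult_ac)
  then have "Xb ^ n dvd r * g" using Xb_nz by (simp add: dvd_mult_cancel_left)
  then have "Xb ^ n dvd g" by (rule Suc.IH)
  then show ?case by (simp add: g mult_dvd_mono)
qed simp

lemma at0_Rb: "at0 (Rb k l) = R0 k l"
  by (simp add: Rb_def R0_def rhom_simps[OF rhom_at0] at0_gen)

lemma R0_nz: "l > 0 \<Longrightarrow> R0 k l \<noteq> 0"
  using R0_monic by (metis leading_coeff_0_iff zero_neq_one)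

lemma tangent_apply:
  assumes T: "rhom T" "\<And>a. T (cst a) = cst a" and n: "n \<ge> 1" and t: "tangent \<xi> n h T"
  shows "cst \<xi> ^ Suc n dvd T f - (f + cst \<xi> ^ n * bracket f h)"
proof (induction f rule: poly2_gen_induct)
  case (const a)
  then show ?case by (simp add: T bracket_const dz_gen dt_gen)
next
  case z
  have "bracket Zv h = dt h" by (simp add: bracket_def dz_gen dt_gen)
  then show ?case using t unfolding tangent_def by (simp only:)
next
  case t
  have "bracket Tv h = - dz h" by (simp add: bracket_def dz_gen dt_gen)
  then show ?case using assms(4) unfolding tangent_def by (simp del: power_Suc)
next
  case (add p q)
  have "T (p + q) - (p + q + cst \<xi> ^ n * bracket (p + q) h) =
      (T p - (p + cst \<xi> ^ n * bracket p h)) + (T q - (q + cst \<xi> ^ n * bracket q h))"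
    by (simp add: rhom_add[OF T(1)] bracket_add algebra_simps)
  then show ?case using add by (metis dvd_add)
next
  case (mult p q)
  have e: "T (p * q) - (p * q + cst \<xi> ^ n * bracket (p * q) h) =
      (T p - (p + cst \<xi> ^ n * bracket p h)) * T q + (p + cst \<xi> ^ n * bracket p h) * (T q - (q + cst \<xi> ^ n * bracket q h))
       + (cst \<xi> ^ n * cst \<xi> ^ n) * (bracket p h * bracket q h)"
    by (simp add: rhom_mult[OF T(1)] bracket_mult algebra_simps)
  have "cst \<xi> ^ Suc n dvd cst \<xi> ^ n * cst \<xi> ^ n"
    unfolding power_add[symmetric] using n by (intro le_imp_power_dvd) simp
  from dvd_add[OF dvd_add[OF dvd_mult2[OF mult(1)] dvd_mult[OF mult(2)]] dvd_mult2[OF this]]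
  show ?case unfolding e .
qed

lemma tangent_inverse:
  assumes a: "aut2 T S" and n: "n \<ge> 1" and t: "tangent \<xi> n h T"
  shows "tangent \<xi> n (- h) S"
proof -
  define E where "E = cst \<xi>"
  have T: "rhom T" "\<And>a. T (cst a) = cst a" and S: "rhom S" "\<And>a. S (cst a) = cst a"
    and TS: "\<And>f. T (S f) = f" "\<And>f. S (T f) = f"
    using a by (auto simp: aut2_def)
  have XX: "E ^ Suc n dvd E ^ n * E ^ n"
    unfolding power_add[symmetric] using n by (intro le_imp_power_dvd) simp
  have SE: "S (E ^ m) = E ^ m" for m by (simp add: E_def rhom_simps[OF S(1)] S(2))
  have near: "E ^ n dvd S f - f" for f
  proof -
    have "E ^ n dvd S (T f - f)"
      using rhom_dvd[OF S(1) tangent_near_id[OF T t, folded E_def, of f]] by (simp add: SE)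
    then show ?thesis by (simp add: rhom_simps[OF S(1)] TS dvd_sub_swap)
  qed
  have main: "E ^ Suc n dvd S f - (f - E ^ n * bracket f h)" for f
  proof -
    have "E ^ Suc n dvd S (T f - (f + E ^ n * bracket f h))"
      using rhom_dvd[OF S(1) tangent_apply[OF T n t, folded E_def, of f]] by (simp only: SE)
    then have 1: "E ^ Suc n dvd f - (S f + E ^ n * S (bracket f h))"
      by (simp only: rhom_diff[OF S(1)] rhom_add[OF S(1)] rhom_mult[OF S(1)] TS SE)
    have 2: "E ^ Suc n dvd E ^ n * (S (bracket f h) - bracket f h)"
      using XX mult_dvd_mono[OF dvd_refl near[of "bracket f h"], of "E ^ n"] by (rule dvd_trans)
    have "S f - (f - E ^ n * bracket f h) =
        - (f - (S f + E ^ n * S (bracket f h))) - E ^ n * (S (bracket f h) - bracket f h)"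
      by (simp add: algebra_simps)
    moreover have "E ^ Suc n dvd \<dots>"
      by (rule dvd_diff[OF _ 2]) (simp only: dvd_minus_iff 1)
    ultimately show ?thesis by (simp only:)
  qed
  have "bracket Zv h = dt h" "bracket Tv h = - dz h" by (simp_all add: bracket_def dz_gen dt_gen)
  then show ?thesis
    using main[of Zv] main[of Tv] unfolding tangent_def E_def dt_uminus dz_uminus
    by (simp del: power_Suc)
qed

lemma tangent_cong:
  assumes "tangent \<xi> n h T" "cst \<xi> dvd h - h'"
  shows "tangent \<xi> n h' T"
proof -
  obtain w where "h - h' = cst \<xi> * w" using assms(2) by (rule dvdE)
  then have h: "h = h' + cst \<xi> * w" by (simp add: algebra_simps)
  have t: "dt h = dt h' + cst \<xi> * dt w" and z: "dz h = dz h' + cst \<xi> * dz w"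
    by (simp_all add: h dt_simps dz_simps)
  have "T Zv - (Zv + cst \<xi> ^ n * dt h') = (T Zv - (Zv + cst \<xi> ^ n * dt h)) + cst \<xi> ^ Suc n * dt w"
    "T Tv - (Tv - cst \<xi> ^ n * dz h') = (T Tv - (Tv - cst \<xi> ^ n * dz h)) - cst \<xi> ^ Suc n * dz w"
    unfolding t z by (simp_all add: algebra_simps)
  then show ?thesis
    using assms(1) unfolding tangent_def by (metis dvd_add dvd_diff dvd_triv_left)
qed

text \<open>Together with \<open>x\<close> going to a multiple of \<open>x\<close>, this is
  preservation of the ideal \<open>(x^d, r)\<close>, which is all that an automorphism of
  \<open>X\<close> reveals about \<open>r\<close>.\<close>

definition pres :: "nat \<Rightarrow> nat \<Rightarrow> nat \<Rightarrow> (poly3 \<Rightarrow> poly3) \<Rightarrow> bool" where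
  "pres d k l g \<longleftrightarrow> (\<exists>u v. g (Rb k l) = Rb k l * u + Xb ^ d * v)"

lemma pres_comp:
  assumes "pres d k l g" "pres d k l g'" "rhom g" "Xb dvd g Xb"
  shows "pres d k l (\<lambda>b. g (g' b))"
proof -
  obtain u v u' v' where 1: "g (Rb k l) = Rb k l * u + Xb ^ d * v" "g' (Rb k l) = Rb k l * u' + Xb ^ d * v'"
    using assms unfolding pres_def by blast
  obtain w where w: "g Xb = Xb * w" using assms(4) by (rule dvdE)
  have "g (g' (Rb k l)) = Rb k l * (u * g u') + Xb ^ d * (v * g u' + w ^ d * g v')"
    unfolding 1 rhom_simps[OF assms(3)] w by (simp add: power_mult_distrib algebra_simps)
  then show ?thesis unfolding pres_def by blast
qed

lemma at0_lift0: "at0 (lift0 f) = f"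
  by (rule rhom_poly2_eqI[OF rhom_comp[OF rhom_at0 rhom_lift0] rhom_id])
    (simp_all add: lift0_gen at0_gen const3_def)

lemma fam_gen_induct [case_names const x c z t add mult]:
  fixes p :: fam
  assumes "\<And>a. Q (cst [:[:a:]:])" "Q (cst Xi)" "Q (cst Cc)" "Q Zv" "Q Tv"
    and add: "\<And>p q. Q p \<Longrightarrow> Q q \<Longrightarrow> Q (p + q)" and mult: "\<And>p q. Q p \<Longrightarrow> Q q \<Longrightarrow> Q (p * q)"
  shows "Q p"
proof (induction p rule: poly2_gen_induct)
  case (const a)
  show ?case
  proof (induction a rule: poly_gen_induct)
    case (const a)
    show ?case
    proof (induction a rule: poly_gen_induct)
      case (add p q)
      then show ?case using assms(6)[of "cst [:p:]" "cst [:q:]"] by (simp flip: cst_simps(1))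
    next
      case (mult p q)
      then show ?case using assms(7)[of "cst [:p:]" "cst [:q:]"] by (simp add: mult.commute flip: cst_simps(2))
    qed (use assms in \<open>auto simp: Cc_def\<close>)
  next
    case (add p q)
    then show ?case using assms(6)[of "cst p" "cst q"] by (simp add: cst_simps)
  next
    case (mult p q)
    then show ?case using assms(7)[of "cst p" "cst q"] by (simp add: cst_simps)
  qed (use assms in \<open>auto simp: Xi_def\<close>)
qed (use assms in auto)

lemma dz_special: "dz (special f) = special (dz f)" and dt_special: "dt (special f) = special (dt f)"
  by (induction f rule: fam_gen_induct)
    (simp_all add: special_gen dz_simps dt_simps const3_def Xb_def rhom_simps[OF rhom_special])

text \<open>The potential carries the factor \<open>z\<^sup>k + t\<^sup>l + x - c\<close> instead of \<open>z\<^sup>k + t\<^sup>l + x\<close>, so that the flow preserves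
  every member of the family of hypersurfaces \<open>P = c\<close>.\<close>

lemma extendable_with_tangent:
  fixes h1 :: "complex poly poly"
  assumes n: "n \<ge> 1" and d: "n < d"
  shows "\<exists>T S. aut2 T S \<and> tangent [:0, 1:] n (Rb k l * lift0 h1) T \<and> extendable d k l T \<and>
    pres d k l T \<and> pres d k l S"
proof -
  define g where "g = Rf k l * emb (lift0 h1)"
  have br: "bracket (Rf k l) g = Rf k l * bracket (Rf k l) (emb (lift0 h1))"
    by (simp add: g_def bracket_def dz_mult dt_mult algebra_simps)
  have d1: "d \<ge> 1" using d by simp
  obtain \<alpha> \<beta> where ab: "cst Xi ^ Suc n dvd \<alpha> - (Zv + cst Xi ^ n * dt g)" "cst Xi ^ Suc n dvd \<beta> - (Tv - cst Xi ^ n * dz g)"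
    "cst Xi ^ d dvd bracket \<alpha> \<beta> - 1"
    and flow: "\<And>T. rhom T \<Longrightarrow> (\<And>a. T (cst a) = cst a) \<Longrightarrow> cst Xi ^ d dvd T Zv - \<alpha> \<Longrightarrow> cst Xi ^ d dvd T Tv - \<beta> \<Longrightarrow>
      (\<exists>u. cst Xi ^ d dvd T (Rf k l) - Rf k l * u \<and> cst Xi dvd u - 1)"
    using exp_flow[OF n d1 br, of Xi] by metis
  have Xn: "cst Xi ^ n dvd cst Xi ^ Suc n" by (simp add: le_imp_power_dvd)
  have "cst Xi ^ n dvd (\<alpha> - (Zv + cst Xi ^ n * dt g)) + cst Xi ^ n * dt g"
    "cst Xi ^ n dvd (\<beta> - (Tv - cst Xi ^ n * dz g)) - cst Xi ^ n * dz g"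
    using ab(1,2) Xn by (blast intro: dvd_add dvd_diff dvd_trans dvd_triv_left)+
  then have ab': "cst Xi ^ n dvd \<alpha> - Zv" "cst Xi ^ n dvd \<beta> - Tv"
    by (simp_all add: algebra_simps)
  have "Xi \<noteq> 0" by (simp add: Xi_def)
  then obtain T S where TS: "aut2 T S" "cst Xi ^ d dvd T Zv - \<alpha>" "cst Xi ^ d dvd T Tv - \<beta>"
    using lift_special_endomorphism[OF _ n ab' ab(3)] by blast
  have T: "rhom T" "\<And>a. T (cst a) = cst a" and S: "rhom S" "\<And>a. S (cst a) = cst a"
    and inv: "\<And>f. T (S f) = f" "\<And>f. S (T f) = f"
    using TS(1) by (auto simp: aut2_def)
  obtain u where u: "cst Xi ^ d dvd T (Rf k l) - Rf k l * u" "cst Xi dvd u - 1"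
    using flow[OF T TS(2,3)] by blast
  obtain v where "T (Rf k l) - Rf k l * u = cst Xi ^ d * v" using u(1) by (rule dvdE)
  then have v: "T (Rf k l) = Rf k l * u + cst Xi ^ d * v" by (simp add: algebra_simps)
  obtain w where "u - 1 = cst Xi * w" using u(2) by (rule dvdE)
  then have w: "u = 1 - - (cst Xi * w)" by (simp add: algebra_simps)
  \<comment> \<open>A finite geometric series: \<open>u\<close> is 1 modulo \<open>\<xi>\<close>,
    hence \<open>z\<close> inverts it modulo \<open>\<xi>^d\<close>. This transfers the preservation
    of the ideal from \<open>T\<close> to its inverse \<open>S\<close>.\<close>
  define z where "z = (\<Sum>i<d. (- (cst Xi * w)) ^ i)"
  have uz: "u * z = 1 - (- (cst Xi * w)) ^ d"
    unfolding w z_def by (rule one_diff_power_eq[symmetric])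
  have "S (T (Rf k l)) = S (Rf k l) * S u + cst Xi ^ d * S v"
    unfolding v rhom_simps[OF S(1)] S(2) ..
  then have e: "Rf k l = S (Rf k l) * S u + cst Xi ^ d * S v"
    unfolding inv .
  have "Rf k l * S z = S (Rf k l) * S (u * z) + cst Xi ^ d * (S v * S z)"
    using arg_cong[OF e, of "\<lambda>f. f * S z"] by (simp add: rhom_mult[OF S(1)] algebra_simps)
  also have "S (u * z) = 1 - cst Xi ^ d * (- S w) ^ d"
    unfolding uz by (simp add: rhom_simps[OF S(1)] S(2) flip: power_mult_distrib)
  finally have "S (Rf k l) = Rf k l * S z + cst Xi ^ d * (S (Rf k l) * (- S w) ^ d - S v * S z)"
    by (simp add: algebra_simps)
  then obtain v1 where v': "S (Rf k l) = Rf k l * S z + cst Xi ^ d * v1" by blast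
  define T0 where "T0 b = special (T (emb b))" for b
  define S0 where "S0 b = special (S (emb b))" for b
  have T0: "rhom T0" and S0: "rhom S0"
    unfolding T0_def S0_def using T S by (intro rhom_comp[OF rhom_special] rhom_comp[OF _ rhom_emb]; simp)+
  have T0s: "T0 (special f) = special (T f)" for f
    by (rule rhom_fam_eqI[OF rhom_comp[OF T0 rhom_special] rhom_comp[OF rhom_special T(1)]])
      (simp_all only: T special_gen T0_def emb_gen rhom_0[OF rhom_emb] rhom_0[OF rhom_special] rhom_0[OF T(1)])
  have S0s: "S0 (special f) = special (S f)" for f
    by (rule rhom_fam_eqI[OF rhom_comp[OF S0 rhom_special] rhom_comp[OF rhom_special S(1)]])
      (simp_all only: S special_gen S0_def emb_gen rhom_0[OF rhom_emb] rhom_0[OF rhom_special] rhom_0[OF S(1)])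
  have c0: "T0 (cst p) = cst p" "S0 (cst p) = cst p" for p
  proof -
    show "T0 (cst p) = cst p"
      by (rule rhom_poly_eqI[OF rhom_comp[OF T0 rhom_cst] rhom_cst])
        (simp_all only: T0_def emb_gen[unfolded Xb_def const3_def] T special_gen[unfolded Xb_def const3_def])
    show "S0 (cst p) = cst p"
      by (rule rhom_poly_eqI[OF rhom_comp[OF S0 rhom_cst] rhom_cst])
        (simp_all only: S0_def emb_gen[unfolded Xb_def const3_def] S special_gen[unfolded Xb_def const3_def])
  qed
  have "T0 (S0 b) = b" "S0 (T0 b) = b" for b
    using T0s[of "S (emb b)"] S0s[of "T (emb b)"] by (simp_all add: T0_def S0_def inv special_emb)
  then have a0: "aut2 T0 S0" by (simp add: aut2_def T0 S0 c0)
  have sX: "special (cst Xi ^ m) = Xb ^ m" for m by (simp add: rhom_simps[OF rhom_special] special_gen)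
  have sg: "special g = Rb k l * lift0 h1"
    by (simp add: g_def rhom_simps[OF rhom_special] special_Rf special_emb)
  have le: "cst Xi ^ Suc n dvd cst Xi ^ d" using d by (intro le_imp_power_dvd) simp
  have "cst Xi ^ Suc n dvd (T Zv - \<alpha>) + (\<alpha> - (Zv + cst Xi ^ n * dt g))"
    "cst Xi ^ Suc n dvd (T Tv - \<beta>) + (\<beta> - (Tv - cst Xi ^ n * dz g))"
    using TS(2,3) ab(1,2) le by (blast intro: dvd_add dvd_trans)+
  then have "cst Xi ^ Suc n dvd T Zv - (Zv + cst Xi ^ n * dt g)"
    "cst Xi ^ Suc n dvd T Tv - (Tv - cst Xi ^ n * dz g)"
    by (simp_all only: add_diff_eq diff_add_cancel)
  from this[THEN rhom_dvd[OF rhom_special]]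
  have "tangent [:0, 1:] n (Rb k l * lift0 h1) T0"
    unfolding sg[symmetric] tangent_def Xb_def[symmetric] sX
    by (simp add: rhom_simps[OF rhom_special] special_gen dz_special dt_special T0_def emb_gen)
  moreover have "extendable d k l T0"
    unfolding T0_def by (rule extendable_family[OF TS(1) v v'])
  moreover have "pres d k l T0" "pres d k l S0"
  proof -
    have "T (cst Cc) = cst Cc" "S (cst Cc) = cst Cc" using T S by simp_all
    then have "T0 (Rb k l) = Rb k l * special u + Xb ^ d * special v"
      "S0 (Rb k l) = Rb k l * special (S z) + Xb ^ d * special v1"
      by (simp_all only: T0_def S0_def emb_Rb rhom_add[OF T(1)] rhom_add[OF S(1)] v v' rhom_add[OF rhom_special]
          rhom_mult[OF rhom_special] sX special_Rf special_gen add_0_right)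
    then show "pres d k l T0" "pres d k l S0" unfolding pres_def by blast+
  qed
  ultimately show ?thesis using a0 by blast
qed

text \<open>Induction on \<open>d - n\<close>. Each round splits off an extendable \<open>T\<close>
  with the same first-order term as \<open>g\<close>; the quotient still preserves the ideal and is
  the identity to one more order.\<close>

lemma extendable_near_id:
  assumes kl: "coprime k l" "k > 0" "l > 0" "d \<ge> 1"
  shows "aut2 g g' \<Longrightarrow> pres d k l g \<Longrightarrow> pres d k l g' \<Longrightarrow> n \<ge> 1 \<Longrightarrow>
    Xb ^ n dvd g Zv - Zv \<Longrightarrow> Xb ^ n dvd g Tv - Tv \<Longrightarrow> extendable d k l g"
proof (induction "d - n" arbitrary: n g g')
  case 0
  have g: "rhom g" "\<And>a. g (cst a) = cst a" and g': "rhom g'" "\<And>a. g' (cst a) = cst a"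
    and inv: "\<And>f. g (g' f) = f" "\<And>f. g' (g f) = f"
    using 0(2) by (auto simp: aut2_def)
  have near: "Xb ^ n dvd g f - f" for f by (rule near_id[OF g 0(6,7)])
  have gX: "g' (Xb ^ n) = Xb ^ n" by (simp add: rhom_simps[OF g'(1)] Xb_def g')
  have "Xb ^ d dvd Xb ^ n" using 0(1) by (intro le_imp_power_dvd) simp
  moreover have "Xb ^ n dvd g' f - f" for f
    using rhom_dvd[OF g'(1) near[of f]] unfolding gX rhom_diff[OF g'(1)] inv by (rule dvd_sub_swap)
  ultimately have "Xb ^ d dvd g (Rb k l) - Rb k l" "Xb ^ d dvd g' (Rb k l) - Rb k l"
    using near by (blast intro: dvd_trans)+
  then obtain v v' where "g (Rb k l) - Rb k l = Xb ^ d * v" "g' (Rb k l) - Rb k l = Xb ^ d * v'"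
    by (elim dvdE)
  then have "g (Rb k l) = Rb k l + Xb ^ d * v" "g' (Rb k l) = Rb k l + Xb ^ d * v'"
    by (simp_all add: algebra_simps)
  then show ?case using extendable_shift[OF 0(2)] by blast
next
  case (Suc j)
  have jn: "j = d - Suc n" and nd: "n < d" using Suc.hyps(2) by simp_all
  have g: "rhom g" "\<And>a. g (cst a) = cst a" and g': "rhom g'" "\<And>a. g' (cst a) = cst a"
    and inv: "\<And>f. g (g' f) = f" "\<And>f. g' (g f) = f"
    using Suc.prems(1) by (auto simp: aut2_def)
  have n1: "n \<ge> 1" by fact
  define E :: "complex poly" where "E = [:0, 1:]"
  have XE: "Xb = cst E" by (simp add: Xb_def E_def)
  have E0: "E \<noteq> 0" by (simp add: E_def)
  have near: "Xb ^ n dvd g f - f" for f by (rule near_id[OF g Suc.prems(5,6)])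
  obtain a where "g Zv - Zv = Xb ^ n * a" using Suc.prems(5) by (rule dvdE)
  then have a: "g Zv = Zv + Xb ^ n * a" by (simp add: algebra_simps)
  obtain b where "g Tv - Tv = Xb ^ n * b" using Suc.prems(6) by (rule dvdE)
  then have b: "g Tv = Tv + Xb ^ n * b" by (simp add: algebra_simps)
  \<comment> \<open>The Jacobian determinant of an automorphism is a unit, hence a complex constant,
    and it is 1 because \<open>g\<close> is the identity modulo \<open>x\<close>.\<close>
  have jac: "bracket (g Zv) (g Tv) = 1"
  proof -
    have "g (bracket (g' Zv) (g' Tv)) * bracket (g Zv) (g Tv) = bracket (g (g' Zv)) (g (g' Tv))"
      by (rule bracket_chain[OF g(1), of "\<lambda>a. a", symmetric]) (simp add: g)
    also have "\<dots> = 1" by (simp add: inv bracket_def dz_gen dt_gen)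
    finally have *: "bracket (g Zv) (g Tv) * g (bracket (g' Zv) (g' Tv)) = 1" by (simp add: mult.commute)
    obtain p q where p: "bracket (g Zv) (g Tv) = [:p:]" "p * q = 1" using mult_eq_1_poly[OF *] by blast
    obtain p' q' where p': "p = [:p':]" "p' * q' = 1" using mult_eq_1_poly[OF p(2)] by blast
    obtain c where c: "p' = [:c:]" using mult_eq_1_poly[OF p'(2)] by blast
    have "Xb ^ n dvd bracket (g Zv) (g Tv) - bracket Zv Tv"
      using Suc.prems(5,6) unfolding XE by (rule bracket_cong)
    then have "Xb dvd bracket (g Zv) (g Tv) - 1"
      using n1 dvd_trans[OF dvd_power[of n Xb]] by (simp add: bracket_def dz_gen dt_gen)
    then have "at0 (cst [:c:] - 1) = 0" by (simp add: Xb_dvd_iff p p' c cst_def)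
    then have "cst c = (1 :: complex poly poly)"
      by (simp add: rhom_simps[OF rhom_at0] at0_gen)
    then have "c = 1" by (simp add: cst_def one_pCons)
    then show ?thesis by (simp add: p p' c one_pCons)
  qed
  have "cst E dvd dz a + dt b"
    using divergence_free[OF E0 n1, of a b] jac a b by (simp add: XE)
  then obtain h where h: "cst E dvd dt h - a" "cst E dvd dz h + b"
    using potential_mod by blast
  have tan: "tangent E n h g"
  proof -
    have "g Zv - (Zv + cst E ^ n * dt h) = - (cst E ^ n * (dt h - a))"
      "g Tv - (Tv - cst E ^ n * dz h) = cst E ^ n * (dz h + b)"
      by (simp_all add: a b XE algebra_simps)
    then show ?thesis
      unfolding tangent_def power_Suc2 using h by (simp only: dvd_minus_iff mult_dvd_mono[OF dvd_refl])
  qed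
  obtain u v where uv: "g (Rb k l) = Rb k l * u + Xb ^ d * v" using Suc.prems(2) unfolding pres_def by blast
  have Xd: "Xb ^ Suc n dvd Xb ^ d" using nd by (intro le_imp_power_dvd) simp
  have "Xb ^ Suc n dvd g (Rb k l) - (Rb k l + Xb ^ n * bracket (Rb k l) h)"
    using tangent_apply[OF g n1 tan] by (simp only: XE)
  moreover have "g (Rb k l) - (Rb k l + Xb ^ n * bracket (Rb k l) h) =
      (Rb k l * (u - 1) - Xb ^ n * bracket (Rb k l) h) + Xb ^ d * v"
    unfolding uv by (simp add: algebra_simps)
  \<comment> \<open>Since \<open>n < d\<close>, the summand \<open>x^d v\<close> is invisible at
    order \<open>n + 1\<close>. This is the only place where the ideal \<open>(x^d, r)\<close>
    restricts the potential.\<close>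
  ultimately have key: "Xb ^ Suc n dvd Rb k l * (u - 1) - Xb ^ n * bracket (Rb k l) h"
    using Xd by (metis dvd_add_left_iff dvd_mult2)
  have r0: "at0 (Rb k l) \<noteq> 0" using R0_nz kl by (simp add: at0_Rb)
  have "Xb ^ n dvd Rb k l * (u - 1) - Xb ^ n * bracket (Rb k l) h"
    using key by (rule dvd_trans[rotated]) (simp add: le_imp_power_dvd)
  then have "Xb ^ n dvd Rb k l * (u - 1)" by (metis dvd_diff_left_iff dvd_triv_left)
  then have "Xb ^ n dvd u - 1" by (rule Xb_power_dvd_cancel[OF _ r0])
  then obtain u' where u': "u - 1 = Xb ^ n * u'" by (rule dvdE)
  have "Xb ^ n * Xb dvd Xb ^ n * (Rb k l * u' - bracket (Rb k l) h)"
    using key by (simp add: u' algebra_simps)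
  then have "Xb dvd Rb k l * u' - bracket (Rb k l) h" using Xb_nz by (simp add: dvd_mult_cancel_left)
  then have "bracket (R0 k l) (at0 h) = R0 k l * at0 u'"
    by (simp add: Xb_dvd_iff rhom_simps[OF rhom_at0] at0_Rb flip: bracket_at0)
  then obtain c h1 where h1: "at0 h = cst c + R0 k l * h1"
    using hamiltonian_tangent_to_curve[OF kl(1-3)] by blast
  \<comment> \<open>The constant \<open>c\<close> of the potential produces no vector field, so the
    first-order term of \<open>g\<close> comes from a multiple of \<open>r\<close>.\<close>
  have tan': "tangent E n (Rb k l * lift0 h1) g"
  proof -
    have "at0 (h - const3 c - Rb k l * lift0 h1) = 0"
      by (simp add: rhom_simps[OF rhom_at0] h1 at0_Rb at0_lift0 const3_def at0_gen)
    then have "cst E dvd (h - const3 c) - Rb k l * lift0 h1" by (simp only: Xb_dvd_iff flip: XE)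
    moreover have "tangent E n (h - const3 c) g"
      using tan by (simp add: tangent_def dt_diff dz_diff const3_def dz_gen dt_gen)
    ultimately show ?thesis by (rule tangent_cong[rotated])
  qed
  obtain T S where TS: "aut2 T S" "tangent E n (Rb k l * lift0 h1) T" "extendable d k l T" "pres d k l T" "pres d k l S"
    using extendable_with_tangent[OF n1 nd, of k l h1] unfolding E_def by blast
  have T: "rhom T" "\<And>a. T (cst a) = cst a" and S: "rhom S" "\<And>a. S (cst a) = cst a" and TSinv: "\<And>f. T (S f) = f"
    using TS(1) by (auto simp: aut2_def)
  have "tangent E n (- (Rb k l * lift0 h1) + Rb k l * lift0 h1) (\<lambda>f. S (g f))"
    by (rule tangent_comp[OF S n1 tangent_inverse[OF TS(1) n1 TS(2)] tan'])
  then have t0: "Xb ^ Suc n dvd S (g Zv) - Zv" "Xb ^ Suc n dvd S (g Tv) - Tv"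
    by (simp_all add: tangent_def dt_gen dz_gen XE del: power_Suc)
  have X1: "Xb dvd S Xb" "Xb dvd g' Xb" by (simp_all add: Xb_def S g')
  have "extendable d k l (\<lambda>f. S (g f))"
    by (rule Suc.hyps(1)[OF jn aut2_comp[OF aut2_sym[OF TS(1)] Suc.prems(1)]
          pres_comp[OF TS(5) Suc.prems(2) S(1) X1(1)] pres_comp[OF Suc.prems(3) TS(4) g'(1) X1(2)] _ t0]) simp
  from extendable_comp[OF TS(3) this] show ?case by (simp add: TSinv)
qed

section \<open>Automorphisms of the plane preserving the cuspidal curve\<close>

text \<open>Rescaling \<open>z\<close> by \<open>s^l\<close> and \<open>t\<close> by
  \<open>s^k\<close>: the coefficients in the new variable \<open>s\<close> are the weighted
  homogeneous parts, and the degree in \<open>s\<close> is the weighted degree.\<close>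

definition wt_hom :: "nat \<Rightarrow> nat \<Rightarrow> complex poly poly \<Rightarrow> complex poly poly poly" where
  "wt_hom k l = subst2 (\<lambda>a. [:cst a:]) (monom Zv l) (monom Tv k)"

abbreviation wdeg :: "nat \<Rightarrow> nat \<Rightarrow> complex poly poly \<Rightarrow> nat" where
  "wdeg k l f \<equiv> degree (wt_hom k l f)"

lemma rhom_wt_hom: "rhom (wt_hom k l)"
  unfolding wt_hom_def by (intro rhom_subst2 rhom_comp[OF rhom_const_poly rhom_cst])

lemma wt_hom_gen: "wt_hom k l (cst a) = [:cst a:]" "wt_hom k l Zv = monom Zv l" "wt_hom k l Tv = monom Tv k"
  by (simp_all add: wt_hom_def subst2_gen rhom_comp[OF rhom_const_poly rhom_cst])

lemma wt_hom_eq_0_iff: "wt_hom k l f = 0 \<longleftrightarrow> f = 0"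
proof
  assume "wt_hom k l f = 0"
  moreover have "poly (wt_hom k l f) 1 = f"
    by (rule rhom_poly2_eqI[OF rhom_comp[OF rhom_poly rhom_wt_hom] rhom_id]) (simp_all add: wt_hom_gen poly_monom)
  ultimately show "f = 0" by simp
qed (simp add: rhom_0[OF rhom_wt_hom])

lemma map_deriv_mult:
  fixes D :: "'a::comm_ring_1 \<Rightarrow> 'a"
  assumes D: "\<And>a b. D (a + b) = D a + D b" "\<And>a b. D (a * b) = D a * b + a * D b"
  shows "map_poly D (p + q) = map_poly D p + map_poly D q"
    and "map_poly D (p * q) = map_poly D p * q + p * map_poly D q"
proof -
  have D0: "D 0 = 0" using D(1)[of 0 0] by simp
  have s: "D (sum h A) = (\<Sum>i\<in>A. D (h i))" for h :: "nat \<Rightarrow> 'a" and A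
    by (induction A rule: infinite_finite_induct) (simp_all add: D D0)
  show "map_poly D (p + q) = map_poly D p + map_poly D q"
    by (rule poly_eqI) (simp add: coeff_map_poly D0 D)
  show "map_poly D (p * q) = map_poly D p * q + p * map_poly D q"
    by (rule poly_eqI) (simp add: coeff_map_poly coeff_mult D0 D s sum.distrib)
qed

text \<open>A partial derivative lowers the weight of each homogeneous part by the weight of its
  variable; multiplying by that power of \<open>s\<close> avoids negative exponents.\<close>

lemma wt_hom_dz: "monom 1 l * wt_hom k l (dz f) = map_poly dz (wt_hom k l f)"
  and wt_hom_dt: "monom 1 k * wt_hom k l (dt f) = map_poly dt (wt_hom k l f)"
proof -
  note ws = rhom_simps[OF rhom_wt_hom[of k l]]
  note mz = map_deriv_mult[of dz, OF dz_add dz_mult] and mt = map_deriv_mult[of dt, OF dt_add dt_mult]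
  show "monom 1 l * wt_hom k l (dz f) = map_poly dz (wt_hom k l f)"
  proof (induction f rule: poly2_gen_induct)
    case (mult p q)
    have "monom 1 l * wt_hom k l (dz (p * q)) =
        (monom 1 l * wt_hom k l (dz p)) * wt_hom k l q + wt_hom k l p * (monom 1 l * wt_hom k l (dz q))"
      by (simp only: dz_mult ws) (simp only: algebra_simps)
    then show ?case by (simp only: mult ws mz)
  qed (simp_all add: wt_hom_gen dz_gen dz_add ws mz map_poly_pCons map_poly_monom distrib_left)
  show "monom 1 k * wt_hom k l (dt f) = map_poly dt (wt_hom k l f)"
  proof (induction f rule: poly2_gen_induct)
    case (mult p q)
    have "monom 1 k * wt_hom k l (dt (p * q)) =
        (monom 1 k * wt_hom k l (dt p)) * wt_hom k l q + wt_hom k l p * (monom 1 k * wt_hom k l (dt q))"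
      by (simp only: dt_mult ws) (simp only: algebra_simps)
    then show ?case by (simp only: mult ws mt)
  qed (simp_all add: wt_hom_gen dt_gen dt_add ws mt map_poly_pCons map_poly_monom distrib_left)
qed

lemma wdeg_dz: "dz f \<noteq> 0 \<Longrightarrow> wdeg k l (dz f) + l \<le> wdeg k l f"
  and wdeg_dt: "dt f \<noteq> 0 \<Longrightarrow> wdeg k l (dt f) + k \<le> wdeg k l f"
proof -
  assume "dz f \<noteq> 0"
  then have "degree (monom 1 l * wt_hom k l (dz f)) = l + wdeg k l (dz f)"
    by (subst degree_mult_eq) (simp_all add: wt_hom_eq_0_iff degree_monom_eq monom_eq_0_iff)
  then show "wdeg k l (dz f) + l \<le> wdeg k l f"
    unfolding wt_hom_dz using map_poly_degree_leq[of dz "wt_hom k l f"] by simp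
next
  assume "dt f \<noteq> 0"
  then have "degree (monom 1 k * wt_hom k l (dt f)) = k + wdeg k l (dt f)"
    by (subst degree_mult_eq) (simp_all add: wt_hom_eq_0_iff degree_monom_eq monom_eq_0_iff)
  then show "wdeg k l (dt f) + k \<le> wdeg k l f"
    unfolding wt_hom_dt using map_poly_degree_leq[of dt "wt_hom k l f"] by simp
qed

lemma wdeg_mult: "f \<noteq> 0 \<Longrightarrow> g \<noteq> 0 \<Longrightarrow> wdeg k l (f * g) = wdeg k l f + wdeg k l g"
  by (simp add: rhom_mult[OF rhom_wt_hom] degree_mult_eq wt_hom_eq_0_iff)

lemma wdeg_bracket:
  assumes "bracket f g \<noteq> 0"
  shows "wdeg k l (bracket f g) + (k + l) \<le> wdeg k l f + wdeg k l g"
proof -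
  have t1: "wdeg k l (dz f * dt g) + (k + l) \<le> wdeg k l f + wdeg k l g" if "dz f * dt g \<noteq> 0" for f g
    using that wdeg_dz[of f k l] wdeg_dt[of g k l] by (simp add: wdeg_mult)
  have w: "wt_hom k l (bracket f g) = wt_hom k l (dz f * dt g) - wt_hom k l (dz g * dt f)"
    by (simp add: bracket_def rhom_diff[OF rhom_wt_hom] mult.commute)
  consider "dz f * dt g \<noteq> 0" "dz g * dt f \<noteq> 0" | "dz f * dt g \<noteq> 0" "dz g * dt f = 0"
    | "dz f * dt g = 0" "dz g * dt f \<noteq> 0"
  proof -
    have "dz f * dt g \<noteq> 0 \<or> dz g * dt f \<noteq> 0"
    proof (rule ccontr)
      assume "\<not> ?thesis"
      then have "dz f * dt g = 0" "dz g * dt f = 0" by blast+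
      then show False using assms by (simp only: bracket_def mult.commute[of "dt f"]) simp
    qed
    then show ?thesis using that by blast
  qed
  then show ?thesis
  proof cases
    case 1
    have "wdeg k l (bracket f g) \<le> max (wdeg k l (dz f * dt g)) (wdeg k l (dz g * dt f))"
      unfolding w by (rule degree_diff_le_max)
    then show ?thesis using t1[OF 1(1)] t1[OF 1(2)] by linarith
  next
    case 2
    then show ?thesis using t1[OF 2(1)] by (simp only: w 2(2) rhom_0[OF rhom_wt_hom] diff_0_right)
  next
    case 3
    then show ?thesis using t1[OF 3(2)]
      by (simp only: w 3(1) rhom_0[OF rhom_wt_hom] diff_0 degree_minus add.commute[of "wdeg k l f"])
  qed
qed

lemma wdeg_cst: "wdeg k l (cst a) = 0"
  by (simp add: wt_hom_gen)

lemma derivs_0_const: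
  assumes "dz f = 0" "dt f = 0"
  shows "\<exists>a. f = cst (a :: complex)"
proof -
  obtain p where p: "f = [:p:]" using assms(2) pderiv_iszero unfolding dt_def by blast
  then have "pderiv p = 0" using assms(1) by (simp add: dz_def map_poly_pCons)
  then show ?thesis using pderiv_iszero p unfolding cst_def by blast
qed

lemma aut2_bracket_unit:
  assumes "aut2 T S"
  shows "\<exists>q. bracket (T Zv) (T Tv) * q = 1"
proof -
  have T: "rhom T" "\<And>a. T (cst a) = cst a" and inv: "\<And>f. T (S f) = f" using assms by (auto simp: aut2_def)
  have "T (bracket (S Zv) (S Tv)) * bracket (T Zv) (T Tv) = bracket (T (S Zv)) (T (S Tv))"
    by (rule bracket_chain[OF T(1), of "\<lambda>a. a", symmetric]) (simp add: T)
  also have "\<dots> = 1" by (simp add: inv bracket_def dz_gen dt_gen)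
  finally show ?thesis by (metis mult.commute)
qed

lemma unit_complex_poly2:
  fixes p q :: "complex poly poly"
  assumes "p * q = 1"
  shows "\<exists>c. c \<noteq> 0 \<and> p = cst c"
proof -
  obtain a b where "p = [:a:]" "a * b = 1" using mult_eq_1_poly[OF assms] by blast
  moreover obtain c e where "a = [:c:]" "c * e = 1" using mult_eq_1_poly[OF calculation(2)] by blast
  ultimately show ?thesis by (auto simp: cst_def)
qed

lemma bracket_power: "bracket (f ^ Suc n) g = of_nat (Suc n) * f ^ n * bracket f g"
  "bracket f (g ^ Suc n) = of_nat (Suc n) * g ^ n * bracket f g"
  unfolding bracket_def dz_power dt_power by (simp_all add: algebra_simps)

text \<open>The images satisfy \<open>\<alpha>^k + \<beta>^l = c R0\<close> and have constant
  nonzero Jacobian. Taking brackets of this relation with \<open>\<alpha>\<close> and with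
  \<open>\<beta>\<close> expresses \<open>\<beta>^(l-1)\<close> and \<open>\<alpha>^(k-1)\<close> as
  brackets with \<open>R0\<close>, whose weighted degree is at most \<open>k l\<close>; that bounds
  the degrees of \<open>\<alpha>\<close> and \<open>\<beta>\<close> by those of \<open>z\<close> and
  \<open>t\<close>.\<close>

lemma plane_curve_automorphism:
  fixes T S :: "complex poly poly \<Rightarrow> complex poly poly"
  assumes kl: "2 \<le> k" "k < l" and a: "aut2 T S" and TR: "T (R0 k l) = R0 k l * w" and SR: "S (R0 k l) = R0 k l * w'"
  shows "\<exists>a b c. a \<noteq> 0 \<and> b \<noteq> 0 \<and> c \<noteq> 0 \<and> T Zv = cst a * Zv \<and> T Tv = cst b * Tv \<and> a ^ k = c \<and> b ^ l = c \<and> w = cst c"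
proof -
  have T: "rhom T" "\<And>a. T (cst a) = cst a" and S: "rhom S" and inv: "\<And>f. T (S f) = f"
    using a by (auto simp: aut2_def)
  have "R0 k l * 1 = T (S (R0 k l))" by (simp add: inv)
  also have "\<dots> = R0 k l * (w * T w')" unfolding SR rhom_mult[OF T(1)] TR by (simp add: mult.assoc)
  finally have "w * T w' = 1" using R0_nz[of l k] kl by (metis gr_implies_not0 mult_cancel_left neq0_conv)
  then obtain c where c: "c \<noteq> 0" "w = cst c" using unit_complex_poly2 by blast
  define \<alpha> where "\<alpha> = T Zv"
  define \<beta> where "\<beta> = T Tv"
  have rel: "\<alpha> ^ k + \<beta> ^ l = R0 k l * cst c"
    using TR unfolding R0_def rhom_simps[OF T(1)] \<alpha>_def \<beta>_def c .
  obtain j where j: "c \<noteq> 0" "bracket \<alpha> \<beta> = cst j" "j \<noteq> 0"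
    using aut2_bracket_unit[OF a] unit_complex_poly2 c unfolding \<alpha>_def \<beta>_def by blast
  have jn: "cst j \<noteq> 0" using j by (simp add: cst_def)
  have nz: "\<alpha> \<noteq> 0" "\<beta> \<noteq> 0" using j jn by (auto simp: bracket_0)
  obtain k' l' where kl': "k = Suc k'" "l = Suc l'" using kl by (metis Suc_le_D less_eq_Suc_le numeral_2_eq_2)
  have bR: "wdeg k l (R0 k l * cst c) \<le> k * l"
  proof -
    have "wt_hom k l (R0 k l * cst c) = monom (Zv ^ k * cst c) (k * l) + monom (Tv ^ l * cst c) (k * l)"
      by (simp add: R0_def rhom_simps[OF rhom_wt_hom] wt_hom_gen monom_power algebra_simps smult_monom)
    then show ?thesis by (simp add: add_monom degree_monom_le)
  qed
  define A where "A = wdeg k l \<alpha>"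
  define B where "B = wdeg k l \<beta>"
  have pw: "wdeg k l (f ^ n) = n * wdeg k l f" if "f \<noteq> 0" for f n
    using that by (induction n) (simp_all add: wdeg_mult rhom_1[OF rhom_wt_hom])
  have e1: "bracket \<alpha> (R0 k l * cst c) = cst (of_nat l * j) * \<beta> ^ l'"
    unfolding rel[symmetric] bracket_add
    unfolding kl' bracket_power bracket_self j(2) cst_simps by (simp add: mult_ac)
  have e2: "bracket (R0 k l * cst c) \<beta> = cst (of_nat k * j) * \<alpha> ^ k'"
    unfolding rel[symmetric] bracket_add
    unfolding kl' bracket_power bracket_self j(2) cst_simps by (simp add: mult_ac)
  have cn: "cst (of_nat l * j) \<noteq> 0" "cst (of_nat k * j) \<noteq> 0" using j kl by (simp_all add: cst_def)
  have "wdeg k l (cst (of_nat l * j) * \<beta> ^ l') + (k + l) \<le> A + k * l"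
    using wdeg_bracket[of \<alpha> "R0 k l * cst c" k l] bR cn nz unfolding e1 A_def by simp
  then have i1: "l' * B + (k + l) \<le> A + k * l"
    using cn nz by (simp add: wdeg_mult pw wdeg_cst B_def)
  have "wdeg k l (cst (of_nat k * j) * \<alpha> ^ k') + (k + l) \<le> B + k * l"
    using wdeg_bracket[of "R0 k l * cst c" \<beta> k l] bR cn nz unfolding e2 B_def by simp
  then have i2: "k' * A + (k + l) \<le> B + k * l"
    using cn nz by (simp add: wdeg_mult pw wdeg_cst A_def)
  \<comment> \<open>In terms of the excesses \<open>a = A - l\<close> and \<open>b = B - k\<close>
    the two estimates read \<open>(l - 1) b \<le> a\<close> and \<open>(k - 1) a \<le> b\<close>.
    With \<open>l - 1 \<ge> 2\<close> and \<open>k - 1 \<ge> 1\<close> neither excess can be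
    positive.\<close>
  have AB: "A \<le> l" "B \<le> k"
  proof -
    define a b where "a = int A - int l" and "b = int B - int k"
    have "int (l' * B + (k + l)) \<le> int (A + k * l)" "int (k' * A + (k + l)) \<le> int (B + k * l)"
      using i1 i2 by linarith+
    then have 1: "int l' * b \<le> a" and 2: "int k' * a \<le> b"
      unfolding a_def b_def kl' by (simp_all add: algebra_simps)
    have l2: "int l' \<ge> 2" and k1: "int k' \<ge> 1" using kl kl' by simp_all
    have "b \<le> 0"
    proof (rule ccontr)
      assume "\<not> b \<le> 0"
      then have "2 * b \<le> int l' * b" using l2 by (intro mult_right_mono) simp_all
      then have "a > 0" "2 * b \<le> a" using 1 \<open>\<not> b \<le> 0\<close> by linarith+
      moreover then have "1 * a \<le> int k' * a" using k1 by (intro mult_right_mono) simp_all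
      ultimately show False using 2 \<open>\<not> b \<le> 0\<close> by linarith
    qed
    moreover have "a \<le> 0"
    proof (rule ccontr)
      assume "\<not> a \<le> 0"
      then have "1 * a \<le> int k' * a" using k1 by (intro mult_right_mono) simp_all
      then show False using 2 \<open>\<not> a \<le> 0\<close> \<open>b \<le> 0\<close> by linarith
    qed
    ultimately show "A \<le> l" "B \<le> k" by (simp_all add: a_def b_def)
  qed
  \<comment> \<open>Weight at most \<open>k < l\<close> leaves in \<open>\<beta>\<close> only a
    constant and a linear term in \<open>t\<close>. Weight at most \<open>l\<close> makes the
    \<open>z\<close>-derivative of \<open>\<alpha>\<close> constant, but may still allow powers of
    \<open>t\<close> in \<open>\<alpha>\<close>.\<close>
  have "dz \<beta> = 0" using wdeg_dz[of \<beta> k l] AB kl by (fastforce simp: B_def)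
  moreover have "dz (dt \<beta>) = 0" by (simp add: dz_dt_commute calculation dt_gen)
  moreover have "dt (dt \<beta>) = 0"
    using wdeg_dt[of "dt \<beta>" k l] wdeg_dt[of \<beta> k l] AB kl by (fastforce simp: B_def dt_gen)
  ultimately obtain b where b: "dt \<beta> = cst b" "dz \<beta> = 0" using derivs_0_const by blast
  have "dz (dz \<alpha>) = 0"
    using wdeg_dz[of "dz \<alpha>" k l] wdeg_dz[of \<alpha> k l] AB kl by (fastforce simp: A_def dz_gen)
  moreover have "dt (dz \<alpha>) = 0"
    using wdeg_dt[of "dz \<alpha>" k l] wdeg_dz[of \<alpha> k l] AB kl by (fastforce simp: A_def dt_gen)
  ultimately obtain a where a: "dz \<alpha> = cst a" using derivs_0_const by blast
  have "cst j = cst a * cst b" using j(2) by (simp add: bracket_def a b)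
  then have ab: "a \<noteq> 0" "b \<noteq> 0" using jn by (auto simp: cst_simps)
  have cab: "cst a \<noteq> 0" "cst b \<noteq> 0" using ab by (simp_all add: cst_def)
  have fin: "\<exists>a0. \<gamma> = cst a * v + cst a0" if "dz (\<gamma> - cst a * v) = 0" "dt (\<gamma> - cst a * v) = 0"
    for \<gamma> v :: "complex poly poly" and a
    using derivs_0_const[OF that] by (metis add.commute diff_eq_eq)
  have kn: "(of_nat k :: complex poly poly) \<noteq> 0" using kl by simp
  \<comment> \<open>Differentiating the relation in \<open>z\<close> shows that
    \<open>\<alpha>^(k-1)\<close> is a multiple of \<open>z^(k-1)\<close>; as
    \<open>k \<ge> 2\<close>, this excludes \<open>t\<close> from \<open>\<alpha>\<close>.\<close>
  have "dz (\<alpha> ^ k + \<beta> ^ l) = dz (R0 k l * cst c)" by (simp only: rel)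
  then have "of_nat k * (cst a * \<alpha> ^ k') = of_nat k * (cst c * Zv ^ k')"
    unfolding R0_def kl' by (simp add: dz_add dz_mult dz_power a b dz_gen algebra_simps del: power_Suc of_nat_Suc)
  then have za: "cst a * \<alpha> ^ k' = cst c * Zv ^ k'"
    using mult_left_cancel[OF kn] by blast
  obtain k'' where k'': "k' = Suc k''" using kl kl' by (cases k') simp_all
  have "dt (cst a * \<alpha> ^ k') = 0" unfolding za unfolding k'' by (simp add: dt_mult dt_power dt_gen del: power_Suc)
  then have "cst a * (of_nat (Suc k'') * \<alpha> ^ k'' * dt \<alpha>) = 0"
    unfolding k'' by (simp add: dt_mult dt_power dt_gen del: power_Suc of_nat_Suc)
  then have dta: "dt \<alpha> = 0" using cab nz by (simp del: of_nat_Suc)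
  obtain a0 where a0: "\<alpha> = cst a * Zv + cst a0"
    using fin[of \<alpha> a Zv] dta a by (auto simp: dz_simps dt_simps)
  obtain b0 where b0: "\<beta> = cst b * Tv + cst b0"
    using fin[of \<beta> b Tv] b by (auto simp: dz_simps dt_simps)
  \<comment> \<open>Evaluation at the origin, the singular point of the curve, removes the constant
    terms of \<open>\<alpha>\<close> and \<open>\<beta>\<close>.\<close>
  define e where "e = subst2 (\<lambda>a. a) (0::complex) 0"
  have er: "rhom e" unfolding e_def by (rule rhom_subst2[OF rhom_id])
  have eg: "e (cst q) = q" "e Zv = 0" "e Tv = 0" for q
    unfolding e_def by (simp_all only: subst2_gen[OF rhom_id])
  have "e (cst a * \<alpha> ^ k') = 0" unfolding za unfolding k'' by (simp add: rhom_simps[OF er] eg)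
  then have "a0 = 0" using ab unfolding a0 k'' by (auto simp add: rhom_simps[OF er] eg)
  then have \<alpha>: "\<alpha> = cst a * Zv" by (simp add: a0 cst_simps)
  have Zn: "(Zv :: complex poly poly) \<noteq> 0" "(Tv :: complex poly poly) \<noteq> 0" by (simp_all add: Zv_def Tv_def)
  have "cst (a ^ k) * Zv ^ k' = cst c * Zv ^ k'"
    using za unfolding \<alpha> by (simp add: kl' cst_simps power_mult_distrib mult_ac)
  then have ak: "cst (a ^ k) = (cst c :: complex poly poly)" using Zn by simp
  then have ak': "a ^ k = c" by (simp add: cst_def)
  have bl: "\<beta> ^ l = cst c * Tv ^ l"
    using rel unfolding \<alpha> R0_def by (simp add: power_mult_distrib algebra_simps ak flip: cst_simps)
  have "e (\<beta> ^ l) = 0" unfolding bl using kl by (simp add: rhom_simps[OF er] eg)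
  then have "b0 = 0" unfolding b0 using kl by (auto simp add: rhom_simps[OF er] eg)
  then have \<beta>: "\<beta> = cst b * Tv" by (simp add: b0 cst_simps)
  have "cst (b ^ l) * Tv ^ l = cst c * Tv ^ l"
    using bl unfolding \<beta> by (simp add: cst_simps power_mult_distrib)
  then have "cst (b ^ l) = (cst c :: complex poly poly)" using Zn by simp
  then have "b ^ l = c" by (simp add: cst_def)
  then show ?thesis using ab ak' \<alpha> \<beta> c unfolding \<alpha>_def \<beta>_def by blast
qed

section \<open>Diagonal automorphisms, and the reduction of the general case to the identity modulo
  \<open>x\<close>\<close>

definition torus :: "complex \<Rightarrow> complex \<Rightarrow> complex \<Rightarrow> poly3 \<Rightarrow> poly3" where
  "torus c a b = subst2 (lift_hom const3 (const3 c * Xb)) (const3 a * Zv) (const3 b * Tv)"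

lemma rhom_torus: "rhom (torus c a b)"
  unfolding torus_def by (intro rhom_subst2 rhom_lift_hom rhom_const3)

lemma torus_gen: "torus c a b (const3 e) = const3 e" "torus c a b Xb = const3 c * Xb"
  "torus c a b Zv = const3 a * Zv" "torus c a b Tv = const3 b * Tv"
proof -
  have h: "rhom (lift_hom const3 (const3 c * Xb))" by (intro rhom_lift_hom rhom_const3)
  show "torus c a b Zv = const3 a * Zv" "torus c a b Tv = const3 b * Tv"
    by (simp_all only: torus_def subst2_gen[OF h])
  show "torus c a b (const3 e) = const3 e"
    by (simp only: torus_def const3_def[of e] subst2_gen[OF h] lift_hom_const[OF rhom_const3])
  show "torus c a b Xb = const3 c * Xb"
    unfolding torus_def by (subst (2) Xb_def) (simp only: subst2_gen[OF h] lift_hom_X[OF rhom_const3])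
qed

lemma torus_inverse:
  assumes "c \<noteq> 0" "a \<noteq> 0" "b \<noteq> 0"
  shows "torus c a b (torus (inverse c) (inverse a) (inverse b) f) = f"
    "torus (inverse c) (inverse a) (inverse b) (torus c a b f) = f"
proof -
  have m: "const3 x * (const3 y * f) = f" if "x * y = 1" for x y f
    using that rhom_mult[OF rhom_const3, of x y] rhom_1[OF rhom_const3] by (simp flip: mult.assoc)
  show "torus c a b (torus (inverse c) (inverse a) (inverse b) f) = f"
    by (rule rhom_poly3_eqI'[OF rhom_comp[OF rhom_torus rhom_torus] rhom_id])
      (use assms in \<open>simp_all add: torus_gen rhom_mult[OF rhom_torus] m\<close>)
  show "torus (inverse c) (inverse a) (inverse b) (torus c a b f) = f"
    by (rule rhom_poly3_eqI'[OF rhom_comp[OF rhom_torus rhom_torus] rhom_id])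
      (use assms in \<open>simp_all add: torus_gen rhom_mult[OF rhom_torus] m\<close>)
qed

lemma torus_Rb:
  assumes "a ^ k = c" "b ^ l = c"
  shows "torus c a b (Rb k l) = const3 c * Rb k l"
  by (simp add: Rb_def rhom_simps[OF rhom_torus] torus_gen power_mult_distrib assms algebra_simps
      flip: rhom_power[OF rhom_const3])

lemma extendable_torus:
  assumes c: "c \<noteq> 0" "a \<noteq> 0" "b \<noteq> 0" "a ^ k = c" "b ^ l = c"
  shows "extendable d k l (torus c a b)"
proof -
  \<comment> \<open>The factor on \<open>y\<close> is \<open>c^(1-d)\<close>: since
    \<open>x^d\<close> is multiplied by \<open>c^d\<close>, this gives \<open>x^d y\<close> the same
    factor \<open>c\<close> as the other summands of \<open>P\<close>.\<close>
  define F where "F c a b = hom4 const4 [:const3 c * Xb:] [:const3 a * Zv:] [:const3 b * Tv:] (const4 (c * inverse c ^ d) * var_y)"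
    for c a b
  have Fr: "rhom (F c a b)" for c a b unfolding F_def by (rule rhom_hom4[OF rhom_const4])
  have Fb: "F c a b [:f:] = [:torus c a b f:]" for c a b f
    by (rule rhom_poly3_eqI'[OF rhom_comp[OF Fr rhom_const_poly] rhom_comp[OF rhom_const_poly rhom_torus]])
      (simp_all only: torus_gen F_def hom4_gen'[OF rhom_const4] flip: var_const_poly(4))
  have Fy: "F c a b var_y = const4 (c * inverse c ^ d) * var_y" for c a b
    by (simp only: F_def hom4_gen'[OF rhom_const4])
  have FP: "F c a b (P d k l) = const4 c * P d k l" if "c \<noteq> 0" "a ^ k = c" "b ^ l = c" for c a b
  proof -
    have "c ^ d * (c * inverse c ^ d) = c"
      using that by (simp add: power_inverse)
    then have "const3 c ^ d * const3 (c * inverse c ^ d) = const3 c"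
      by (simp only: rhom_mult[OF rhom_const3, symmetric] rhom_power[OF rhom_const3, symmetric])
    then have "[:const3 c ^ d:] * const4 (c * inverse c ^ d) = const4 c"
      by (simp add: var_const_poly mult.commute)
    then have "[:const3 c ^ d * Xb ^ d:] * (const4 (c * inverse c ^ d) * var_y) = const4 c * ([:Xb ^ d:] * var_y)"
      unfolding const_poly_simps by (metis (no_types, lifting) mult.assoc mult.left_commute)
    then show ?thesis
      unfolding P_eq rhom_add[OF Fr] rhom_mult[OF Fr] Fb Fy torus_Rb[OF that(2,3)]
        rhom_power[OF rhom_torus] torus_gen power_mult_distrib
      by (simp only: distrib_left var_const_poly(4)[of c] const_poly_simps(2))
  qed
  have inv: "F c a b (F (inverse c) (inverse a) (inverse b) f) = f" if "c \<noteq> 0" "a \<noteq> 0" "b \<noteq> 0" "a ^ k = c" "b ^ l = c" for c a b f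
  proof (rule hom4_inverse[OF Fr Fr])
    have "F c a b (F (inverse c) (inverse a) (inverse b) (P d k l)) = const4 (inverse c) * (const4 c * P d k l)"
    proof -
      have "F (inverse c) (inverse a) (inverse b) (P d k l) = const4 (inverse c) * P d k l"
        using that by (intro FP) (simp_all add: power_inverse)
      moreover have "F c a b (const4 (inverse c)) = const4 (inverse c)"
        by (simp only: var_const_poly(4) Fb torus_gen)
      ultimately show ?thesis by (simp only: rhom_mult[OF Fr] FP[OF that(1,4,5)])
    qed
    also have "\<dots> = P d k l"
      using that rhom_mult[OF rhom_const4, of "inverse c" c] by (simp add: rhom_1[OF rhom_const4] flip: mult.assoc)
    finally show "F c a b (F (inverse c) (inverse a) (inverse b) (P d k l)) = P d k l" .
  qed (simp_all only: var_const_poly(4) Fb torus_inverse(1)[OF that(1-3)])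
  show ?thesis
    unfolding extendable_def
  proof (rule exI[where x = "F c a b"], rule exI[where x = "F (inverse c) (inverse a) (inverse b)"], rule exI[where x = c],
      intro conjI allI)
    show "F c a b (F (inverse c) (inverse a) (inverse b) f) = f" for f by (rule inv[OF c])
    show "F (inverse c) (inverse a) (inverse b) (F c a b f) = f" for f
      using inv[of "inverse c" "inverse a" "inverse b" f] c by (simp add: power_inverse)
    show "F c a b (P d k l) = const4 c * P d k l" by (rule FP[OF c(1,4,5)])
    show "P d k l dvd F c a b [:f:] - [:torus c a b f:]" for f by (simp add: Fb)
  qed (simp_all add: Fr c var_const_poly Fb torus_gen)
qed

lemma extendable_automorphism:
  assumes kl: "2 \<le> k" "k < l" "coprime k l" and d: "2 \<le> d"
    and g: "rhom g" "\<And>a. g (const3 a) = const3 a" "g Xb = const3 \<mu> * Xb"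
    and g': "rhom g'" "\<And>a. g' (const3 a) = const3 a" "g' Xb = const3 \<mu>' * Xb"
    and inv: "\<And>f. g (g' f) = f" "\<And>f. g' (g f) = f"
    and pr: "pres d k l g" "pres d k l g'"
  shows "extendable d k l g"
proof -
  define bar where "bar g = subst2 cst (at0 (g Zv)) (at0 (g Tv))" for g :: "poly3 \<Rightarrow> poly3"
  have bar: "rhom (bar g)" "bar g (cst a) = cst a" "bar g Zv = at0 (g Zv)" "bar g Tv = at0 (g Tv)" for g a
    unfolding bar_def using rhom_subst2[OF rhom_cst] by (simp_all add: subst2_gen[OF rhom_cst])
  have a3: "at0 (const3 e) = cst e" for e by (simp add: const3_def at0_gen)
  have bar_at0: "at0 (g f) = bar g (at0 f)"
    if "rhom g" "\<And>a. g (const3 a) = const3 a" "g Xb = const3 \<mu> * Xb" for g \<mu> f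
    by (rule rhom_poly3_eqI'[OF rhom_comp[OF rhom_at0 that(1)] rhom_comp[OF bar(1) rhom_at0]])
      (simp_all add: that bar at0_gen a3 rhom_mult[OF rhom_at0] rhom_0[OF bar(1)])
  have bar_inv: "bar g (bar g' f) = f"
    if "rhom g" "\<And>a. g (const3 a) = const3 a" "g Xb = const3 \<mu> * Xb"
      "rhom g'" "\<And>a. g' (const3 a) = const3 a" "g' Xb = const3 \<mu>' * Xb" "\<And>f. g (g' f) = f" for g g' \<mu> \<mu>' f
    using bar_at0[OF that(1-3), of "g' (lift0 f)"] bar_at0[OF that(4-6), of "lift0 f"]
    by (simp add: that(7) at0_lift0)
  have aut: "aut2 (bar g) (bar g')"
    using bar_inv[OF g g' inv(1)] bar_inv[OF g' g inv(2)] by (simp add: aut2_def bar)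
  have X0: "at0 (Xb ^ d) = 0" using d by (simp add: rhom_simps[OF rhom_at0] at0_gen)
  obtain u v where u: "g (Rb k l) = Rb k l * u + Xb ^ d * v" using pr unfolding pres_def by blast
  obtain u' v' where u': "g' (Rb k l) = Rb k l * u' + Xb ^ d * v'" using pr unfolding pres_def by blast
  have R: "bar g (R0 k l) = R0 k l * at0 u"
    using arg_cong[OF u, of at0] unfolding bar_at0[OF g] by (simp add: rhom_add[OF rhom_at0] rhom_mult[OF rhom_at0] X0 at0_Rb)
  have R': "bar g' (R0 k l) = R0 k l * at0 u'"
    using arg_cong[OF u', of at0] unfolding bar_at0[OF g'] by (simp add: rhom_add[OF rhom_at0] rhom_mult[OF rhom_at0] X0 at0_Rb)
  obtain a b c where abc: "a \<noteq> 0" "b \<noteq> 0" "c \<noteq> 0" "at0 (g Zv) = cst a * Zv" "at0 (g Tv) = cst b * Tv"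
    "a ^ k = c" "b ^ l = c" "at0 u = cst c"
    using plane_curve_automorphism[OF kl(1,2) aut R R'] unfolding bar by blast
  have "Xb dvd g Zv - const3 a * Zv" "Xb dvd g Tv - const3 b * Tv" "Xb dvd u - const3 c"
    unfolding Xb_dvd_iff by (simp_all add: rhom_simps[OF rhom_at0] abc a3 at0_gen)
  then obtain z1 t1 u1 where "g Zv - const3 a * Zv = Xb * z1" "g Tv - const3 b * Tv = Xb * t1" "u - const3 c = Xb * u1"
    by (elim dvdE)
  then have e1: "g Zv = const3 a * Zv + Xb * z1" "g Tv = const3 b * Tv + Xb * t1" "u = const3 c + Xb * u1"
    by (simp_all add: algebra_simps)
  \<comment> \<open>The torus element seen modulo \<open>x\<close> must also account for the factor
    \<open>\<mu>\<close> of \<open>x\<close>. At \<open>z = t = 0\<close> the image of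
    \<open>r\<close> is computed in two ways; because \<open>k, l, d \<ge> 2\<close>, only
    \<open>\<mu>\<close> and \<open>c\<close> contribute to the coefficient of
    \<open>x\<close>.\<close>
  have lc: "\<mu> = c"
  proof -
    define \<eta> where "\<eta> = subst2 (\<lambda>p. p) 0 (0 :: complex poly)"
    have er: "rhom \<eta>" unfolding \<eta>_def by (rule rhom_subst2[OF rhom_id])
    have eg: "\<eta> (cst q) = q" "\<eta> Zv = 0" "\<eta> Tv = 0" for q
      unfolding \<eta>_def by (simp_all only: subst2_gen[OF rhom_id])
    note es = rhom_simps[OF er] eg Xb_def const3_def
    define E :: "complex poly" where "E = [:0, 1:]"
    obtain k' l' d' where k': "k = Suc (Suc k')" "l = Suc (Suc l')" "d = Suc (Suc d')"
      using kl d by (metis Suc_le_D less_imp_le numeral_2_eq_2 order_trans Suc_le_mono)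
    have "\<eta> (g (Rb k l)) = (E * \<eta> z1) ^ k + (E * \<eta> t1) ^ l + [:\<mu>:] * E"
      unfolding Rb_def rhom_simps[OF g(1)] g(3) e1 by (simp add: es E_def zero_power)
    moreover have "\<eta> (g (Rb k l)) = E * ([:c:] + E * \<eta> u1) + E ^ d * \<eta> v"
      unfolding u e1 unfolding Rb_def using kl by (simp add: es E_def zero_power)
    ultimately have "[:\<mu>:] * E - [:c:] * E = E ^ 2 * (\<eta> u1 + E ^ d' * \<eta> v - E ^ k' * \<eta> z1 ^ k - E ^ l' * \<eta> t1 ^ l)"
      unfolding k' by (simp add: algebra_simps power2_eq_square)
    then have "coeff ([:\<mu>:] * E - [:c:] * E) 1 = 0"
      by (simp add: E_def power2_eq_square)
    then show ?thesis by (simp add: E_def)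
  qed
  \<comment> \<open>Dividing by the torus element leaves an automorphism that fixes \<open>x\<close>
    and is the identity modulo \<open>x\<close>, the start \<open>n = 1\<close> of the
    approximation.\<close>
  define \<tau> where "\<tau> = torus c a b"
  define \<tau>' where "\<tau>' = torus (inverse c) (inverse a) (inverse b)"
  have tt: "\<tau> (\<tau>' f) = f" "\<tau>' (\<tau> f) = f" for f
    unfolding \<tau>_def \<tau>'_def using torus_inverse[OF abc(3,1,2)] by blast+
  have tr: "rhom \<tau>" "rhom \<tau>'" by (simp_all add: \<tau>_def \<tau>'_def rhom_torus)
  note tg = torus_gen[of c a b, folded \<tau>_def] torus_gen[of "inverse c" "inverse a" "inverse b", folded \<tau>'_def]
  have m: "const3 x * (const3 y * f) = f" if "x * y = 1" for x y f
    using that rhom_mult[OF rhom_const3, of x y] rhom_1[OF rhom_const3] by (simp flip: mult.assoc)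
  define h where "h f = \<tau>' (g f)" for f
  define h' where "h' f = g' (\<tau> f)" for f
  have hr: "rhom h" "rhom h'" unfolding h_def h'_def using rhom_comp tr g(1) g'(1) by blast+
  have hh: "h (h' f) = f" "h' (h f) = f" for f by (simp_all add: h_def h'_def tt inv)
  have h3: "h (const3 e) = const3 e" "h' (const3 e) = const3 e" for e
    by (simp_all add: h_def h'_def g g' tg)
  have hX: "h Xb = Xb"
    using abc by (simp add: h_def g lc rhom_mult[OF tr(2)] tg m)
  have hX': "h' Xb = Xb" using hh(2)[of Xb] by (simp add: hX)
  have hc: "h (cst p) = cst p" "h' (cst p) = cst p" for p
  proof -
    show "h (cst p) = cst p"
      by (rule rhom_poly_eqI[OF rhom_comp[OF hr(1) rhom_cst] rhom_cst])
        (use h3 hX in \<open>simp_all add: const3_def Xb_def\<close>)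
    show "h' (cst p) = cst p"
      by (rule rhom_poly_eqI[OF rhom_comp[OF hr(2) rhom_cst] rhom_cst])
        (use h3 hX' in \<open>simp_all add: const3_def Xb_def\<close>)
  qed
  have ha: "aut2 h h'" by (simp add: aut2_def hr hc hh)
  have near: "Xb ^ 1 dvd h Zv - Zv" "Xb ^ 1 dvd h Tv - Tv"
    using abc by (simp_all add: h_def e1 rhom_add[OF tr(2)] rhom_mult[OF tr(2)] tg m mult.assoc)
  have pt: "pres d k l \<tau>" "pres d k l \<tau>'"
  proof -
    have "\<tau> (Rb k l) = Rb k l * const3 c + Xb ^ d * 0"
      unfolding \<tau>_def using torus_Rb[OF abc(6,7)] by (simp add: mult.commute)
    then show "pres d k l \<tau>" unfolding pres_def by blast
    have "inverse a ^ k = inverse c" "inverse b ^ l = inverse c" by (simp_all add: power_inverse abc)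
    from torus_Rb[OF this] have "\<tau>' (Rb k l) = Rb k l * const3 (inverse c) + Xb ^ d * 0"
      unfolding \<tau>'_def by (simp add: mult.commute)
    then show "pres d k l \<tau>'" unfolding pres_def by blast
  qed
  have "pres d k l h" unfolding h_def by (rule pres_comp[OF pt(2) pr(1) tr(2)]) (simp add: tg)
  moreover have "pres d k l h'" unfolding h'_def by (rule pres_comp[OF pr(2) pt(1) g'(1)]) (simp add: g')
  ultimately have eh: "extendable d k l h"
    using extendable_near_id[OF kl(3) _ _ _ ha _ _ _ near] kl d by simp
  have "extendable d k l \<tau>"
    unfolding \<tau>_def using abc by (intro extendable_torus)
  from extendable_comp[OF this eh] show ?thesis by (simp add: h_def tt)
qed

section \<open>Normal forms modulo the equation\<close>

fun mono4 :: "nat \<times> nat \<times> nat \<times> nat \<Rightarrow> poly4" where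
  "mono4 (j, a, e, i) = var_x ^ j * var_z ^ a * var_t ^ e * var_y ^ i"

text \<open>The monomials not divisible by \<open>x^d y\<close>, which the equation rewrites in
  terms of \<open>z^k\<close>, \<open>t^l\<close> and \<open>x\<close>.\<close>

fun normal :: "nat \<Rightarrow> nat \<times> nat \<times> nat \<times> nat \<Rightarrow> bool" where
  "normal d (j, a, e, i) \<longleftrightarrow> i = 0 \<or> j < d"

definition lincomb :: "(nat \<times> nat \<times> nat \<times> nat) set \<Rightarrow> (nat \<times> nat \<times> nat \<times> nat \<Rightarrow> complex) \<Rightarrow> poly4" where
  "lincomb S c = (\<Sum>m\<in>S. const4 (c m) * mono4 m)"

definition has_nf :: "nat \<Rightarrow> nat \<Rightarrow> nat \<Rightarrow> poly4 \<Rightarrow> bool" where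
  "has_nf d k l f \<longleftrightarrow> (\<exists>S c. finite S \<and> (\<forall>m\<in>S. normal d m) \<and> P d k l dvd f - lincomb S c)"

lemma has_nf_add:
  assumes "has_nf d k l f" "has_nf d k l g"
  shows "has_nf d k l (f + g)"
proof -
  obtain S c where 1: "finite S" "\<forall>m\<in>S. normal d m" "P d k l dvd f - lincomb S c"
    using assms(1) unfolding has_nf_def by blast
  obtain S' c' where 2: "finite S'" "\<forall>m\<in>S'. normal d m" "P d k l dvd g - lincomb S' c'"
    using assms(2) unfolding has_nf_def by blast
  define c1 where "c1 m = (if m \<in> S then c m else 0)" for m
  define c2 where "c2 m = (if m \<in> S' then c' m else 0)" for m
  have c0: "const4 0 = 0" by (rule rhom_0[OF rhom_const4])
  have e1: "lincomb S c = lincomb (S \<union> S') c1" unfolding lincomb_def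
    using 1(1) 2(1) by (intro sum.mono_neutral_cong_left) (auto simp: c1_def c0)
  have e2: "lincomb S' c' = lincomb (S \<union> S') c2" unfolding lincomb_def
    using 1(1) 2(1) by (intro sum.mono_neutral_cong_left) (auto simp: c2_def c0)
  have e3: "lincomb (S \<union> S') (\<lambda>m. c1 m + c2 m) = lincomb S c + lincomb S' c'"
    unfolding e1 e2 by (simp add: lincomb_def rhom_add[OF rhom_const4] distrib_right sum.distrib)
  have "P d k l dvd (f - lincomb S c) + (g - lincomb S' c')" using 1 2 by (intro dvd_add)
  then have "P d k l dvd f + g - lincomb (S \<union> S') (\<lambda>m. c1 m + c2 m)"
    unfolding e3 by (simp add: algebra_simps)
  then show ?thesis unfolding has_nf_def using 1 2 by (intro exI[of _ "S \<union> S'"]) auto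
qed

lemma has_nf_scale:
  assumes "has_nf d k l f"
  shows "has_nf d k l (const4 a * f)"
proof -
  obtain S c where 1: "finite S" "\<forall>m\<in>S. normal d m" "P d k l dvd f - lincomb S c"
    using assms(1) unfolding has_nf_def by blast
  have "const4 a * lincomb S c = lincomb S (\<lambda>m. a * c m)"
    by (simp add: lincomb_def sum_distrib_left rhom_mult[OF rhom_const4] mult.assoc)
  then have "const4 a * f - lincomb S (\<lambda>m. a * c m) = const4 a * (f - lincomb S c)"
    by (simp add: right_diff_distrib)
  then have "P d k l dvd const4 a * f - lincomb S (\<lambda>m. a * c m)" using 1 by simp
  then show ?thesis unfolding has_nf_def using 1 by blast
qed

lemma has_nf_cong:
  assumes "has_nf d k l f" "P d k l dvd g - f"
  shows "has_nf d k l g"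
proof -
  obtain S c where 1: "finite S" "\<forall>m\<in>S. normal d m" "P d k l dvd f - lincomb S c"
    using assms(1) unfolding has_nf_def by blast
  have "P d k l dvd (g - f) + (f - lincomb S c)" using 1 assms by (intro dvd_add)
  then show ?thesis unfolding has_nf_def using 1 by (intro exI[of _ S] exI[of _ c]) (simp add: algebra_simps)
qed

text \<open>Replacing \<open>x^d y\<close> by \<open>- (z^k + t^l + x)\<close> lowers the exponent
  of \<open>y\<close>, whatever happens to the other exponents.\<close>

lemma has_nf_mono4: "has_nf d k l (mono4 (j, a, e, i))"
proof (induction i arbitrary: j a e)
  case 0
  show ?case unfolding has_nf_def lincomb_def
    by (intro exI[of _ "{(j, a, e, 0)}"] exI[of _ "\<lambda>_. 1"]) (simp add: rhom_1[OF rhom_const4])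
next
  case (Suc i)
  show ?case
  proof (cases "j < d")
    case True
    then show ?thesis unfolding has_nf_def lincomb_def
      by (intro exI[of _ "{(j, a, e, Suc i)}"] exI[of _ "\<lambda>_. 1"]) (simp add: rhom_1[OF rhom_const4] del: mono4.simps)
  next
    case False
    define j' where "j' = j - d"
    have j: "var_x ^ j = var_x ^ j' * var_x ^ d" using False by (simp add: j'_def flip: power_add)
    have neg: "has_nf d k l (- f)" if "has_nf d k l f" for f
      using has_nf_scale[OF that, of "- 1"] by (simp add: rhom_simps[OF rhom_const4])
    define R where "R = - mono4 (j', a + k, e, i) + (- mono4 (j', a, e + l, i) + - mono4 (Suc j', a, e, i))"
    have "has_nf d k l R"
      unfolding R_def using Suc.IH by (intro has_nf_add neg)
    moreover have "mono4 (j, a, e, Suc i) - R = mono4 (j', a, e, i) * P d k l"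
      by (simp add: R_def P_def j power_add algebra_simps)
    then have "P d k l dvd mono4 (j, a, e, Suc i) - R" by simp
    ultimately show ?thesis by (rule has_nf_cong)
  qed
qed

lemma has_nf: "has_nf d k l f"
proof -
  define U where "U f \<longleftrightarrow> (\<forall>m. has_nf d k l (f * mono4 m))" for f
  have "U g \<Longrightarrow> U (f * g)" for g
  proof (induction f arbitrary: g rule: poly4_gen_induct)
    case (const a)
    then show ?case unfolding U_def by (simp add: mult.assoc has_nf_scale)
  next
    case x
    show ?case unfolding U_def
    proof
      fix m :: "nat \<times> nat \<times> nat \<times> nat"
      obtain j a e i where m: "m = (j, a, e, i)" by (cases m) auto
      have "has_nf d k l (g * mono4 (Suc j, a, e, i))" using x U_def by blast
      then show "has_nf d k l (var_x * g * mono4 m)" by (simp add: m mult_ac)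
    qed
  next
    case z
    show ?case unfolding U_def
    proof
      fix m :: "nat \<times> nat \<times> nat \<times> nat"
      obtain j a e i where m: "m = (j, a, e, i)" by (cases m) auto
      have "has_nf d k l (g * mono4 (j, Suc a, e, i))" using z U_def by blast
      then show "has_nf d k l (var_z * g * mono4 m)" by (simp add: m mult_ac)
    qed
  next
    case t
    show ?case unfolding U_def
    proof
      fix m :: "nat \<times> nat \<times> nat \<times> nat"
      obtain j a e i where m: "m = (j, a, e, i)" by (cases m) auto
      have "has_nf d k l (g * mono4 (j, a, Suc e, i))" using t U_def by blast
      then show "has_nf d k l (var_t * g * mono4 m)" by (simp add: m mult_ac)
    qed
  next
    case y
    show ?case unfolding U_def
    proof
      fix m :: "nat \<times> nat \<times> nat \<times> nat"
      obtain j a e i where m: "m = (j, a, e, i)" by (cases m) auto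
      have "has_nf d k l (g * mono4 (j, a, e, Suc i))" using y U_def by blast
      then show "has_nf d k l (var_y * g * mono4 m)" by (simp add: m mult_ac)
    qed
  next
    case (add p q)
    then show ?case unfolding U_def by (simp add: distrib_right has_nf_add)
  next
    case (mult p q)
    then show ?case by (simp add: mult.assoc)
  qed
  moreover have "U 1" unfolding U_def using has_nf_mono4 by (metis mult_1 prod_cases4)
  ultimately have "U f" by fastforce
  then have "has_nf d k l (f * mono4 (0, 0, 0, 0))" unfolding U_def by blast
  then show ?thesis by simp
qed

lemma normal_form:
  obtains S c where "finite S" "\<And>m. m \<in> S \<Longrightarrow> normal d m \<and> c m \<noteq> 0" "P d k l dvd f - lincomb S c"
proof -
  obtain S c where 1: "finite S" "\<forall>m\<in>S. normal d m" "P d k l dvd f - lincomb S c"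
    using has_nf[of d k l f] unfolding has_nf_def by blast
  have e: "lincomb {m \<in> S. c m \<noteq> 0} c = lincomb S c" unfolding lincomb_def
    using 1(1) by (intro sum.mono_neutral_left) (auto simp: rhom_0[OF rhom_const4])
  show ?thesis
  proof (rule that)
    show "finite {m \<in> S. c m \<noteq> 0}" using 1(1) by simp
    show "P d k l dvd f - lincomb {m \<in> S. c m \<noteq> 0} c" unfolding e by (rule 1(3))
  qed (use 1(2) in blast)
qed

section \<open>A real-valued degree on the coordinate ring\<close>

type_synonym graded = "real \<Rightarrow>\<^sub>0 complex poly"

abbreviation "lookup \<equiv> Poly_Mapping.lookup"

definition bounded_by :: "real \<Rightarrow> graded \<Rightarrow> bool" where
  "bounded_by w f \<longleftrightarrow> (\<forall>v>w. lookup f v = 0)"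

definition level :: "real \<Rightarrow> graded \<Rightarrow> bool" where
  "level w f \<longleftrightarrow> bounded_by w f \<and> lookup f w \<noteq> 0"

lemma lookup_mult_group: "lookup (f * g) n = (\<Sum>m. lookup f m * lookup g (n - m))"
  for f g :: graded
proof -
  have "(\<Sum>q. lookup g q when n = m + q) = lookup g (n - m)" for m
  proof -
    have "(lookup g q when n = m + q) = (lookup g (n - m) when q = n - m)" for q
      by (auto simp: when_def)
    then show ?thesis by simp
  qed
  then show ?thesis by (simp add: lookup_mult)
qed

lemma bounded_by_mult:
  assumes "bounded_by w f" "bounded_by w' g"
  shows "bounded_by (w + w') (f * g)" "lookup (f * g) (w + w') = lookup f w * lookup g w'"
proof -
  show "bounded_by (w + w') (f * g)"
    unfolding bounded_by_def
  proof (intro allI impI)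
    fix v assume v: "w + w' < v"
    have "lookup f m * lookup g (v - m) = 0" for m
      using assms v unfolding bounded_by_def by (cases "m > w") auto
    then have "(\<lambda>m. lookup f m * lookup g (v - m)) = (\<lambda>m. 0)" by (intro ext)
    then show "lookup (f * g) v = 0" by (simp only: lookup_mult_group) simp
  qed
  have "lookup f m * lookup g (w + w' - m) = (lookup f w * lookup g w' when m = w)" for m
    using assms unfolding bounded_by_def by (cases m w rule: linorder_cases) (auto simp: when_def)
  then show "lookup (f * g) (w + w') = lookup f w * lookup g w'" by (simp add: lookup_mult_group)
qed

lemma bounded_by_single: "v \<le> w \<Longrightarrow> bounded_by w (Poly_Mapping.single v a)"
  by (simp add: bounded_by_def lookup_single when_def)

lemma bounded_by_mono: "bounded_by w f \<Longrightarrow> w \<le> w' \<Longrightarrow> bounded_by w' f"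
  by (auto simp: bounded_by_def)

lemma bounded_by_add: "bounded_by w f \<Longrightarrow> bounded_by w g \<Longrightarrow> bounded_by w (f + g)"
  by (simp add: bounded_by_def lookup_add)

lemma bounded_by_0: "bounded_by w 0"
  by (simp add: bounded_by_def)

lemma bounded_by_sum: "(\<And>i. i \<in> S \<Longrightarrow> bounded_by w (f i)) \<Longrightarrow> bounded_by w (sum f S)"
  by (induction S rule: infinite_finite_induct) (simp_all add: bounded_by_0 bounded_by_add)

lemma bounded_by_power:
  assumes "bounded_by w f"
  shows "bounded_by (of_nat n * w) (f ^ n) \<and> lookup (f ^ n) (of_nat n * w) = lookup f w ^ n"
proof (induction n)
  case 0
  show ?case by (simp add: bounded_by_def lookup_one when_def)
next
  case (Suc n)
  then show ?case
    using bounded_by_mult[OF assms, of "of_nat n * w" "f ^ n"] by (simp add: distrib_right)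
qed

lemma level_mult: "level w f \<Longrightarrow> level w' g \<Longrightarrow> level (w + w') (f * g)"
  using bounded_by_mult[of w f w' g] by (simp add: level_def)

lemma level_exists:
  assumes "f \<noteq> 0"
  shows "\<exists>w. level w f"
proof -
  have fin: "finite (Poly_Mapping.keys f)" "Poly_Mapping.keys f \<noteq> {}" using assms by simp_all
  have "level (Max (Poly_Mapping.keys f)) f"
    unfolding level_def bounded_by_def
    using Max_in[OF fin] Max_ge[OF fin(1)] by (fastforce simp: in_keys_iff)
  then show ?thesis by blast
qed

lemma level_unique: "level w f \<Longrightarrow> level w' f \<Longrightarrow> w = w'"
  unfolding level_def bounded_by_def by (metis linorder_neqE_linordered_idom)

text \<open>Forced by homogeneity of \<open>x^d y + z^k + t^l\<close>, where \<open>x\<close> has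
  weight -1 and both powers have weight \<open>k l \<epsilon>\<close>.\<close>

definition ydeg :: "nat \<Rightarrow> nat \<Rightarrow> nat \<Rightarrow> real \<Rightarrow> real" where
  "ydeg d k l \<epsilon> = of_nat d + of_nat (k * l) * \<epsilon>"

text \<open>The form \<open>z^k + t^l\<close> at \<open>t = 1\<close>: up to sign the leading
  coefficient of \<open>y = - (z^k + t^l + x) / x^d\<close>.\<close>

definition Rt :: "nat \<Rightarrow> complex poly" where "Rt k = [:0, 1:] ^ k + 1"

text \<open>The exponents of \<open>x\<close> and \<open>t\<close> are absorbed into the real exponent: for irrational \<open>\<epsilon>\<close> a monomial in
  \<open>x, z, t\<close> can be recovered from its exponent of \<open>z\<close> and its degree. Leading coefficients are therefore
  polynomials in \<open>z\<close> alone.\<close>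

definition grd :: "nat \<Rightarrow> nat \<Rightarrow> nat \<Rightarrow> real \<Rightarrow> poly4 \<Rightarrow> graded" where
  "grd d k l \<epsilon> = hom4 (\<lambda>c. Poly_Mapping.single 0 [:c:]) (Poly_Mapping.single (- 1) 1)
     (Poly_Mapping.single (of_nat l * \<epsilon>) [:0, 1:]) (Poly_Mapping.single (of_nat k * \<epsilon>) 1)
     (- (Poly_Mapping.single (ydeg d k l \<epsilon>) (Rt k) + Poly_Mapping.single (of_nat d - 1) 1))"

lemma rhom_single0: "rhom (\<lambda>c::complex. Poly_Mapping.single (0::real) [:c:])"
  by (rule rhomI) (simp_all add: single_add[symmetric] mult_single mult.commute flip: one_pCons)

lemma rhom_grd: "rhom (grd d k l \<epsilon>)"
  unfolding grd_def by (rule rhom_hom4[OF rhom_single0])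

lemma grd_gen:
  "grd d k l \<epsilon> (const4 c) = Poly_Mapping.single 0 [:c:]"
  "grd d k l \<epsilon> var_x = Poly_Mapping.single (- 1) 1"
  "grd d k l \<epsilon> var_z = Poly_Mapping.single (of_nat l * \<epsilon>) [:0, 1:]"
  "grd d k l \<epsilon> var_t = Poly_Mapping.single (of_nat k * \<epsilon>) 1"
  "grd d k l \<epsilon> var_y = - (Poly_Mapping.single (ydeg d k l \<epsilon>) (Rt k) + Poly_Mapping.single (of_nat d - 1) 1)"
  by (simp_all only: grd_def hom4_gen[OF rhom_single0])

lemma single_power: "Poly_Mapping.single v a ^ n = Poly_Mapping.single (of_nat n * v) (a ^ n)"
  for v :: real and a :: "complex poly"
  by (induction n) (simp_all add: mult_single distrib_right add.commute)

lemma grd_P: "grd d k l \<epsilon> (P d k l) = 0"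
proof -
  have kl: "of_nat k * (of_nat l * \<epsilon>) = of_nat (k * l) * \<epsilon>" "of_nat l * (of_nat k * \<epsilon>) = of_nat (k * l) * \<epsilon>"
    by (simp_all add: algebra_simps)
  show ?thesis
    unfolding P_def rhom_simps[OF rhom_grd] grd_gen single_power kl
    by (simp add: distrib_left right_diff_distrib mult_single ydeg_def Rt_def kl)
      (rule poly_mapping_eqI, simp add: lookup_add lookup_minus lookup_single when_def)
qed

lemma grd_dvd: "P d k l dvd f - g \<Longrightarrow> grd d k l \<epsilon> f = grd d k l \<epsilon> g"
proof -
  assume "P d k l dvd f - g"
  then have "grd d k l \<epsilon> (f - g) = 0"
    by (elim dvdE) (simp add: rhom_mult[OF rhom_grd] grd_P)
  then show ?thesis by (simp add: rhom_diff[OF rhom_grd])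
qed

fun mono_deg :: "nat \<Rightarrow> nat \<Rightarrow> nat \<Rightarrow> real \<Rightarrow> nat \<times> nat \<times> nat \<times> nat \<Rightarrow> real" where
  "mono_deg d k l \<epsilon> (j, a, e, i) = of_nat j * (- 1) + of_nat a * (of_nat l * \<epsilon>) + of_nat e * (of_nat k * \<epsilon>) + of_nat i * ydeg d k l \<epsilon>"

lemma grd_var_y:
  assumes "0 < \<epsilon>"
  shows "bounded_by (ydeg d k l \<epsilon>) (grd d k l \<epsilon> var_y)" "lookup (grd d k l \<epsilon> var_y) (ydeg d k l \<epsilon>) = - Rt k"
proof -
  have lt: "of_nat d - 1 < ydeg d k l \<epsilon>"
  proof -
    have "0 \<le> of_nat (k * l) * \<epsilon>" using assms by simp
    then show ?thesis unfolding ydeg_def by linarith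
  qed
  then show "bounded_by (ydeg d k l \<epsilon>) (grd d k l \<epsilon> var_y)" "lookup (grd d k l \<epsilon> var_y) (ydeg d k l \<epsilon>) = - Rt k"
    unfolding grd_gen by (auto simp: bounded_by_def lookup_add lookup_minus lookup_single when_def)
qed

lemma grd_mono4:
  assumes "0 < \<epsilon>"
  shows "bounded_by (mono_deg d k l \<epsilon> (j, a, e, i)) (grd d k l \<epsilon> (mono4 (j, a, e, i))) \<and>
    lookup (grd d k l \<epsilon> (mono4 (j, a, e, i))) (mono_deg d k l \<epsilon> (j, a, e, i)) = [:0, 1:] ^ a * (- Rt k) ^ i"
proof -
  have b: "bounded_by (- 1) (grd d k l \<epsilon> var_x)" "bounded_by (of_nat l * \<epsilon>) (grd d k l \<epsilon> var_z)"
    "bounded_by (of_nat k * \<epsilon>) (grd d k l \<epsilon> var_t)"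
    by (simp_all add: grd_gen bounded_by_single)
  have t: "lookup (grd d k l \<epsilon> var_x) (- 1) = 1" "lookup (grd d k l \<epsilon> var_z) (of_nat l * \<epsilon>) = [:0, 1:]"
    "lookup (grd d k l \<epsilon> var_t) (of_nat k * \<epsilon>) = 1"
    by (simp_all add: grd_gen)
  note px = bounded_by_power[OF b(1), of j] and pz = bounded_by_power[OF b(2), of a]
    and pt = bounded_by_power[OF b(3), of e] and py = bounded_by_power[OF grd_var_y(1)[OF assms], of i d k l]
  note B1 = bounded_by_mult[OF conjunct1[OF px] conjunct1[OF pz]]
  note B2 = bounded_by_mult[OF B1(1) conjunct1[OF pt]]
  note B3 = bounded_by_mult[OF B2(1) conjunct1[OF py]]
  show ?thesis
    unfolding mono4.simps rhom_simps[OF rhom_grd] mono_deg.simps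
    by (rule conjI[OF B3(1)])
      (simp only: B3(2) B2(2) B1(2) conjunct2[OF px] conjunct2[OF pz] conjunct2[OF pt] conjunct2[OF py]
        t grd_var_y(2)[OF assms] power_one mult_1_left mult_1_right)
qed

text \<open>Irrationality of \<open>\<epsilon>\<close> separates the integral part
  \<open>i d - j\<close> of the degree from the multiple of \<open>\<epsilon>\<close>. For normal
  monomials the integral part determines \<open>i\<close> and \<open>j\<close>, since
  \<open>j < d\<close> whenever \<open>i > 0\<close>.\<close>

lemma mono_deg_unique:
  assumes \<epsilon>: "\<epsilon> \<notin> \<rat>" and n: "normal d (j, a, e, i)" "normal d (j', a', e', i')"
    and eq: "mono_deg d k l \<epsilon> (j, a, e, i) = mono_deg d k l \<epsilon> (j', a', e', i')"
  shows "j = j' \<and> i = i' \<and> l * a + k * e = l * a' + k * e'"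
proof -
  define N M where "N = int i * int d - int j" and "M = int (l * a + k * e + k * l * i)"
  define N' M' where "N' = int i' * int d - int j'" and "M' = int (l * a' + k * e' + k * l * i')"
  have "of_int (N - N') = of_int (M' - M) * \<epsilon>"
    using eq unfolding N_def M_def N'_def M'_def mono_deg.simps ydeg_def by (simp add: algebra_simps)
  then have MM: "M' - M = 0"
  proof (rule_tac ccontr)
    assume "M' - M \<noteq> 0" "of_int (N - N') = of_int (M' - M) * \<epsilon>"
    then have "\<epsilon> = of_int (N - N') / of_int (M' - M)" by (simp add: field_simps)
    also have "\<dots> \<in> \<rat>" by (intro Rats_divide Rats_of_int)
    finally show False using \<epsilon> by blast
  qed
  then have NN: "N = N'" using \<open>of_int (N - N') = of_int (M' - M) * \<epsilon>\<close> by simp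
  have key: "\<not> i' < i" if n: "normal d (j, a, e, i)" and NN: "int i * int d - int j = int i' * int d - int j'" for i j i' j' a e :: nat
  proof
    assume "i' < i"
    then have "j < d" using n by simp
    have "1 * int d \<le> (int i - int i') * int d" using \<open>i' < i\<close> by (intro mult_right_mono) simp_all
    then show False using NN \<open>j < d\<close> by (simp add: algebra_simps)
  qed
  have "i = i'"
    using key[OF n(1), of i' j'] key[OF n(2), of i j] NN unfolding N_def N'_def by (metis linorder_neqE_nat)
  moreover have "j = j'" using NN calculation unfolding N_def N'_def by simp
  moreover have "l * a + k * e = l * a' + k * e'"
  proof -
    have "M = M'" using MM by simp
    then have "l * a + k * e + k * l * i = l * a' + k * e' + k * l * i'" unfolding M_def M'_def by (simp only: of_nat_eq_iff)
    then show ?thesis using \<open>i = i'\<close> by simp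
  qed
  ultimately show ?thesis by blast
qed

lemma Rt_nz: "Rt k \<noteq> 0"
proof
  assume "Rt k = 0"
  then have "poly (Rt k) 1 = 0" by simp
  then show False by (simp add: Rt_def)
qed

text \<open>Leading terms of a normal form never cancel: all monomials of top degree share the
  exponents of \<open>x\<close> and \<open>y\<close>, and they differ in the exponent of
  \<open>z\<close>. The leading coefficient is thus a nonzero polynomial in \<open>z\<close> times a
  power of \<open>- Rt k\<close>.\<close>

lemma lincomb_top:
  assumes \<epsilon>: "0 < \<epsilon>" "\<epsilon> \<notin> \<rat>" and k: "k > 0" and S: "finite S" "S \<noteq> {}" "\<And>m. m \<in> S \<Longrightarrow> normal d m \<and> c m \<noteq> 0"
    and W: "W = Max (mono_deg d k l \<epsilon> ` S)" and M: "M = {m \<in> S. mono_deg d k l \<epsilon> m = W}"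
  shows "\<exists>i j N. M \<noteq> {} \<and> (\<forall>m\<in>S. mono_deg d k l \<epsilon> m \<le> W) \<and> (\<forall>m\<in>M. \<exists>a e. m = (j, a, e, i) \<and> l * a + k * e = N) \<and>
    level W (grd d k l \<epsilon> (lincomb S c))"
proof -
  have le: "mono_deg d k l \<epsilon> m \<le> W" if "m \<in> S" for m using S that by (simp add: W)
  have "W \<in> mono_deg d k l \<epsilon> ` S" unfolding W using S by (intro Max_in) auto
  then obtain m0 where m0: "m0 \<in> S" "mono_deg d k l \<epsilon> m0 = W" by blast
  obtain j a0 e0 i where m0e: "m0 = (j, a0, e0, i)" by (cases m0) auto
  define N where "N = l * a0 + k * e0"
  have Mm: "\<exists>a e. m = (j, a, e, i) \<and> l * a + k * e = N" if "m \<in> M" for m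
  proof -
    obtain j' a e i' where m: "m = (j', a, e, i')" by (cases m) auto
    show ?thesis
      using mono_deg_unique[OF \<epsilon>(2), of d j' a e i' j a0 e0 i k l] that S(3) m0 m m0e unfolding M N_def by auto
  qed
  have bm: "bounded_by (mono_deg d k l \<epsilon> m) (grd d k l \<epsilon> (const4 a * mono4 m))"
    "lookup (grd d k l \<epsilon> (const4 a * mono4 m)) (mono_deg d k l \<epsilon> m) = [:a:] * lookup (grd d k l \<epsilon> (mono4 m)) (mono_deg d k l \<epsilon> m)"
    for m a
  proof -
    obtain j a e i where m: "m = (j, a, e, i)" by (cases m) auto
    have b: "bounded_by (mono_deg d k l \<epsilon> m) (grd d k l \<epsilon> (mono4 m))"
      using grd_mono4[OF \<epsilon>(1)] m by blast
    have b0: "bounded_by 0 (Poly_Mapping.single (0::real) x)" for x :: "complex poly" by (rule bounded_by_single) simp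
    show "bounded_by (mono_deg d k l \<epsilon> m) (grd d k l \<epsilon> (const4 x * mono4 m))"
      "lookup (grd d k l \<epsilon> (const4 x * mono4 m)) (mono_deg d k l \<epsilon> m) = [:x:] * lookup (grd d k l \<epsilon> (mono4 m)) (mono_deg d k l \<epsilon> m)" for x
      unfolding rhom_mult[OF rhom_grd] grd_gen using bounded_by_mult[OF b0 b] by simp_all
  qed
  have bS: "bounded_by W (grd d k l \<epsilon> (lincomb S c))"
    unfolding lincomb_def rhom_sum[OF rhom_grd] using bm(1) le by (blast intro: bounded_by_sum bounded_by_mono)
  have "lookup (grd d k l \<epsilon> (lincomb S c)) W = (\<Sum>m\<in>S. lookup (grd d k l \<epsilon> (const4 (c m) * mono4 m)) W)"
    unfolding lincomb_def rhom_sum[OF rhom_grd] lookup_sum ..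
  also have "\<dots> = (\<Sum>m\<in>M. lookup (grd d k l \<epsilon> (const4 (c m) * mono4 m)) W)"
  proof (rule sum.mono_neutral_right[OF S(1)])
    show "M \<subseteq> S" by (auto simp: M)
    show "\<forall>m\<in>S - M. lookup (grd d k l \<epsilon> (const4 (c m) * mono4 m)) W = 0"
    proof
      fix m assume "m \<in> S - M"
      then have "mono_deg d k l \<epsilon> m < W" using le[of m] by (auto simp: M)
      then show "lookup (grd d k l \<epsilon> (const4 (c m) * mono4 m)) W = 0"
        using bm(1)[where m = m and a = "c m"] unfolding bounded_by_def by blast
    qed
  qed
  also have "\<dots> = (\<Sum>m\<in>M. [:c m:] * [:0, 1:] ^ (fst (snd m))) * (- Rt k) ^ i"
    unfolding sum_distrib_right
  proof (intro sum.cong refl)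
    fix m assume m: "m \<in> M"
    then obtain a e where me: "m = (j, a, e, i)" using Mm by blast
    have "lookup (grd d k l \<epsilon> (const4 (c m) * mono4 m)) W = [:c m:] * lookup (grd d k l \<epsilon> (mono4 m)) (mono_deg d k l \<epsilon> m)"
      using bm(2)[where m = m and a = "c m"] m by (simp add: M)
    then show "lookup (grd d k l \<epsilon> (const4 (c m) * mono4 m)) W = [:c m:] * [:0, 1:] ^ (fst (snd m)) * (- Rt k) ^ i"
      using grd_mono4[OF \<epsilon>(1), of d k l j a e i] by (simp only: me fst_conv snd_conv mult.assoc)
  qed
  finally have lk: "lookup (grd d k l \<epsilon> (lincomb S c)) W = (\<Sum>m\<in>M. [:c m:] * [:0, 1:] ^ (fst (snd m))) * (- Rt k) ^ i" .
  have m0M: "m0 \<in> M" using m0 by (simp add: M)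
  have fM: "finite M" using S(1) by (simp add: M)
  have "coeff (\<Sum>m\<in>M. [:c m:] * [:0, 1:] ^ (fst (snd m))) a0 = (\<Sum>m\<in>M. if m = m0 then c m else 0)"
    unfolding coeff_sum
  proof (intro sum.cong refl)
    fix m assume m: "m \<in> M"
    then obtain a e where me: "m = (j, a, e, i)" "l * a + k * e = N" using Mm by blast
    have "a = a0 \<longleftrightarrow> m = m0" using me m0e k by (auto simp: N_def)
    then show "coeff ([:c m:] * [:0, 1:] ^ (fst (snd m))) a0 = (if m = m0 then c m else 0)"
      by (auto simp: me(1) monom_altdef[symmetric, of 1, simplified] coeff_monom)
  qed
  also have "\<dots> \<noteq> 0" using S(3)[OF m0(1)] m0M fM by simp
  finally have "(\<Sum>m\<in>M. [:c m:] * [:0, 1:] ^ (fst (snd m))) \<noteq> 0" by auto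
  then have "lookup (grd d k l \<epsilon> (lincomb S c)) W \<noteq> 0" using Rt_nz by (simp add: lk)
  then show ?thesis using bS Mm m0M le unfolding level_def by blast
qed

section \<open>Additive group actions\<close>

text \<open>An elementary substitute for the Mason--Stothers theorem: no coprimality argument is needed because the
  right-hand side is a nonzero constant.\<close>

lemma power_sum_const:
  fixes U V :: "'a::{idom,ring_char_0} poly"
  assumes fg: "f \<noteq> 0" "g \<noteq> 0" "c \<noteq> 0" and ab: "a \<ge> 2" "b \<ge> 2"
    and eq: "[:f:] * U ^ a + [:g:] * V ^ b = [:c:]"
  shows "degree U = 0 \<and> degree V = 0"
proof -
  have main: "pderiv U = 0 \<or> degree V \<le> degree (pderiv U)"
    if eq: "[:f:] * U ^ a + [:g:] * V ^ b = [:c:]" and ab: "a \<ge> 2" "b \<ge> 2" and c: "c \<noteq> 0"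
    for f g c :: 'a and U V and a b :: nat
  proof (rule disjCI)
    assume "\<not> degree V \<le> degree (pderiv U)"
    obtain a' b' where a': "a = Suc a'" "b = Suc (Suc b')" using ab that[of "a - 1" "b - 2"] by simp
    have d: "[:f:] * (of_nat a * U ^ a' * pderiv U) + [:g:] * (of_nat b * V ^ Suc b' * pderiv V) = 0"
      using arg_cong[OF eq, of pderiv] unfolding a' pderiv_add pderiv_mult pderiv_power_Suc
      by (simp add: of_nat_poly algebra_simps)
    \<comment> \<open>Multiply the relation by \<open>a U'\<close> and eliminate
      \<open>U^(a-1) U'\<close> by its derivative; every term then contains \<open>V\<close>,
      because \<open>b \<ge> 2\<close>. So \<open>V\<close> divides \<open>U'\<close>, up to a
      nonzero constant, and by symmetry \<open>U\<close> divides \<open>V'\<close>, which is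
      impossible for two nonconstant polynomials.\<close>
    have "of_nat a * [:c:] * pderiv U = U * ([:f:] * (of_nat a * U ^ a' * pderiv U)) + of_nat a * [:g:] * V ^ b * pderiv U"
      unfolding eq[symmetric] a' by (simp only: algebra_simps power_Suc)
    also have "[:f:] * (of_nat a * U ^ a' * pderiv U) = - ([:g:] * (of_nat b * V ^ Suc b' * pderiv V))"
      using d by (simp only: eq_neg_iff_add_eq_0)
    also have "U * - ([:g:] * (of_nat b * V ^ Suc b' * pderiv V)) + of_nat a * [:g:] * V ^ b * pderiv U =
        V * ([:g:] * V ^ b' * (of_nat a * V * pderiv U - of_nat b * U * pderiv V))"
      unfolding a' by (simp only: algebra_simps power_Suc) (simp add: algebra_simps)
    finally have e: "of_nat a * [:c:] * pderiv U = V * ([:g:] * V ^ b' * (of_nat a * V * pderiv U - of_nat b * U * pderiv V))" .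
    show "pderiv U = 0"
    proof (rule ccontr)
      assume nz: "pderiv U \<noteq> 0"
      have cn: "of_nat a * [:c:] \<noteq> 0" "degree (of_nat a * [:c:]) = 0"
        using c ab by (simp_all add: of_nat_poly)
      then have "degree (of_nat a * [:c:] * pderiv U) = degree (pderiv U)"
        using nz by (subst degree_mult_eq) auto
      moreover have "V dvd of_nat a * [:c:] * pderiv U" unfolding e by (rule dvd_triv_left)
      then have "degree V \<le> degree (of_nat a * [:c:] * pderiv U)"
        using cn nz by (intro dvd_imp_degree_le) auto
      ultimately show False using \<open>\<not> degree V \<le> degree (pderiv U)\<close> by simp
    qed
  qed
  have U: "pderiv U = 0 \<or> degree V \<le> degree (pderiv U)" by (rule main[OF eq ab fg(3)])
  have V: "pderiv V = 0 \<or> degree U \<le> degree (pderiv V)"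
    using main[of g V b f U a c] eq ab fg by (simp add: add.commute)
  have z: "pderiv p = 0 \<longleftrightarrow> degree p = 0" for p :: "'a poly" by (rule pderiv_eq_0_iff)
  have dp: "degree (pderiv p) = degree p - 1" for p :: "'a poly" by (rule degree_pderiv)
  have UV: "degree U = 0 \<or> degree V = 0"
    using U V unfolding z dp by linarith
  have "degree Q = 0" if "degree R = 0" "[:f:] * R ^ a + [:g:] * Q ^ b = [:c:]" "g \<noteq> 0" "b \<ge> 2"
    for R Q f g a b
  proof -
    from that(1) obtain r where r: "R = [:r:]" by (rule degree_eq_zeroE)
    have "[:g:] * Q ^ b = [:c:] - [:f:] * [:r:] ^ a"
      unfolding that(2)[symmetric] r by (simp only: add_diff_cancel_left')
    also have "\<dots> = [:c - f * r ^ a:]" by (simp add: poly_const_pow)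
    finally have "degree ([:g:] * Q ^ b) = 0" by simp
    then show ?thesis using that(3,4) by (cases "Q = 0") (simp_all add: degree_mult_eq degree_power_eq)
  qed
  note this[of U f a g V b] this[of V g b f U a]
  moreover have "[:g:] * V ^ b + [:f:] * U ^ a = [:c:]" using eq by (simp only: add.commute)
  ultimately show ?thesis using UV eq fg(1,2) ab by metis
qed

text \<open>A weighted homogeneous form with weights \<open>l\<close> and \<open>k\<close> that is
  divisible by neither variable is by coprimality a binary form in \<open>U^k\<close> and
  \<open>V^l\<close>; over the complex numbers it has a factor \<open>U^k - \<zeta> V^l\<close>.
  Arbitrary ring elements \<open>U\<close>, \<open>V\<close> are allowed because it is applied to
  images under the graded action.\<close>

lemma weighted_form_factor:
  fixes U V :: "'r::comm_ring_1" and \<kappa> :: "complex \<Rightarrow> 'r"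
  assumes \<kappa>: "rhom \<kappa>" and kl: "coprime k l" "k > 0" "l > 0"
    and F: "finite F" "F \<noteq> {}" "\<And>p. p \<in> F \<Longrightarrow> c p \<noteq> 0 \<and> l * fst p + k * snd p = N"
  defines "\<Sigma> \<equiv> \<Sum>p\<in>F. \<kappa> (c p) * U ^ fst p * V ^ snd p"
  shows "F = {(0, 0)} \<or> U dvd \<Sigma> \<or> V dvd \<Sigma> \<or> (\<exists>\<zeta>. \<zeta> \<noteq> 0 \<and> U ^ k - \<kappa> \<zeta> * V ^ l dvd \<Sigma>)"
proof (cases "(\<forall>p\<in>F. fst p \<noteq> 0) \<or> (\<forall>p\<in>F. snd p \<noteq> 0) \<or> N = 0")
  case True
  then show ?thesis
  proof (elim disjE)
    assume "\<forall>p\<in>F. fst p \<noteq> 0"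
    then have "U dvd \<Sigma>" unfolding \<Sigma>_def by (intro dvd_sum dvd_mult2 dvd_mult) (simp add: dvd_power)
    then show ?thesis by blast
  next
    assume "\<forall>p\<in>F. snd p \<noteq> 0"
    then have "V dvd \<Sigma>" unfolding \<Sigma>_def by (intro dvd_sum dvd_mult) (simp add: dvd_power)
    then show ?thesis by blast
  next
    assume N: "N = 0"
    have "p = (0, 0)" if "p \<in> F" for p using F(3)[OF that] N kl by (simp add: prod_eq_iff)
    then show ?thesis using F(2) by blast
  qed
next
  case False
  then obtain e0 a1 where e0: "(0, e0) \<in> F" and a1: "(a1, 0) \<in> F" and N: "N \<noteq> 0"
  proof -
    assume *: "\<And>e0 a1. (0, e0) \<in> F \<Longrightarrow> (a1, 0) \<in> F \<Longrightarrow> N \<noteq> 0 \<Longrightarrow> thesis"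
    obtain p p' where "p \<in> F" "fst p = 0" "p' \<in> F" "snd p' = 0" using False by blast
    then show thesis using *[of "snd p" "fst p'"] False by (cases p; cases p') auto
  qed
  have "l * a1 = N" "k * e0 = N" using F(3)[OF e0] F(3)[OF a1] by simp_all
  then have "k dvd l * a1" by (metis dvd_triv_left)
  then have "k dvd a1" using kl(1) by (simp add: coprime_dvd_mult_right_iff)
  then obtain M where M: "a1 = k * M" by (rule dvdE)
  have NM: "N = l * (k * M)" using \<open>l * a1 = N\<close> M by simp
  have shape: "fst p = k * (fst p div k) \<and> snd p = l * (M - fst p div k) \<and> fst p div k \<le> M" if "p \<in> F" for p
  proof -
    have eq: "l * fst p + k * snd p = l * (k * M)" using F(3)[OF that] NM by simp
    have "k dvd l * fst p + k * snd p" unfolding eq by simp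
    then have "k dvd l * fst p" by (simp add: dvd_add_left_iff)
    then have "k dvd fst p" using kl(1) by (simp add: coprime_dvd_mult_right_iff)
    then obtain b where b: "fst p = k * b" by (rule dvdE)
    have "k * (l * b + snd p) = k * (l * M)" using eq by (simp add: b algebra_simps)
    then have "l * b + snd p = l * M" using kl(2) by simp
    moreover then have "b \<le> M" using kl(3) by (metis le_add1 mult_le_cancel1)
    ultimately have "snd p = l * (M - b)" by (simp add: diff_mult_distrib2)
    then show ?thesis using b \<open>b \<le> M\<close> kl(2) by simp
  qed
  \<comment> \<open>The dehomogenised form, a polynomial in the quotient of \<open>U^k\<close> by
    \<open>V^l\<close>; both its constant and its top coefficient are nonzero, so it has a nonzero
    root.\<close>
  define q where "q = (\<Sum>p\<in>F. monom (c p) (fst p div k))"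
  have eqp: "p = (k * b, l * (M - b))" if "p \<in> F" "fst p div k = b" for p b
    using shape[OF that(1)] that(2) by (auto simp: prod_eq_iff)
  have cq: "coeff q b = c p0" if "p0 \<in> F" "fst p0 div k = b" for p0 b
  proof -
    have "coeff q b = (\<Sum>p\<in>F. if p = p0 then c p else 0)"
      unfolding q_def coeff_sum coeff_monom
    proof (intro sum.cong refl)
      fix p assume "p \<in> F"
      then have "fst p div k = b \<longleftrightarrow> p = p0" using eqp[of p b] eqp[OF that] that(2) by auto
      then show "(if fst p div k = b then c p else 0) = (if p = p0 then c p else 0)" by simp
    qed
    then show ?thesis using F(1) that(1) by simp
  qed
  have M0: "M \<noteq> 0" using NM N by auto
  have "coeff q M \<noteq> 0" using cq[OF a1, of M] F(3)[OF a1] kl(2) by (simp add: M)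
  then have "degree q \<noteq> 0" using M0 by (metis le_degree le_zero_eq)
  then have "\<not> constant (poly q)" by (simp add: constant_degree)
  then obtain \<zeta> where z: "poly q \<zeta> = 0" using fundamental_theorem_of_algebra by blast
  have "coeff q 0 \<noteq> 0" using cq[OF e0, of 0] F(3)[OF e0] by simp
  then have z0: "\<zeta> \<noteq> 0" using z by (auto simp: poly_0_coeff_0)
  have "(\<Sum>p\<in>F. c p * \<zeta> ^ (fst p div k)) = 0"
    using z unfolding q_def by (simp add: poly_sum poly_monom)
  then have "\<kappa> (\<Sum>p\<in>F. c p * \<zeta> ^ (fst p div k)) = 0" by (simp only: rhom_0[OF \<kappa>])
  then have zero: "(\<Sum>p\<in>F. \<kappa> (c p) * \<kappa> \<zeta> ^ (fst p div k)) = 0"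
    by (simp only: rhom_sum[OF \<kappa>] rhom_mult[OF \<kappa>] rhom_power[OF \<kappa>])
  \<comment> \<open>Subtracting the value at the root, which is 0, turns each summand into a
    multiple of a difference of equal powers of \<open>U^k\<close> and
    \<open>\<zeta> V^l\<close>.\<close>
  have "\<Sigma> = \<Sigma> - (\<Sum>p\<in>F. \<kappa> (c p) * \<kappa> \<zeta> ^ (fst p div k)) * (V ^ l) ^ M"
    by (simp add: zero)
  also have "\<dots> = (\<Sum>p\<in>F. \<kappa> (c p) * (V ^ l) ^ (M - fst p div k) * ((U ^ k) ^ (fst p div k) - (\<kappa> \<zeta> * V ^ l) ^ (fst p div k)))"
    unfolding \<Sigma>_def sum_distrib_right sum_subtractf[symmetric]
  proof (intro sum.cong refl)
    fix p assume p: "p \<in> F"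
    define b where "b = fst p div k"
    have e: "U ^ fst p = (U ^ k) ^ b" "V ^ snd p = (V ^ l) ^ (M - b)"
      using shape[OF p] unfolding b_def by (simp_all flip: power_mult)
    have "(V ^ l) ^ M = (V ^ l) ^ (M - b) * (V ^ l) ^ b"
      using shape[OF p] unfolding b_def by (simp flip: power_add)
    then show "\<kappa> (c p) * U ^ fst p * V ^ snd p - \<kappa> (c p) * \<kappa> \<zeta> ^ (fst p div k) * (V ^ l) ^ M =
        \<kappa> (c p) * (V ^ l) ^ (M - fst p div k) * ((U ^ k) ^ (fst p div k) - (\<kappa> \<zeta> * V ^ l) ^ (fst p div k))"
      unfolding b_def[symmetric] e by (simp only: power_mult_distrib) (simp only: algebra_simps)
  qed
  also have "U ^ k - \<kappa> \<zeta> * V ^ l dvd \<dots>"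
  proof (intro dvd_sum dvd_mult)
    fix p
    show "U ^ k - \<kappa> \<zeta> * V ^ l dvd (U ^ k) ^ (fst p div k) - (\<kappa> \<zeta> * V ^ l) ^ (fst p div k)"
      by (simp only: power_diff_sumr2 dvd_triv_left)
  qed
  finally show ?thesis using z0 by blast
qed

text \<open>\<open>E\<close> lifts the coaction \<open>a \<mapsto> (\<Sum>n. (D\<^sup>n a / n!) s\<^sup>n)\<close> of a locally nilpotent derivation \<open>D\<close> of the coordinate
  ring to representatives; all its axioms hold modulo \<open>P\<close> only.\<close>

locale ga_action =
  fixes d k l :: nat and E :: "poly4 \<Rightarrow> poly4 poly"
  assumes d: "2 \<le> d" and kl: "2 \<le> k" "k < l" "coprime k l"
    and E_hom: "rhom E" and E_const: "E (const4 c) = [:const4 c:]" and E_P: "P d k l dvd coeff (E (P d k l)) n"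
    and E_0: "P d k l dvd coeff (E a) 0 - a"
    and E_group: "P d k l dvd coeff (E (coeff (E a) n)) m - of_nat ((n + m) choose n) * coeff (E a) (n + m)"
    and E_nontrivial: "\<exists>a n. n \<ge> 1 \<and> \<not> P d k l dvd coeff (E a) n"

lemma normal_form_top:
  assumes \<epsilon>: "0 < \<epsilon>" "\<epsilon> \<notin> \<rat>" and k: "k > 0" and f: "\<not> P d k l dvd f"
  shows "\<exists>S c W M i j N. finite S \<and> (\<forall>m\<in>S. normal d m \<and> c m \<noteq> 0) \<and> P d k l dvd f - lincomb S c \<and>
    M = {m \<in> S. mono_deg d k l \<epsilon> m = W} \<and> M \<noteq> {} \<and> (\<forall>m\<in>S. mono_deg d k l \<epsilon> m \<le> W) \<and>
    (\<forall>m\<in>M. \<exists>a e. m = (j, a, e, i) \<and> l * a + k * e = N) \<and> level W (grd d k l \<epsilon> f)"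
proof -
  obtain S c where S: "finite S" "\<And>m. m \<in> S \<Longrightarrow> normal d m \<and> c m \<noteq> 0" "P d k l dvd f - lincomb S c"
    using normal_form by metis
  have ne: "S \<noteq> {}" using S(3) f by (auto simp: lincomb_def)
  define W where "W = Max (mono_deg d k l \<epsilon> ` S)"
  define M where "M = {m \<in> S. mono_deg d k l \<epsilon> m = W}"
  from lincomb_top[OF \<epsilon> k S(1) ne S(2) W_def M_def] obtain i j N where
    A: "M \<noteq> {}" "\<forall>m\<in>S. mono_deg d k l \<epsilon> m \<le> W" "\<forall>m\<in>M. \<exists>a e. m = (j, a, e, i) \<and> l * a + k * e = N"
    "level W (grd d k l \<epsilon> (lincomb S c))" by blast
  have "level W (grd d k l \<epsilon> f)" using A(4) grd_dvd[OF S(3)] by simp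
  then have "finite S \<and> (\<forall>m\<in>S. normal d m \<and> c m \<noteq> 0) \<and> P d k l dvd f - lincomb S c \<and>
    M = {m \<in> S. mono_deg d k l \<epsilon> m = W} \<and> M \<noteq> {} \<and> (\<forall>m\<in>S. mono_deg d k l \<epsilon> m \<le> W) \<and>
    (\<forall>m\<in>M. \<exists>a e. m = (j, a, e, i) \<and> l * a + k * e = N) \<and> level W (grd d k l \<epsilon> f)"
    using S A(1-3) M_def by blast
  then show ?thesis by blast
qed

text \<open>Outside the ideal a normal form has a nonzero leading term. So \<open>grd\<close> embeds
  the coordinate ring into a ring in which degrees can be read off.\<close>

lemma grd_eq_0_iff:
  assumes "0 < \<epsilon>" "\<epsilon> \<notin> \<rat>" "k > 0"
  shows "grd d k l \<epsilon> f = 0 \<longleftrightarrow> P d k l dvd f"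
proof
  assume "grd d k l \<epsilon> f = 0"
  then show "P d k l dvd f" using normal_form_top[OF assms, of d l f] by (auto simp: level_def)
next
  assume "P d k l dvd f"
  then show "grd d k l \<epsilon> f = 0" using grd_dvd[of d k l f 0 \<epsilon>] by (simp add: rhom_0[OF rhom_grd])
qed

text \<open>The slope \<open>q\<close> is the least weight of the parameter making the action filtered; by minimality the
  associated graded action is nontrivial.\<close>

locale graded_action = ga_action +
  fixes \<epsilon> q :: real
  assumes eps: "0 < \<epsilon>" "\<epsilon> \<notin> \<rat>"
    and slope: "\<And>n. bounded_by (- 1 + of_nat n * q) (grd d k l \<epsilon> (coeff (E var_x) n))"
      "\<And>n. bounded_by (of_nat l * \<epsilon> + of_nat n * q) (grd d k l \<epsilon> (coeff (E var_z) n))"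
      "\<And>n. bounded_by (of_nat k * \<epsilon> + of_nat n * q) (grd d k l \<epsilon> (coeff (E var_t) n))"
      "\<And>n. bounded_by (ydeg d k l \<epsilon> + of_nat n * q) (grd d k l \<epsilon> (coeff (E var_y) n))"
begin

abbreviation "gr \<equiv> grd d k l \<epsilon>"

definition "eb a = map_poly gr (E a)"
definition "ec a n = gr (coeff (E a) n)"

lemma gr_eq_0_iff: "gr f = 0 \<longleftrightarrow> P d k l dvd f"
  using grd_eq_0_iff[OF eps, of k d l f] kl by simp

lemma gr_dvd: "P d k l dvd f - g \<Longrightarrow> gr f = gr g"
  by (rule grd_dvd)

lemma rhom_eb: "rhom eb"
  unfolding eb_def using rhom_comp[OF rhom_map_poly[OF rhom_grd] E_hom] by blast

lemma coeff_eb: "coeff (eb a) n = ec a n"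
  by (simp add: eb_def ec_def coeff_map_poly rhom_0[OF rhom_grd])

lemma eb_P: "eb (P d k l) = 0"
  by (rule poly_eqI) (simp add: coeff_eb ec_def gr_eq_0_iff E_P)

lemma eb_cong:
  assumes "P d k l dvd f - g"
  shows "eb f = eb g"
proof -
  have "eb (f - g) = 0" using assms by (elim dvdE) (simp add: rhom_mult[OF rhom_eb] eb_P)
  then show ?thesis by (simp add: rhom_diff[OF rhom_eb])
qed

lemma ec_0: "ec a 0 = gr a"
  unfolding ec_def by (rule gr_dvd[OF E_0])

lemma ec_group: "ec (coeff (E a) n) m = of_nat ((n + m) choose n) * ec a (n + m)"
  unfolding ec_def using gr_dvd[OF E_group] by (simp add: rhom_simps[OF rhom_grd])

text \<open>The parameter of the action is given weight \<open>- q\<close>; then the whole of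
  \<open>E a\<close> has weight at most \<open>w\<close>.\<close>

definition bd :: "real \<Rightarrow> poly4 \<Rightarrow> bool" where
  "bd w a \<longleftrightarrow> (\<forall>n. bounded_by (w + of_nat n * q) (ec a n))"

text \<open>The part of weight \<open>w\<close> of \<open>E a\<close>, as a polynomial in the
  parameter over \<open>\<complex>[z]\<close>: for \<open>a\<close> of degree \<open>w\<close>, the
  image of the leading form of \<open>a\<close> under the associated graded action.\<close>

definition H :: "real \<Rightarrow> poly4 \<Rightarrow> complex poly poly" where
  "H w a = (\<Sum>n\<le>degree (eb a). monom (lookup (ec a n) (w + of_nat n * q)) n)"

lemma coeff_H: "coeff (H w a) n = lookup (ec a n) (w + of_nat n * q)"
proof -
  have "ec a n = 0" if "n > degree (eb a)" using coeff_eq_0[OF that] by (simp add: coeff_eb)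
  then show ?thesis by (auto simp: H_def coeff_sum coeff_monom)
qed

lemma H_cong: "P d k l dvd f - g \<Longrightarrow> H w f = H w g" and bd_cong: "P d k l dvd f - g \<Longrightarrow> bd w f = bd w g"
proof -
  assume "P d k l dvd f - g"
  then have "ec f n = ec g n" for n using eb_cong coeff_eb by metis
  then show "H w f = H w g" "bd w f = bd w g" by (auto simp: poly_eq_iff coeff_H bd_def)
qed

lemma H_add: "H w (a + b) = H w a + H w b"
  by (rule poly_eqI) (simp add: coeff_H lookup_add rhom_add[OF rhom_eb] flip: coeff_eb)

lemma bd_add: "bd w a \<Longrightarrow> bd w b \<Longrightarrow> bd w (a + b)"
  by (simp add: bd_def bounded_by_add rhom_add[OF rhom_eb] flip: coeff_eb)

lemma H_0: "H w 0 = 0"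
  by (rule poly_eqI) (simp add: coeff_H rhom_0[OF rhom_eb] flip: coeff_eb)

lemma H_uminus: "H w (- a) = - H w a"
  using H_add[of w a "- a"] by (simp add: H_0 eq_neg_iff_add_eq_0 add.commute)

lemma H_diff: "H w (a - b) = H w a - H w b"
  using H_add[of w a "- b"] by (simp add: H_uminus)

lemma bd_0: "bd w 0"
  by (simp add: bd_def bounded_by_0 rhom_0[OF rhom_eb] flip: coeff_eb)

lemma H_sum: "H w (sum f S) = (\<Sum>i\<in>S. H w (f i))"
  by (induction S rule: infinite_finite_induct) (simp_all add: H_0 H_add)

lemma bd_sum: "(\<And>i. i \<in> S \<Longrightarrow> bd w (f i)) \<Longrightarrow> bd w (sum f S)"
  by (induction S rule: infinite_finite_induct) (simp_all add: bd_0 bd_add)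

lemma bd_mono: "bd w a \<Longrightarrow> w \<le> w' \<Longrightarrow> bd w' a"
  unfolding bd_def by (blast intro: bounded_by_mono add_right_mono)

lemma H_lower: "bd w a \<Longrightarrow> w < w' \<Longrightarrow> H w' a = 0"
  by (rule poly_eqI) (simp add: coeff_H bd_def bounded_by_def)

lemma bd_mult:
  assumes "bd w a" "bd w' b"
  shows "bd (w + w') (a * b)" "H (w + w') (a * b) = H w a * H w' b"
proof -
  have e: "ec (a * b) n = (\<Sum>i\<le>n. ec a i * ec b (n - i))" for n
    by (simp add: rhom_mult[OF rhom_eb] coeff_mult flip: coeff_eb)
  have w: "w + w' + of_nat n * q = (w + of_nat i * q) + (w' + of_nat (n - i) * q)" if "i \<le> n" for n i
    using that by (simp add: of_nat_diff algebra_simps)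
  have 1: "bounded_by (w + w' + of_nat n * q) (ec a i * ec b (n - i)) \<and>
    lookup (ec a i * ec b (n - i)) (w + w' + of_nat n * q) = coeff (H w a) i * coeff (H w' b) (n - i)" if "i \<le> n" for n i
    unfolding w[OF that] coeff_H using assms bounded_by_mult unfolding bd_def by blast
  show "bd (w + w') (a * b)"
    unfolding bd_def e using 1 by (auto intro!: bounded_by_sum)
  show "H (w + w') (a * b) = H w a * H w' b"
    by (rule poly_eqI) (simp add: coeff_H[of "w + w'"] e lookup_sum coeff_mult 1)
qed

lemma bd_const: "bd 0 (const4 c)" "H 0 (const4 c) = [:[:c:]:]"
proof -
  have e: "ec (const4 c) n = (if n = 0 then Poly_Mapping.single 0 [:c:] else 0)" for n
    by (simp add: ec_def E_const grd_gen coeff_pCons rhom_0[OF rhom_grd] split: nat.split)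
  show "bd 0 (const4 c)" by (simp add: bd_def e bounded_by_0 bounded_by_single)
  show "H 0 (const4 c) = [:[:c:]:]"
    by (rule poly_eqI) (simp add: coeff_H e coeff_pCons split: nat.split)
qed

lemma bd_power:
  assumes "bd w a"
  shows "bd (of_nat n * w) (a ^ n) \<and> H (of_nat n * w) (a ^ n) = H w a ^ n"
proof (induction n)
  case 0
  show ?case using bd_const[of 1] by (simp add: rhom_1[OF rhom_const4] flip: one_pCons)
next
  case (Suc n)
  then show ?case using bd_mult[OF assms, of "of_nat n * w" "a ^ n"] by (simp add: distrib_right)
qed

abbreviation "wy \<equiv> ydeg d k l \<epsilon>"
abbreviation "wz \<equiv> of_nat l * \<epsilon>"
abbreviation "wt \<equiv> of_nat k * \<epsilon>"
abbreviation "wkl \<equiv> of_nat (k * l) * \<epsilon>"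
text \<open>The images of the coordinates under the graded action. Degree 0 in the parameter means
  invariance of the corresponding leading form.\<close>

definition "Hx = H (- 1) var_x"
definition "Hz = H wz var_z"
definition "Ht = H wt var_t"
definition "Hy = H wy var_y"

lemma bd_gen: "bd (- 1) var_x" "bd wz var_z" "bd wt var_t" "bd wy var_y"
  unfolding bd_def ec_def using slope by blast+

lemma H_gen_0: "coeff Hx 0 = 1" "coeff Hz 0 = [:0, 1:]" "coeff Ht 0 = 1" "coeff Hy 0 = - Rt k"
  using grd_var_y(2)[OF eps(1), of d k l]
  by (simp_all add: Hx_def Hz_def Ht_def Hy_def coeff_H ec_0 grd_gen(1-4))

lemma H_gen_nz: "Hx \<noteq> 0" "Hz \<noteq> 0" "Ht \<noteq> 0" "Hy \<noteq> 0"
  using H_gen_0 Rt_nz[of k] by auto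

lemma bd_mono4:
  "bd (mono_deg d k l \<epsilon> (j, a, e, i)) (mono4 (j, a, e, i)) \<and>
   H (mono_deg d k l \<epsilon> (j, a, e, i)) (mono4 (j, a, e, i)) = Hx ^ j * Hz ^ a * Ht ^ e * Hy ^ i"
proof -
  note p = bd_gen[THEN bd_power]
  note B1 = bd_mult[OF conjunct1[OF p(1), of j] conjunct1[OF p(2), of a]]
  note B2 = bd_mult[OF B1(1) conjunct1[OF p(3), of e]]
  note B3 = bd_mult[OF B2(1) conjunct1[OF p(4), of i]]
  show ?thesis
    unfolding mono4.simps mono_deg.simps Hx_def Hz_def Ht_def Hy_def
    by (rule conjI[OF B3(1)]) (simp only: B3(2) B2(2) B1(2) conjunct2[OF p(1)] conjunct2[OF p(2)] conjunct2[OF p(3)] conjunct2[OF p(4)])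
qed

lemma bd_term: "bd (mono_deg d k l \<epsilon> m) (const4 c * mono4 m)"
  "H (mono_deg d k l \<epsilon> m) (const4 c * mono4 m) = [:[:c:]:] * H (mono_deg d k l \<epsilon> m) (mono4 m)"
proof -
  obtain j a e i where m: "m = (j, a, e, i)" by (cases m) auto
  have b: "bd (mono_deg d k l \<epsilon> m) (mono4 m)" using bd_mono4 m by blast
  from bd_mult[OF bd_const(1) b, of c]
  show "bd (mono_deg d k l \<epsilon> m) (const4 c * mono4 m)"
    "H (mono_deg d k l \<epsilon> m) (const4 c * mono4 m) = [:[:c:]:] * H (mono_deg d k l \<epsilon> m) (mono4 m)"
    by (simp_all only: add_0_left bd_const(2))
qed

lemma top_part:
  assumes S: "finite S" "P d k l dvd f - lincomb S c" and W: "\<forall>m\<in>S. mono_deg d k l \<epsilon> m \<le> W"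
    and M: "M = {m \<in> S. mono_deg d k l \<epsilon> m = W}" and shape: "\<forall>m\<in>M. \<exists>a e. m = (j, a, e, i) \<and> l * a + k * e = N"
  shows "bd W f" "H W f = Hx ^ j * Hy ^ i * (\<Sum>p\<in>(\<lambda>m. (fst (snd m), fst (snd (snd m)))) ` M. [:[:c (j, fst p, snd p, i):]:] * Hz ^ fst p * Ht ^ snd p)"
proof -
  have "bd W (lincomb S c)" unfolding lincomb_def
    using bd_term(1) W by (intro bd_sum) (blast intro: bd_mono)
  then show "bd W f" using bd_cong[OF S(2)] by simp
  have inj: "inj_on (\<lambda>m. (fst (snd m), fst (snd (snd m)))) M"
  proof (rule inj_onI)
    fix m m' assume m: "m \<in> M" "m' \<in> M" and e: "(fst (snd m), fst (snd (snd m))) = (fst (snd m'), fst (snd (snd m')))"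
    from shape m obtain a e where "m = (j, a, e, i)" by blast
    moreover from shape m obtain a' e' where "m' = (j, a', e', i)" by blast
    ultimately show "m = m'" using e by simp
  qed
  have "H W f = (\<Sum>m\<in>S. H W (const4 (c m) * mono4 m))"
    unfolding H_cong[OF S(2)] lincomb_def H_sum ..
  also have "\<dots> = (\<Sum>m\<in>M. H W (const4 (c m) * mono4 m))"
  proof (rule sum.mono_neutral_right[OF S(1)])
    show "M \<subseteq> S" by (auto simp: M)
    show "\<forall>m\<in>S - M. H W (const4 (c m) * mono4 m) = 0"
    proof
      fix m assume "m \<in> S - M"
      then have "mono_deg d k l \<epsilon> m < W" using W by (auto simp: M less_le)
      then show "H W (const4 (c m) * mono4 m) = 0" by (rule H_lower[OF bd_term(1)])
    qed
  qed
  also have "\<dots> = (\<Sum>m\<in>M. Hx ^ j * Hy ^ i * ([:[:c (j, fst (snd m), fst (snd (snd m)), i):]:] * Hz ^ fst (snd m) * Ht ^ fst (snd (snd m))))"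
  proof (intro sum.cong refl)
    fix m assume m: "m \<in> M"
    then obtain a e where me: "m = (j, a, e, i)" using shape by blast
    have "H W (const4 (c m) * mono4 m) = [:[:c m:]:] * H (mono_deg d k l \<epsilon> m) (mono4 m)"
      using bd_term(2)[of m "c m"] m by (simp only: M mem_Collect_eq)
    also have "\<dots> = [:[:c m:]:] * (Hx ^ j * Hz ^ a * Ht ^ e * Hy ^ i)"
      unfolding me using bd_mono4 by simp
    finally show "H W (const4 (c m) * mono4 m) =
      Hx ^ j * Hy ^ i * ([:[:c (j, fst (snd m), fst (snd (snd m)), i):]:] * Hz ^ fst (snd m) * Ht ^ fst (snd (snd m)))"
      by (simp only: me fst_conv snd_conv) (simp only: mult_ac)
  qed
  also have "\<dots> = Hx ^ j * Hy ^ i * (\<Sum>p\<in>(\<lambda>m. (fst (snd m), fst (snd (snd m)))) ` M. [:[:c (j, fst p, snd p, i):]:] * Hz ^ fst p * Ht ^ snd p)"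
    by (simp add: sum.reindex[OF inj] sum_distrib_left)
  finally show "H W f = Hx ^ j * Hy ^ i * (\<Sum>p\<in>(\<lambda>m. (fst (snd m), fst (snd (snd m)))) ` M. [:[:c (j, fst p, snd p, i):]:] * Hz ^ fst p * Ht ^ snd p)" .
qed

lemma coeff_H_0: "coeff (H w f) 0 = lookup (gr f) w"
  by (simp add: coeff_H ec_0)

lemma H_nz: "level w (gr f) \<Longrightarrow> H w f \<noteq> 0"
  using coeff_H_0[of w f] by (auto simp: level_def)

lemma level_not_dvd: "level w (gr f) \<Longrightarrow> \<not> P d k l dvd f"
  using gr_eq_0_iff[of f] by (auto simp: level_def)

lemma k_pos: "k > 0" using kl by simp

lemma level_bd:
  assumes "level w (gr f)"
  shows "bd w f"
proof -
  from normal_form_top[OF eps k_pos level_not_dvd[OF assms]] obtain S c W M i j N where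
    A: "finite S" "\<forall>m\<in>S. normal d m \<and> c m \<noteq> 0" "P d k l dvd f - lincomb S c"
    "M = {m \<in> S. mono_deg d k l \<epsilon> m = W}" "M \<noteq> {}" "\<forall>m\<in>S. mono_deg d k l \<epsilon> m \<le> W"
    "\<forall>m\<in>M. \<exists>a e. m = (j, a, e, i) \<and> l * a + k * e = N" "level W (gr f)"
    by (elim exE conjE) (rule that; assumption)
  have "W = w" by (rule level_unique[OF A(8) assms])
  then show ?thesis using top_part(1)[OF A(1,3,6,4,7)] by simp
qed

text \<open>The summand \<open>x\<close> of \<open>P\<close> has negative weight, below the common
  weight of the other summands, and disappears from the leading relation.\<close>

lemma relation: "Hy * Hx ^ d + Hz ^ k + Ht ^ l = 0"
proof -
  note p = bd_gen[THEN bd_power]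
  have y: "wkl = of_nat d * (- 1) + wy" "wkl = of_nat k * wz" "wkl = of_nat l * wt" by (simp_all add: ydeg_def)
  have 1: "H wkl (var_x ^ d * var_y) = Hx ^ d * Hy"
    unfolding y(1) Hx_def Hy_def using bd_mult(2)[OF conjunct1[OF p(1), of d] bd_gen(4)] conjunct2[OF p(1), of d] by simp
  have 2: "H wkl (var_z ^ k) = Hz ^ k" unfolding y(2) Hz_def using p(2) by blast
  have 3: "H wkl (var_t ^ l) = Ht ^ l" unfolding y(3) Ht_def using p(3) by blast
  have "0 \<le> wkl" using eps by simp
  then have 4: "H wkl var_x = 0" by (intro H_lower[OF bd_gen(1)]) linarith
  have "H wkl (P d k l) = H wkl 0" by (rule H_cong) simp
  then show ?thesis unfolding P_def H_add 1 2 3 4 H_0 by (simp add: mult.commute)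
qed

lemma degree_0_of_dvd:
  fixes A B :: "complex poly poly"
  assumes "A dvd B" "B \<noteq> 0" "degree B = 0"
  shows "degree A = 0"
  using dvd_imp_degree_le[OF assms(1,2)] assms(3) by simp

text \<open>With \<open>y\<close> invariant, one more invariant turns the relation into
  \<open>f U^a + g V^b = c\<close> with \<open>c\<close> nonzero, to which
  \<open>power_sum_const\<close> applies. For \<open>z^k - \<zeta> t^l\<close> the invariance
  equation already has this shape, with nonzero value because its part at parameter 0 is
  \<open>z^k - \<zeta>\<close>.\<close>

lemma all_const:
  assumes y: "degree Hy = 0"
    and c: "degree Hx = 0 \<or> degree Hz = 0 \<or> degree Ht = 0 \<or> (\<exists>\<zeta>. \<zeta> \<noteq> 0 \<and> degree (Hz ^ k - [:[:\<zeta>:]:] * Ht ^ l) = 0)"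
  shows "degree Hx = 0 \<and> degree Hz = 0 \<and> degree Ht = 0"
proof -
  have l2: "2 \<le> l" using kl by simp
  from y obtain y0 where y0: "Hy = [:y0:]" by (rule degree_eq_zeroE)
  have yn: "y0 \<noteq> 0" using H_gen_nz y0 by auto
  have cp: "[:u:] ^ n = [:u ^ n:]" for u :: "complex poly" and n by (rule poly_const_pow)
  have zt: "degree Hx = 0" if "degree Hz = 0" "degree Ht = 0"
  proof -
    from that(1) obtain z0 where z0: "Hz = [:z0:]" by (rule degree_eq_zeroE)
    from that(2) obtain t0 where t0: "Ht = [:t0:]" by (rule degree_eq_zeroE)
    note zt = z0 t0
    have "Hy * Hx ^ d = - (Hz ^ k + Ht ^ l)" using relation by (simp only: eq_neg_iff_add_eq_0 add.assoc)
    then have "degree (Hy * Hx ^ d) = 0" by (simp add: zt cp)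
    then show ?thesis using H_gen_nz d by (simp add: degree_mult_eq degree_power_eq)
  qed
  from c show ?thesis
  proof (elim disjE exE conjE)
    assume "degree Hx = 0"
    then obtain x0 where x0: "Hx = [:x0:]" by (rule degree_eq_zeroE)
    have "x0 \<noteq> 0" using H_gen_nz x0 by auto
    have "[:1:] * Hz ^ k + [:1:] * Ht ^ l = - (Hy * Hx ^ d)"
      using relation by (simp add: eq_neg_iff_add_eq_0 algebra_simps)
    also have "\<dots> = [:- (y0 * x0 ^ d):]" by (simp add: y0 x0 cp)
    finally have e: "[:1:] * Hz ^ k + [:1:] * Ht ^ l = [:- (y0 * x0 ^ d):]" .
    have "degree Hz = 0 \<and> degree Ht = 0"
      by (rule power_sum_const[OF _ _ _ kl(1) l2 e]) (use yn \<open>x0 \<noteq> 0\<close> in simp_all)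
    then show ?thesis using \<open>degree Hx = 0\<close> by blast
  next
    assume "degree Hz = 0"
    then obtain z0 where z0: "Hz = [:z0:]" by (rule degree_eq_zeroE)
    have "z0 \<noteq> 0" using H_gen_nz z0 by auto
    have "[:y0:] * Hx ^ d + [:1:] * Ht ^ l = - (Hz ^ k)"
      using relation unfolding y0 by (simp add: eq_neg_iff_add_eq_0 algebra_simps)
    also have "\<dots> = [:- (z0 ^ k):]" by (simp add: z0 cp)
    finally have e: "[:y0:] * Hx ^ d + [:1:] * Ht ^ l = [:- (z0 ^ k):]" .
    have "degree Hx = 0 \<and> degree Ht = 0"
      by (rule power_sum_const[OF _ _ _ d l2 e]) (use yn \<open>z0 \<noteq> 0\<close> in simp_all)
    then show ?thesis using \<open>degree Hz = 0\<close> by blast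
  next
    assume "degree Ht = 0"
    then obtain z0 where z0: "Ht = [:z0:]" by (rule degree_eq_zeroE)
    have "z0 \<noteq> 0" using H_gen_nz z0 by auto
    have "[:y0:] * Hx ^ d + [:1:] * Hz ^ k = - (Ht ^ l)"
      using relation unfolding y0 by (simp add: eq_neg_iff_add_eq_0 algebra_simps)
    also have "\<dots> = [:- (z0 ^ l):]" by (simp add: z0 cp)
    finally have e: "[:y0:] * Hx ^ d + [:1:] * Hz ^ k = [:- (z0 ^ l):]" .
    have "degree Hx = 0 \<and> degree Hz = 0"
      by (rule power_sum_const[OF _ _ _ d kl(1) e]) (use yn \<open>z0 \<noteq> 0\<close> in simp_all)
    then show ?thesis using \<open>degree Ht = 0\<close> by blast
  next
    fix \<zeta> :: complex
    assume z: "\<zeta> \<noteq> 0" "degree (Hz ^ k - [:[:\<zeta>:]:] * Ht ^ l) = 0"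
    from z(2) obtain c where c: "Hz ^ k - [:[:\<zeta>:]:] * Ht ^ l = [:c:]" by (rule degree_eq_zeroE)
    have "coeff (Hz ^ k - [:[:\<zeta>:]:] * Ht ^ l) 0 = [:0, 1:] ^ k - [:\<zeta>:]"
      by (simp add: coeff_0_power coeff_mult_0 H_gen_0)
    also have "\<dots> \<noteq> 0"
    proof
      assume "[:0, 1:] ^ k - [:\<zeta>:] = 0"
      then have "poly ([:0, 1:] ^ k - [:\<zeta>:]) 0 = 0" by simp
      then show False using z k_pos by (simp add: power_0_left)
    qed
    finally have "c \<noteq> 0" unfolding c by simp
    have e: "[:1:] * Hz ^ k + [:[:- \<zeta>:]:] * Ht ^ l = [:c:]"
    proof -
      have "[:[:- \<zeta>:]:] * p = - ([:[:\<zeta>:]:] * p)" for p :: "complex poly poly"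
        by (simp flip: smult_minus_left)
      then show ?thesis using c by (simp only:) simp
    qed
    have "degree Hz = 0 \<and> degree Ht = 0"
      by (rule power_sum_const[OF _ _ _ kl(1) l2 e]) (use z(1) \<open>c \<noteq> 0\<close> in simp_all)
    then show ?thesis using zt by blast
  qed
qed

text \<open>Degrees in the parameter add, so every factor of an invariant is invariant. If neither
  \<open>x, z, t\<close> nor any \<open>z^k - \<zeta> t^l\<close> is invariant, only a power of
  \<open>y\<close> survives in the factorisation of the leading form.\<close>

lemma invariant_top:
  assumes y: "degree Hy = 0" and nx: "degree Hx \<noteq> 0" "degree Hz \<noteq> 0" "degree Ht \<noteq> 0"
    "\<And>\<zeta>. \<zeta> \<noteq> 0 \<Longrightarrow> degree (Hz ^ k - [:[:\<zeta>:]:] * Ht ^ l) \<noteq> 0"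
    and h: "level w (gr h)" "degree (H w h) = 0"
  shows "\<exists>i c. c \<noteq> 0 \<and> w = of_nat i * wy \<and> H w h = [:[:c:]:] * Hy ^ i"
proof -
  from normal_form_top[OF eps k_pos level_not_dvd[OF h(1)]] obtain S c W M i j N where
    A: "finite S" "\<forall>m\<in>S. normal d m \<and> c m \<noteq> 0" "P d k l dvd h - lincomb S c"
    "M = {m \<in> S. mono_deg d k l \<epsilon> m = W}" "M \<noteq> {}" "\<forall>m\<in>S. mono_deg d k l \<epsilon> m \<le> W"
    "\<forall>m\<in>M. \<exists>a e. m = (j, a, e, i) \<and> l * a + k * e = N" "level W (gr h)"
    by (elim exE conjE) (rule that; assumption)
  have W: "W = w" by (rule level_unique[OF A(8) h(1)])
  define F where "F = (\<lambda>m. (fst (snd m), fst (snd (snd m)))) ` M"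
  define \<Sigma> where "\<Sigma> = (\<Sum>p\<in>F. [:[:c (j, fst p, snd p, i):]:] * Hz ^ fst p * Ht ^ snd p)"
  have eq: "H w h = Hx ^ j * Hy ^ i * \<Sigma>"
    using top_part(2)[OF A(1,3,6,4,7)] unfolding W F_def \<Sigma>_def .
  have nz: "H w h \<noteq> 0" by (rule H_nz[OF h(1)])
  have fac: "degree A = 0" if "A dvd Hx ^ j * Hy ^ i * \<Sigma>" for A
    using degree_0_of_dvd[OF _ nz h(2)] that eq by simp
  have "j = 0"
  proof (rule ccontr)
    assume "j \<noteq> 0"
    then have "Hx dvd Hx ^ j * Hy ^ i * \<Sigma>" by (intro dvd_mult2) (simp add: dvd_power)
    then have "degree Hx = 0" by (rule fac)
    with nx(1) show False by simp
  qed
  have sd: "A dvd Hx ^ j * Hy ^ i * \<Sigma>" if "A dvd \<Sigma>" for A using that by (rule dvd_mult)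
  have fM: "finite M" using A(1,4) by simp
  have F: "finite F" "F \<noteq> {}" using fM A(5) by (simp_all add: F_def)
  have Fp: "c (j, fst p, snd p, i) \<noteq> 0 \<and> l * fst p + k * snd p = N \<and> (j, fst p, snd p, i) \<in> M" if "p \<in> F" for p
  proof -
    obtain m where m: "m \<in> M" "p = (fst (snd m), fst (snd (snd m)))" using \<open>p \<in> F\<close> unfolding F_def by blast
    then obtain a e where "m = (j, a, e, i)" "l * a + k * e = N" using A(7) by blast
    then show ?thesis using m A(2,4) by auto
  qed
  have \<kappa>: "rhom (\<lambda>c. [:[:c:]:] :: complex poly poly)"
    by (rule rhom_comp[OF rhom_const_poly rhom_const_poly])
  have lp: "l > 0" using kl by simp
  have "F = {(0, 0)} \<or> Hz dvd \<Sigma> \<or> Ht dvd \<Sigma> \<or> (\<exists>\<zeta>. \<zeta> \<noteq> 0 \<and> Hz ^ k - [:[:\<zeta>:]:] * Ht ^ l dvd \<Sigma>)"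
    unfolding \<Sigma>_def using weighted_form_factor[OF \<kappa> kl(3) k_pos lp F, of "\<lambda>p. c (j, fst p, snd p, i)" N Hz Ht] Fp by blast
  then have F0: "F = {(0, 0)}"
  proof (elim disjE exE conjE)
    assume "Hz dvd \<Sigma>"
    from fac[OF sd[OF this]] nx(2) show ?thesis by simp
  next
    assume "Ht dvd \<Sigma>"
    from fac[OF sd[OF this]] nx(3) show ?thesis by simp
  next
    fix \<zeta> :: complex
    assume z: "\<zeta> \<noteq> 0" "Hz ^ k - [:[:\<zeta>:]:] * Ht ^ l dvd \<Sigma>"
    from fac[OF sd[OF z(2)]] nx(4)[OF z(1)] show ?thesis by simp
  qed
  have m0: "c (j, 0, 0, i) \<noteq> 0" "(j, 0, 0, i) \<in> M" using Fp[of "(0, 0)"] F0 by simp_all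
  then have "mono_deg d k l \<epsilon> (j, 0, 0, i) = w" using A(4) W by simp
  then have "w = of_nat i * wy" by (simp add: \<open>j = 0\<close>)
  moreover have "H w h = [:[:c (j, 0, 0, i):]:] * Hy ^ i"
    unfolding eq \<Sigma>_def F0 by (simp add: \<open>j = 0\<close>)
  ultimately show ?thesis using m0 by blast
qed

text \<open>The last nonzero coefficient of the action on an element is invariant: by the group law,
  acting on it again gives multiples of still higher coefficients. This supplies homogeneous
  invariants.\<close>

lemma leading_invariant:
  assumes f: "level w (gr f)"
  defines "N \<equiv> degree (H w f)"
  shows "level (w + of_nat N * q) (gr (coeff (E f) N))" "H (w + of_nat N * q) (coeff (E f) N) = [:lead_coeff (H w f):]"
proof -
  have b: "bd w f" by (rule level_bd[OF f])
  have nz: "lead_coeff (H w f) \<noteq> 0" using H_nz[OF f] by simp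
  show "level (w + of_nat N * q) (gr (coeff (E f) N))"
    using b nz unfolding level_def bd_def N_def coeff_H ec_def by blast
  show "H (w + of_nat N * q) (coeff (E f) N) = [:lead_coeff (H w f):]"
  proof (rule poly_eqI)
    fix m
    have "coeff (H (w + of_nat N * q) (coeff (E f) N)) m =
        lookup (of_nat ((N + m) choose N) * ec f (N + m)) (w + of_nat (N + m) * q)"
      by (simp add: coeff_H ec_group algebra_simps)
    also have "\<dots> = of_nat ((N + m) choose N) * coeff (H w f) (N + m)"
    proof -
      have "lookup (of_nat n * g) v = of_nat n * lookup g v" for n and g :: graded and v
        by (induction n) (simp_all add: distrib_right lookup_add)
      then show ?thesis by (simp add: coeff_H)
    qed
    also have "\<dots> = coeff [:lead_coeff (H w f):] m"
      by (cases m) (simp_all add: N_def coeff_eq_0)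
    finally show "coeff (H (w + of_nat N * q) (coeff (E f) N)) m = coeff [:lead_coeff (H w f):] m" .
  qed
qed

lemma level_gen: "level (- 1) (gr var_x)" "level wz (gr var_z)" "level wt (gr var_t)"
  by (simp_all add: grd_gen level_def bounded_by_single)

text \<open>Otherwise every homogeneous invariant is a multiple of a power of \<open>y\<close>, in
  particular the top coefficients of the images of \<open>x\<close>, \<open>z\<close> and
  \<open>t\<close>. Comparing weights then leads to a form \<open>z^k - \<zeta> t^l\<close> whose
  image both must and cannot have degree \<open>k * nz\<close>.\<close>

lemma const_if_y_const:
  assumes y: "degree Hy = 0"
  shows "degree Hx = 0 \<and> degree Hz = 0 \<and> degree Ht = 0"
proof (rule ccontr)
  assume no: "\<not> ?thesis"
  have "\<not> (degree Hx = 0 \<or> degree Hz = 0 \<or> degree Ht = 0 \<or>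
      (\<exists>\<zeta>. \<zeta> \<noteq> 0 \<and> degree (Hz ^ k - [:[:\<zeta>:]:] * Ht ^ l) = 0))"
    by (rule contrapos_nn[OF no all_const[OF y]])
  then have nx: "degree Hx \<noteq> 0" "degree Hz \<noteq> 0" "degree Ht \<noteq> 0"
    "\<And>\<zeta>. \<zeta> \<noteq> 0 \<Longrightarrow> degree (Hz ^ k - [:[:\<zeta>:]:] * Ht ^ l) \<noteq> 0"
    by (simp_all only: de_Morgan_disj not_ex de_Morgan_conj not_not) (metis)+
  from y obtain y0 where y0: "Hy = [:y0:]" by (rule degree_eq_zeroE)
  have inv: "\<exists>i c. c \<noteq> 0 \<and> w + of_nat (degree (H w f)) * q = of_nat i * wy \<and> lead_coeff (H w f) = [:c:] * y0 ^ i"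
    if "level w (gr f)" for w f
  proof -
    note A = leading_invariant[OF that]
    have dz: "degree (H (w + of_nat (degree (H w f)) * q) (coeff (E f) (degree (H w f)))) = 0"
      unfolding A(2) by simp
    have "\<exists>i c. c \<noteq> 0 \<and> w + of_nat (degree (H w f)) * q = of_nat i * wy \<and>
      H (w + of_nat (degree (H w f)) * q) (coeff (E f) (degree (H w f))) = [:[:c:]:] * Hy ^ i"
      by (rule invariant_top[OF y nx A(1) dz])
    then obtain i c where 1: "c \<noteq> 0" "w + of_nat (degree (H w f)) * q = of_nat i * wy"
      "H (w + of_nat (degree (H w f)) * q) (coeff (E f) (degree (H w f))) = [:[:c:]:] * Hy ^ i"
      by (elim exE conjE) (rule that; assumption)
    have "[:lead_coeff (H w f):] = [:[:c:] * y0 ^ i:]"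
      unfolding A(2)[symmetric] 1(3) y0 by (simp add: poly_const_pow)
    then show ?thesis using 1 by (intro exI[of _ i] exI[of _ c]) simp
  qed
  define nx nz nt where "nx = degree Hx" and "nz = degree Hz" and "nt = degree Ht"
  obtain ix cx where X: "- 1 + of_nat nx * q = of_nat ix * wy"
    using inv[OF level_gen(1)] unfolding nx_def Hx_def by blast
  obtain iz cz where Z: "cz \<noteq> 0" "wz + of_nat nz * q = of_nat iz * wy" "lead_coeff Hz = [:cz:] * y0 ^ iz"
    using inv[OF level_gen(2)] unfolding nz_def Hz_def by blast
  obtain it ct where T: "ct \<noteq> 0" "wt + of_nat nt * q = of_nat it * wy" "lead_coeff Ht = [:ct:] * y0 ^ it"
    using inv[OF level_gen(3)] unfolding nt_def Ht_def by blast
  have wy: "wy > 0"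
  proof -
    have "0 \<le> wkl" using eps by simp
    then show ?thesis using d unfolding ydeg_def by linarith
  qed
  \<comment> \<open>A rational dependence between \<open>q\<close> and the weight of
    \<open>y\<close> would make both \<open>- 1\<close> and \<open>l \<epsilon>\<close> rational
    multiples of that weight, hence \<open>\<epsilon>\<close> rational.\<close>
  have indep: "A = 0 \<and> B = 0" if "of_int A * q = of_int B * wy" for A B :: int
  proof (cases "A = 0")
    case True
    then show ?thesis using that wy by simp
  next
    case False
    define r where "r = real_of_int B / real_of_int A"
    have r: "r \<in> \<rat>" "q = r * wy" using that False by (simp_all add: r_def field_simps)
    have 1: "- 1 = (of_nat ix - of_nat nx * r) * wy" using X r(2) by (simp add: algebra_simps)
    have 2: "wz = (of_nat iz - of_nat nz * r) * wy" using Z(2) r(2) by (simp add: algebra_simps)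
    have nz0: "of_nat ix - of_nat nx * r \<noteq> 0" using 1 by auto
    have "wz * (of_nat ix - of_nat nx * r) = - (of_nat iz - of_nat nz * r)"
    proof -
      have "wz * (of_nat ix - of_nat nx * r) * wy = wz * (- 1)" by (simp only: 1 mult.assoc)
      also have "\<dots> = - (of_nat iz - of_nat nz * r) * wy" by (subst 2) (simp only: mult_minus_right mult_minus_left mult_1_right)
      finally show ?thesis using wy by simp
    qed
    then have "\<epsilon> = - (of_nat iz - of_nat nz * r) / ((of_nat ix - of_nat nx * r) * of_nat l)"
      using nz0 kl by (simp add: field_simps)
    also have "\<dots> \<in> \<rat>" using r(1) by (intro Rats_divide Rats_minus_iff[THEN iffD2] Rats_diff Rats_mult Rats_of_nat)
    finally show ?thesis using eps by blast
  qed
  have Zk: "wkl + of_nat (k * nz) * q = of_nat (k * iz) * wy"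
    using arg_cong[OF Z(2), of "\<lambda>x. of_nat k * x"] by (simp add: algebra_simps)
  have Tl: "wkl + of_nat (l * nt) * q = of_nat (l * it) * wy"
    using arg_cong[OF T(2), of "\<lambda>x. of_nat l * x"] by (simp add: algebra_simps)
  have "of_int (int (k * nz) - int (l * nt)) * q = of_int (int (k * iz) - int (l * it)) * wy"
    using Zk Tl by (simp add: algebra_simps)
  from indep[OF this] have kn: "k * nz = l * nt" "k * iz = l * it"
    by (simp_all only: right_minus_eq of_nat_eq_iff)
  \<comment> \<open>Chosen to cancel the top coefficients of the images of \<open>z^k\<close> and
    \<open>\<zeta> t^l\<close>, which have equal degree and the same power of
    \<open>y\<close>.\<close>
  define \<zeta> where "\<zeta> = cz ^ k / ct ^ l"
  have \<zeta>: "\<zeta> \<noteq> 0" "\<zeta> * ct ^ l = cz ^ k" using Z T by (simp_all add: \<zeta>_def)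
  define b where "b = var_z ^ k - const4 \<zeta> * var_t ^ l"
  have y: "wkl = of_nat k * wz" "wkl = of_nat l * wt" by simp_all
  note p = bd_gen[THEN bd_power]
  have Hb: "H wkl b = Hz ^ k - [:[:\<zeta>:]:] * Ht ^ l"
  proof -
    have "H wkl (var_z ^ k) = Hz ^ k" unfolding y(1) Hz_def using p(2) by blast
    moreover have "H wkl (var_t ^ l) = Ht ^ l" "bd wkl (var_t ^ l)" unfolding y(2) Ht_def using p(3) by blast+
    moreover from bd_mult(2)[OF bd_const(1) this(2)] have "H wkl (const4 \<zeta> * var_t ^ l) = [:[:\<zeta>:]:] * H wkl (var_t ^ l)"
      by (simp only: add_0_left bd_const(2))
    ultimately show ?thesis by (simp only: b_def H_diff)
  qed
  have lb: "level wkl (gr b)"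
  proof -
    have "gr b = Poly_Mapping.single wkl ([:0, 1:] ^ k - [:\<zeta>:])"
      unfolding b_def rhom_simps[OF rhom_grd] grd_gen single_power
      by (simp add: mult_single single_diff mult.assoc mult.left_commute)
    moreover have "[:0, 1:] ^ k - [:\<zeta>:] \<noteq> 0"
    proof
      assume "[:0, 1:] ^ k - [:\<zeta>:] = 0"
      then have "poly ([:0, 1:] ^ k - [:\<zeta>:]) 0 = 0" by simp
      then show False using \<zeta> k_pos by (simp add: power_0_left)
    qed
    ultimately show ?thesis by (simp add: level_def bounded_by_single)
  qed
  define nb where "nb = degree (H wkl b)"
  obtain ib where B: "wkl + of_nat nb * q = of_nat ib * wy"
    using inv[OF lb] unfolding nb_def by blast
  have "of_int (int (k * nz) - int nb) * q = of_int (int (k * iz) - int ib) * wy"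
    using Zk B by (simp add: algebra_simps)
  \<comment> \<open>By independence the weight \<open>k l \<epsilon>\<close> alone fixes the degree
    of the image: \<open>b\<close> must have the degree of \<open>z^k\<close>, in spite of the
    cancellation.\<close>
  from indep[OF this] have nb: "nb = k * nz" by (simp only: right_minus_eq of_nat_eq_iff)
  have "coeff (H wkl b) (k * nz) = 0"
  proof -
    have "coeff (Hz ^ k) (k * nz) = lead_coeff Hz ^ k"
      unfolding nz_def using lead_coeff_power[of Hz k] by (simp add: degree_power_eq H_gen_nz)
    moreover have "coeff (Ht ^ l) (k * nz) = lead_coeff Ht ^ l"
      unfolding kn nt_def using lead_coeff_power[of Ht l] by (simp add: degree_power_eq H_gen_nz)
    ultimately have "coeff (H wkl b) (k * nz) = ([:cz:] * y0 ^ iz) ^ k - [:\<zeta>:] * ([:ct:] * y0 ^ it) ^ l"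
      unfolding Hb by (simp add: Z T)
    also have "\<dots> = [:cz ^ k:] * y0 ^ (k * iz) - [:\<zeta> * ct ^ l:] * y0 ^ (l * it)"
      by (simp add: power_mult_distrib poly_const_pow smult_power mult.commute flip: power_mult)
    also have "\<dots> = 0" by (simp add: \<zeta> kn)
    finally show ?thesis .
  qed
  then have "lead_coeff (H wkl b) = 0" unfolding nb[symmetric] nb_def .
  then show False using H_nz[OF lb] by simp
qed

end

section \<open>Choice of \<open>\<epsilon>\<close> and of the slope; invariants lie in
  \<open>\<complex>[x, z, t]\<close>\<close>

lemma sqrt_2_irrational: "sqrt 2 \<notin> \<rat>"
proof
  assume "sqrt 2 \<in> \<rat>"
  then obtain m n :: nat where mn: "n \<noteq> 0" "\<bar>sqrt 2\<bar> = real m / real n" "coprime m n"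
    by (rule Rats_abs_nat_div_natE)
  then have "real m = sqrt 2 * real n" by simp
  then have "real (m ^ 2) = real (2 * n ^ 2)" by (simp add: power_mult_distrib)
  then have e: "m ^ 2 = 2 * n ^ 2" by (simp only: of_nat_eq_iff)
  then have "even (m ^ 2)" by simp
  then have m: "even m" by simp
  then obtain r where "m = 2 * r" by (rule evenE)
  then have "n ^ 2 = 2 * r ^ 2" using e by (simp add: power2_eq_square)
  then have "even (n ^ 2)" by simp
  then have "even n" by simp
  then show False using m mn(3) by (meson coprime_common_divisor odd_one)
qed

lemma small_irrational:
  fixes B :: nat
  shows "\<exists>\<epsilon>::real. 0 < \<epsilon> \<and> \<epsilon> \<notin> \<rat> \<and> of_nat B * \<epsilon> < 1"
proof -
  define \<epsilon> where "\<epsilon> = sqrt 2 / of_nat (2 * (B + 1))"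
  have "\<epsilon> \<notin> \<rat>"
  proof
    assume "\<epsilon> \<in> \<rat>"
    then have "\<epsilon> * of_nat (2 * (B + 1)) \<in> \<rat>" by (intro Rats_mult Rats_of_nat)
    then show False using sqrt_2_irrational by (simp add: \<epsilon>_def)
  qed
  moreover have "0 < \<epsilon>" by (simp add: \<epsilon>_def)
  moreover have "of_nat B * \<epsilon> < 1"
  proof -
    have "sqrt 2 < 2" by (rule real_less_lsqrt[THEN order.strict_trans1[OF order.refl]]) simp_all
    then have "of_nat B * sqrt 2 \<le> of_nat B * 2" by (intro mult_left_mono) simp_all
    then have "of_nat B * sqrt 2 < of_nat (2 * (B + 1))" by simp
    then show ?thesis by (simp add: \<epsilon>_def field_simps)
  qed
  ultimately show ?thesis by blast
qed

context ga_action
begin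

lemma exists_slope:
  assumes eps: "0 < \<epsilon>" "\<epsilon> \<notin> \<rat>"
  shows "\<exists>q. graded_action d k l E \<epsilon> q \<and>
    (\<exists>(p, w) \<in> {(var_x, - 1), (var_z, of_nat l * \<epsilon>), (var_t, of_nat k * \<epsilon>), (var_y, ydeg d k l \<epsilon>)}.
      \<exists>n\<ge>1. lookup (grd d k l \<epsilon> (coeff (E p) n)) (w + of_nat n * q) \<noteq> 0)"
proof -
  define gr where "gr = grd d k l \<epsilon>"
  define G where "G = {(var_x, - 1), (var_z, of_nat l * \<epsilon>), (var_t, of_nat k * \<epsilon>), (var_y, ydeg d k l \<epsilon>)}"
  have gr0: "gr f = 0 \<longleftrightarrow> P d k l dvd f" for f unfolding gr_def using grd_eq_0_iff[OF eps, of k d l f] kl by simp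
  have grh: "rhom gr" unfolding gr_def by (rule rhom_grd)
  define I where "I = {(p, n). p \<in> G \<and> n \<ge> 1 \<and> gr (coeff (E (fst p)) n) \<noteq> 0}"
  have finG: "finite G" by (simp add: G_def)
  have "I \<subseteq> (\<Union>p\<in>G. {p} \<times> {..degree (E (fst p))})"
    unfolding I_def by (auto intro: le_degree simp: rhom_0[OF grh])
      (metis coeff_eq_0 not_le_imp_less rhom_0[OF grh])
  then have finI: "finite I" by (rule finite_subset) (use finG in simp)
  have neI: "I \<noteq> {}"
  proof
    assume I0: "I = {}"
    define eb where "eb a = map_poly gr (E a)" for a
    have ebh: "rhom eb" unfolding eb_def using rhom_comp[OF rhom_map_poly[OF grh] E_hom] by blast
    have ceb: "coeff (eb a) n = gr (coeff (E a) n)" for a n by (simp add: eb_def coeff_map_poly rhom_0[OF grh])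
    have gens: "degree (eb p) = 0" if "(p, w) \<in> G" for p w
    proof -
      have "coeff (eb p) n = 0" if "n > 0" for n
        using I0 that \<open>(p, w) \<in> G\<close> unfolding ceb I_def by fastforce
      then show ?thesis by (metis leading_coeff_0_iff degree_0 neq0_conv)
    qed
    have "degree (eb a) = 0" for a
    proof (induction a rule: poly4_gen_induct)
      case (const c)
      then show ?case by (simp add: eb_def E_const map_poly_pCons rhom_0[OF grh])
    next
      case (add p q)
      then show ?case using degree_add_le[of "eb p" 0 "eb q"] by (simp add: rhom_add[OF ebh])
    next
      case (mult p q)
      then show ?case using degree_mult_le[of "eb p" "eb q"] by (simp add: rhom_mult[OF ebh])
    qed (use gens in \<open>auto simp: G_def\<close>)
    then have "gr (coeff (E a) n) = 0" if "n \<ge> 1" for a n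
      using that ceb coeff_eq_0[of "eb a" n] by (metis less_le_trans zero_less_one)
    then show False using E_nontrivial gr0 by blast
  qed
  define lv where "lv f = (SOME w. level w f)" for f :: graded
  have lv: "level (lv f) f" if "f \<noteq> 0" for f
    unfolding lv_def using level_exists[OF that] by (rule someI_ex)
  define ratio where "ratio = (\<lambda>(p, n). (lv (gr (coeff (E (fst p)) n)) - snd p) / of_nat n)"
  \<comment> \<open>Every nonzero coefficient of positive order of a generator bounds the slope from
    below. The largest bound is admissible, and since it is attained, some generator keeps a nonzero
    leading coefficient of positive order.\<close>
  define q where "q = Max (ratio ` I)"
  have b: "bounded_by (w + of_nat n * q) (gr (coeff (E p) n))" if pw: "(p, w) \<in> G" for p w n
  proof (cases "n = 0")
    case True
    have "bounded_by w (gr p)"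
      using pw grd_var_y(1)[OF eps(1), of d k l] by (auto simp: G_def gr_def grd_gen(1-4) bounded_by_single)
    moreover have "gr (coeff (E p) 0) = gr p" unfolding gr_def by (rule grd_dvd[OF E_0])
    ultimately show ?thesis by (simp add: True)
  next
    case False
    show ?thesis
    proof (cases "gr (coeff (E p) n) = 0")
      case True
      then show ?thesis by (simp add: bounded_by_0)
    next
      case nz: False
      then have "((p, w), n) \<in> I" using pw False by (simp add: I_def)
      then have "ratio ((p, w), n) \<le> q" unfolding q_def using finI by (intro Max_ge) auto
      then have "lv (gr (coeff (E p) n)) \<le> w + of_nat n * q"
        using False by (simp add: ratio_def field_simps)
      then show ?thesis using lv[OF nz] unfolding level_def by (blast intro: bounded_by_mono)
    qed
  qed
  have "graded_action d k l E \<epsilon> q"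
    by unfold_locales
      (use eps b[of var_x "- 1"] b[of var_z "of_nat l * \<epsilon>"] b[of var_t "of_nat k * \<epsilon>"] b[of var_y "ydeg d k l \<epsilon>"]
        in \<open>simp_all add: G_def gr_def\<close>)
  moreover have "q \<in> ratio ` I" unfolding q_def using finI neI by (intro Max_in) auto
  then obtain p w n where pn: "((p, w), n) \<in> I" "q = ratio ((p, w), n)" by auto
  then have "(p, w) \<in> G" "n \<ge> 1" "gr (coeff (E p) n) \<noteq> 0" by (auto simp: I_def)
  moreover have "lv (gr (coeff (E p) n)) = w + of_nat n * q"
    using pn(2) \<open>n \<ge> 1\<close> by (simp add: ratio_def field_simps)
  ultimately have "\<exists>(p, w) \<in> G. \<exists>n\<ge>1. lookup (gr (coeff (E p) n)) (w + of_nat n * q) \<noteq> 0"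
    using lv[OF \<open>gr (coeff (E p) n) \<noteq> 0\<close>] unfolding level_def by fastforce
  then show ?thesis using \<open>graded_action d k l E \<epsilon> q\<close> unfolding G_def gr_def by blast
qed

text \<open>Suppose \<open>y\<close> occurs in the normal form of \<open>f\<close>. For
  \<open>\<epsilon>\<close> small enough the leading form of \<open>f\<close> contains
  \<open>y\<close> as a factor and is invariant, so \<open>y\<close> is; then all coordinates are,
  against the choice of the slope.\<close>

lemma invariant_in_subring:
  assumes f: "\<And>n. n \<ge> 1 \<Longrightarrow> P d k l dvd coeff (E f) n"
  shows "\<exists>b. P d k l dvd f - [:b:]"
proof -
  obtain S c where S: "finite S" "\<And>m. m \<in> S \<Longrightarrow> normal d m \<and> c m \<noteq> 0" "P d k l dvd f - lincomb S c"
    using normal_form by metis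
  show ?thesis
  proof (cases "\<forall>m\<in>S. snd (snd (snd m)) = 0")
    case True
    have "const4 (c m) * mono4 m = [:const3 (c m) * (Xb ^ fst m * Zv ^ fst (snd m) * Tv ^ fst (snd (snd m))):]" if "m \<in> S" for m
    proof -
      obtain j a e i where m: "m = (j, a, e, i)" by (cases m) auto
      then have "i = 0" using True \<open>m \<in> S\<close> by auto
      then show ?thesis unfolding m by (simp only: mono4.simps var_const_poly const_poly_simps fst_conv snd_conv power_0 mult_1_right)
    qed
    then have "lincomb S c = (\<Sum>m\<in>S. [:const3 (c m) * (Xb ^ fst m * Zv ^ fst (snd m) * Tv ^ fst (snd (snd m))):])"
      unfolding lincomb_def by (intro sum.cong refl)
    also have "\<dots> = [:\<Sum>m\<in>S. const3 (c m) * (Xb ^ fst m * Zv ^ fst (snd m) * Tv ^ fst (snd (snd m))):]"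
      by (rule rhom_sum[OF rhom_const_poly, symmetric])
    finally have eq: "lincomb S c = [:\<Sum>m\<in>S. const3 (c m) * (Xb ^ fst m * Zv ^ fst (snd m) * Tv ^ fst (snd (snd m))):]" .
    show ?thesis by (rule exI, rule S(3)[unfolded eq])
  next
    case False
    then obtain j1 a1 e1 i1 where m1: "(j1, a1, e1, i1) \<in> S" "i1 \<noteq> 0" by fastforce
    \<comment> \<open>A bound for the multiple of \<open>\<epsilon>\<close> in the degree of any
      monomial of \<open>f\<close> without \<open>y\<close>. With \<open>B \<epsilon> < 1\<close>
      these have degree below 1, while a normal monomial with \<open>y\<close> has integral part
      \<open>i d - j \<ge> 1\<close>.\<close>
    define B where "B = (\<Sum>m\<in>S. l * fst (snd m) + k * fst (snd (snd m)))"
    obtain \<epsilon> :: real where small: "0 < \<epsilon>" "\<epsilon> \<notin> \<rat>" "of_nat B * \<epsilon> < 1" using small_irrational by blast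
    from exists_slope[OF small(1,2)] obtain q where ga: "graded_action d k l E \<epsilon> q"
      and nt: "\<exists>(p, w) \<in> {(var_x, - 1), (var_z, of_nat l * \<epsilon>), (var_t, of_nat k * \<epsilon>), (var_y, ydeg d k l \<epsilon>)}.
        \<exists>n\<ge>1. lookup (grd d k l \<epsilon> (coeff (E p) n)) (w + of_nat n * q) \<noteq> 0" by blast
    interpret graded_action d k l E \<epsilon> q by (rule ga)
    define W where "W = Max (mono_deg d k l \<epsilon> ` S)"
    define M where "M = {m \<in> S. mono_deg d k l \<epsilon> m = W}"
    have ne: "S \<noteq> {}" using m1 by blast
    from lincomb_top[OF small(1,2) k_pos S(1) ne S(2) W_def M_def] obtain i j N where
      A: "M \<noteq> {}" "\<forall>m\<in>S. mono_deg d k l \<epsilon> m \<le> W" "\<forall>m\<in>M. \<exists>a e. m = (j, a, e, i) \<and> l * a + k * e = N"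
      "level W (gr (lincomb S c))" by blast
    have lev: "level W (gr f)" using A(4) gr_dvd[OF S(3)] by simp
    have W1: "1 \<le> W"
    proof -
      have "j1 < d" using S(2)[OF m1(1)] m1(2) by simp
      then have "1 + j1 \<le> d * 1" by simp
      also have "\<dots> \<le> d * i1" using m1(2) by (intro mult_le_mono2) simp
      finally have "real 1 + real j1 \<le> real d * real i1" by (simp only: of_nat_add[symmetric] of_nat_mult[symmetric] of_nat_le_iff)
      moreover have "mono_deg d k l \<epsilon> (j1, a1, e1, i1) = real d * real i1 - real j1 +
          (real a1 * (real l * \<epsilon>) + real e1 * (real k * \<epsilon>) + real i1 * (real (k * l) * \<epsilon>))"
        by (simp add: ydeg_def algebra_simps)
      moreover have "0 \<le> real a1 * (real l * \<epsilon>) + real e1 * (real k * \<epsilon>) + real i1 * (real (k * l) * \<epsilon>)"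
        using small(1) by simp
      ultimately have "1 \<le> mono_deg d k l \<epsilon> (j1, a1, e1, i1)" by linarith
      then show ?thesis using A(2) m1(1) by fastforce
    qed
    have i: "i \<noteq> 0"
    proof
      assume i0: "i = 0"
      obtain m where m: "m \<in> M" using A(1) by blast
      then obtain a e where me: "m = (j, a, e, 0)" using A(3) i0 by blast
      have mS: "m \<in> S" using m by (simp add: M_def)
      have "l * fst (snd m) + k * fst (snd (snd m)) \<le> B"
        unfolding B_def using S(1) mS by (intro member_le_sum) auto
      then have "real (l * a + k * e) * \<epsilon> \<le> real B * \<epsilon>" using small(1) by (intro mult_right_mono) (simp_all add: me del: of_nat_add of_nat_mult)
      moreover have "W = - real j + real (l * a + k * e) * \<epsilon>"
        using m by (simp add: M_def me algebra_simps)
      ultimately show False using W1 small(3) by linarith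
    qed
    have c0: "coeff (H W f) n = 0" if "n \<ge> 1" for n
      using gr_eq_0_iff[THEN iffD2, OF f[OF that]] by (simp add: coeff_H ec_def)
    have deg: "degree (H W f) = 0"
      using c0 by (metis H_nz lev leading_coeff_0_iff less_one not_le)
    obtain \<Sigma> where "H W f = Hx ^ j * Hy ^ i * \<Sigma>"
      using top_part(2)[OF S(1,3) A(2) M_def A(3)] by blast
    moreover have "Hy dvd Hx ^ j * Hy ^ i * \<Sigma>" using i by (intro dvd_mult2 dvd_mult) (simp add: dvd_power)
    ultimately have "degree Hy = 0" using degree_0_of_dvd[OF _ H_nz[OF lev] deg] by simp
    moreover from const_if_y_const[OF this] have "degree Hx = 0" "degree Hz = 0" "degree Ht = 0" by blast+
    ultimately have z: "coeff Hx n = 0" "coeff Hz n = 0" "coeff Ht n = 0" "coeff Hy n = 0" if "n \<ge> 1" for n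
      using that by (simp_all add: coeff_eq_0)
    have False
      using nt z unfolding Hx_def Hz_def Ht_def Hy_def coeff_H ec_def by auto
    then show ?thesis ..
  qed
qed

end

section \<open>Conjugates of the elementary actions\<close>

text \<open>Here the identities hold exactly, not only modulo \<open>P\<close>. The group law is
  replaced by the differential equation of the flow, which can be verified on generators and gives
  the group law back after division by \<open>n + 1\<close>.\<close>

locale elementary_action =
  fixes d k l :: nat and E :: "poly4 \<Rightarrow> poly4 poly"
  assumes hom: "rhom E" and const: "E (const4 c) = [:const4 c:]" and EP: "E (P d k l) = [:P d k l:]"
    and E0: "coeff (E a) 0 = a" and flow: "pderiv (E a) = E (coeff (E a) 1)"
begin

lemma coeff_Suc: "of_nat (Suc n) * coeff (E a) (Suc n) = coeff (E (coeff (E a) 1)) n"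
  using arg_cong[OF flow[of a], of "\<lambda>p. coeff p n"] by (simp add: coeff_pderiv)

lemma group: "coeff (E (coeff (E a) n)) m = of_nat ((n + m) choose n) * coeff (E a) (n + m)"
proof (induction n arbitrary: a)
  case 0
  then show ?case by (simp add: E0)
next
  case (Suc n)
  have on: "E (of_nat r) = of_nat r" for r by (rule rhom_of_nat[OF hom])
  have "of_nat (Suc n) * coeff (E (coeff (E a) (Suc n))) m = coeff (E (of_nat (Suc n) * coeff (E a) (Suc n))) m"
    by (simp add: rhom_mult[OF hom] on del: of_nat_Suc) (simp add: of_nat_poly)
  also have "\<dots> = of_nat ((n + m) choose n) * coeff (E (coeff (E a) 1)) (n + m)"
    unfolding coeff_Suc by (rule Suc.IH)
  also have "\<dots> = of_nat ((n + m) choose n) * of_nat (Suc (n + m)) * coeff (E a) (Suc (n + m))"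
    unfolding coeff_Suc[symmetric] by (simp only: mult.assoc)
  also have "of_nat ((n + m) choose n) * of_nat (Suc (n + m)) = (of_nat (Suc n) * of_nat ((Suc n + m) choose Suc n) :: poly4)"
    unfolding of_nat_mult[symmetric] using Suc_times_binomial_eq[of "n + m" n] by (simp only: add_Suc mult.commute)
  finally have "of_nat (Suc n) * coeff (E (coeff (E a) (Suc n))) m =
      of_nat (Suc n) * (of_nat ((Suc n + m) choose Suc n) * coeff (E a) (Suc n + m))"
    by (simp only: mult.assoc add_Suc)
  moreover have "(of_nat (Suc n) :: poly4) \<noteq> 0" by (rule of_nat_neq_0)
  ultimately show ?case using mult_left_cancel by blast
qed

lemma cong: "P d k l dvd a - b \<Longrightarrow> P d k l dvd coeff (E a) n - coeff (E b) n"
proof -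
  assume "P d k l dvd a - b"
  then obtain g where "a - b = P d k l * g" by (rule dvdE)
  then have "E a - E b = [:P d k l:] * E g" by (simp only: rhom_diff[OF hom, symmetric] rhom_mult[OF hom] EP)
  then have "coeff (E a) n - coeff (E b) n = P d k l * coeff (E g) n"
    using arg_cong[of "E a - E b" _ "\<lambda>p. coeff p n"] by (simp flip: coeff_diff)
  then show ?thesis by simp
qed

end

text \<open>The flow of the derivation with \<open>z \<mapsto> a x^d\<close> and
  \<open>t \<mapsto> b x^d\<close>: the change of \<open>z^k + t^l\<close> is divisible by
  \<open>x^d\<close>, and subtracting the quotient \<open>Q\<close> from \<open>y\<close> keeps
  \<open>P\<close> fixed. The choices \<open>(1, 0)\<close> and \<open>(0, 1)\<close> of
  \<open>(a, b)\<close> are the two actions used.\<close>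

lemma elementary_action_exists:
  assumes kl: "k > 0" "l > 0"
  shows "\<exists>E. elementary_action d k l E \<and> E var_x = [:var_x:] \<and> E var_z = [:var_z, const4 a * var_x ^ d:] \<and>
    E var_t = [:var_t, const4 b * var_x ^ d:]"
proof -
  define Zp where "Zp = [:var_z, const4 a * var_x ^ d:]"
  define Tp where "Tp = [:var_t, const4 b * var_x ^ d:]"
  have dv: "[:var_x ^ d:] dvd [:v, const4 c * var_x ^ d:] ^ n - [:v:] ^ n" for v c n
  proof -
    have "[:v, const4 c * var_x ^ d:] - [:v:] = [:var_x ^ d:] * [:0, const4 c:]" by (simp add: mult.commute)
    then have "[:var_x ^ d:] dvd [:v, const4 c * var_x ^ d:] - [:v:]" by (simp only: dvd_triv_left)
    then show ?thesis unfolding power_diff_sumr2 by (rule dvd_mult2)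
  qed
  have "[:var_x ^ d:] dvd (Zp ^ k - [:var_z:] ^ k) + (Tp ^ l - [:var_t:] ^ l)"
    unfolding Zp_def Tp_def by (intro dvd_add dv)
  then obtain Q where Q0: "(Zp ^ k - [:var_z:] ^ k) + (Tp ^ l - [:var_t:] ^ l) = [:var_x ^ d:] * Q" by (rule dvdE)
  define E where "E = hom4 (\<lambda>c. [:const4 c:]) [:var_x:] Zp Tp ([:var_y:] - Q)"
  have cc: "rhom (\<lambda>c. [:const4 c:])" by (rule rhom_comp[OF rhom_const_poly rhom_const4])
  have Er: "rhom E" unfolding E_def by (rule rhom_hom4[OF cc])
  have Eg: "E (const4 c) = [:const4 c:]" "E var_x = [:var_x:]" "E var_z = Zp" "E var_t = Tp" "E var_y = [:var_y:] - Q" for c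
    by (simp_all only: E_def hom4_gen[OF cc])
  have xn: "var_x ^ d \<noteq> 0" by (simp add: var_x_def)
  have c00: "rhom (\<lambda>p::poly4 poly. coeff p 0)" by (rule rhom_coeff_0)
  have Q00: "coeff Q 0 = 0"
  proof -
    have "coeff ((Zp ^ k - [:var_z:] ^ k) + (Tp ^ l - [:var_t:] ^ l)) 0 = 0"
      unfolding rhom_simps[OF c00] by (simp add: Zp_def Tp_def)
    then show ?thesis unfolding Q0 using xn by (auto simp add: coeff_mult_0)
  qed
  have E0: "coeff (E f) 0 = f" for f
    by (rule rhom_poly4_eqI[OF rhom_comp[OF c00 Er] rhom_id]) (simp_all add: Eg Zp_def Tp_def Q00)
  have EP: "E (P d k l) = [:P d k l:]"
  proof -
    have "E (P d k l) = [:var_x ^ d:] * [:var_y:] - [:var_x ^ d:] * Q + Zp ^ k + Tp ^ l + [:var_x:]"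
      unfolding P_def rhom_simps[OF Er] Eg const_poly_simps by (simp only: right_diff_distrib)
    also have "\<dots> = [:var_x ^ d:] * [:var_y:] + [:var_z:] ^ k + [:var_t:] ^ l + [:var_x:]"
      unfolding Q0[symmetric] by (simp only: algebra_simps)
    also have "\<dots> = [:P d k l:]" by (simp only: P_def const_poly_simps)
    finally show ?thesis .
  qed
  have sm: "smult (of_nat n) p = of_nat n * p" for n and p :: "poly4 poly" by (simp add: of_nat_poly)
  have pZ: "pderiv Zp = [:const4 a * var_x ^ d:]" "pderiv Tp = [:const4 b * var_x ^ d:]"
    by (simp_all add: Zp_def Tp_def pderiv_pCons)
  obtain k' l' where kl': "k = Suc k'" "l = Suc l'" using kl by (metis gr0_implies_Suc)
  have dQ: "pderiv Q = of_nat k * Zp ^ k' * [:const4 a:] + of_nat l * Tp ^ l' * [:const4 b:]"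
  proof -
    have "[:var_x ^ d:] * pderiv Q = pderiv ([:var_x ^ d:] * Q)"
      by (simp only: pderiv_mult pderiv_singleton mult_zero_right add_0_right)
    also have "\<dots> = of_nat k * Zp ^ k' * [:const4 a * var_x ^ d:] + of_nat l * Tp ^ l' * [:const4 b * var_x ^ d:]"
      unfolding Q0[symmetric] kl' pderiv_add pderiv_diff pderiv_power_Suc pZ sm
      by (simp only: pderiv_singleton mult_zero_right diff_0_right)
    also have "\<dots> = [:var_x ^ d:] * (of_nat k * Zp ^ k' * [:const4 a:] + of_nat l * Tp ^ l' * [:const4 b:])"
      unfolding const_poly_simps(2) by (simp only: distrib_left mult_ac)
    finally show ?thesis using xn by (subst (asm) mult_left_cancel) simp_all
  qed
  have dQ0: "coeff (pderiv Q) 0 = of_nat k * var_z ^ k' * const4 a + of_nat l * var_t ^ l' * const4 b"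
    unfolding dQ rhom_simps[OF c00] by (simp add: Zp_def Tp_def)
  have c1: "coeff p 1 = coeff (pderiv p) 0" for p :: "poly4 poly" by (simp add: coeff_pderiv)
  have flow: "pderiv (E f) = E (coeff (E f) 1)" for f
  proof (induction f rule: poly4_gen_induct)
    case (add p q)
    then show ?case by (simp add: rhom_add[OF Er] pderiv_add)
  next
    case (mult p q)
    have "coeff (E p * E q) 1 = p * coeff (E q) 1 + q * coeff (E p) 1"
      unfolding c1 pderiv_mult by (simp add: coeff_mult_0 E0)
    then show ?case by (simp add: rhom_mult[OF Er] rhom_add[OF Er] pderiv_mult mult)
  next
    case y
    have "coeff (E var_y) 1 = - (of_nat k * var_z ^ k' * const4 a + of_nat l * var_t ^ l' * const4 b)"
      unfolding c1 Eg pderiv_diff pderiv_singleton using dQ0 by simp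
    moreover have "pderiv (E var_y) = - pderiv Q" by (simp add: Eg pderiv_diff)
    ultimately show ?case unfolding dQ rhom_simps[OF Er] by (simp only: rhom_simps[OF Er] Eg)
  next
    case z
    have "coeff (E var_z) 1 = const4 a * var_x ^ d" by (simp add: Eg Zp_def)
    then show ?case unfolding Eg pZ by (simp only: Eg rhom_simps[OF Er] const_poly_simps)
  next
    case t
    have "coeff (E var_t) 1 = const4 b * var_x ^ d" by (simp add: Eg Tp_def)
    then show ?case unfolding Eg pZ by (simp only: Eg rhom_simps[OF Er] const_poly_simps)
  qed (simp_all add: Eg rhom_0[OF Er] pderiv_pCons)
  have "elementary_action d k l E"
    by unfold_locales (simp_all add: Er Eg EP E0 flow)
  then show ?thesis using Eg Zp_def Tp_def by blast
qed

text \<open>Transport of the action along the automorphism: \<open>F\<close> carries invariants of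
  \<open>E\<close> to invariants of \<open>F E G\<close>, to which the result on arbitrary
  nontrivial actions applies. \<open>F\<close> and \<open>G\<close> are inverse only modulo
  \<open>P\<close>, which is why the axioms of \<open>ga_action\<close> are congruences.\<close>

lemma conjugate_invariant:
  assumes d: "2 \<le> d" and kl: "2 \<le> k" "k < l" "coprime k l" and el: "elementary_action d k l E"
    and F: "rhom F" "\<And>c. F (const4 c) = const4 c" "P d k l dvd F (P d k l)"
    and G: "rhom G" "\<And>c. G (const4 c) = const4 c" "P d k l dvd G (P d k l)"
    and inv: "\<And>f. P d k l dvd F (G f) - f" "\<And>f. P d k l dvd G (F f) - f"
    and nt: "\<not> P d k l dvd coeff (E a) 1" and f: "E f = [:f:]"
  shows "\<exists>b. P d k l dvd F f - [:b:]"
proof -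
  interpret elementary_action d k l E by (rule el)
  define E' where "E' a = map_poly F (E (G a))" for a
  have E'r: "rhom E'" unfolding E'_def using rhom_comp[OF rhom_map_poly[OF F(1)] rhom_comp[OF hom G(1)]] by blast
  have cE': "coeff (E' a) n = F (coeff (E (G a)) n)" for a n
    by (simp add: E'_def coeff_map_poly rhom_0[OF F(1)])
  have Fd: "P d k l dvd F a - F b" if "P d k l dvd a - b" for a b
    using dvd_trans[OF F(3) rhom_dvd[OF F(1) that]] by (simp add: rhom_diff[OF F(1)])
  have Gd: "P d k l dvd G a - G b" if "P d k l dvd a - b" for a b
    using dvd_trans[OF G(3) rhom_dvd[OF G(1) that]] by (simp add: rhom_diff[OF G(1)])
  have tr: "P d k l dvd a - c" if "P d k l dvd a - b" "P d k l dvd b - c" for a b c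
    using dvd_add[OF that] by simp
  have key: "P d k l dvd coeff (E' (F c)) n - F (coeff (E c) n)" for c n
    unfolding cE' by (rule Fd[OF cong[OF inv(2)]])
  have "ga_action d k l E'"
  proof
    show "rhom E'" by (rule E'r)
    show "E' (const4 c) = [:const4 c:]" for c
      by (simp add: E'_def G const map_poly_pCons rhom_0[OF F(1)] F)
    show "P d k l dvd coeff (E' (P d k l)) n" for n
    proof -
      have "P d k l dvd G (P d k l) - 0" using G(3) by simp
      from Fd[OF cong[OF this, of n]] show ?thesis
        by (simp add: cE' rhom_0[OF hom] rhom_0[OF F(1)])
    qed
    show "P d k l dvd coeff (E' a) 0 - a" for a
      unfolding cE' E0 by (rule inv(1))
    show "P d k l dvd coeff (E' (coeff (E' a) n)) m - of_nat ((n + m) choose n) * coeff (E' a) (n + m)" for a n m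
    proof -
      have "P d k l dvd coeff (E' (coeff (E' a) n)) m - F (coeff (E (coeff (E (G a)) n)) m)"
        unfolding cE'[of a n] by (rule key)
      moreover have "F (coeff (E (coeff (E (G a)) n)) m) = of_nat ((n + m) choose n) * coeff (E' a) (n + m)"
        unfolding group cE' by (simp only: rhom_mult[OF F(1)] rhom_of_nat[OF F(1)])
      ultimately show ?thesis by (simp only:)
    qed
    show "\<exists>a n. n \<ge> 1 \<and> \<not> P d k l dvd coeff (E' a) n"
    proof (rule ccontr)
      assume "\<not> ?thesis"
      then have "P d k l dvd coeff (E' (F a)) 1" by blast
      then have "P d k l dvd F (coeff (E a) 1) - 0"
        using key[of a 1] by (metis diff_zero dvd_diff_right_iff dvd_sub_swap)
      from Gd[OF this] have "P d k l dvd G (F (coeff (E a) 1))" by (simp add: rhom_0[OF G(1)])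
      then show False using inv(2)[of "coeff (E a) 1"] nt by (metis dvd_diff_right_iff)
    qed
  qed (use d kl in auto)
  then interpret A: ga_action d k l E' .
  have "P d k l dvd coeff (E' (F f)) n" if "n \<ge> 1" for n
    using key[of f n] that by (simp add: f coeff_pCons rhom_0[OF F(1)] split: nat.splits)
  then show ?thesis by (rule A.invariant_in_subring)
qed

section \<open>Automorphisms of the coordinate ring\<close>

lemma poly3_gen_induct' [case_names const x z t add mult]:
  fixes p :: poly3
  assumes "\<And>a. Q (const3 a)" "Q Xb" "Q Zv" "Q Tv"
    and "\<And>p q. Q p \<Longrightarrow> Q q \<Longrightarrow> Q (p + q)" and "\<And>p q. Q p \<Longrightarrow> Q q \<Longrightarrow> Q (p * q)"
  shows "Q p"
  by (rule poly3_gen_induct[of Q]) (use assms in \<open>simp_all add: const3_def Xb_def Zv_def Tv_def cst_def\<close>)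

lemma P_dvd_const:
  assumes "P d k l dvd [:b:]"
  shows "b = 0"
proof (rule ccontr)
  assume "b \<noteq> 0"
  then have "degree (P d k l) \<le> degree [:b:]" using assms by (intro dvd_imp_degree_le) simp_all
  then show False using Xb_nz by (simp add: P_eq_pCons)
qed

lemma P_dvd_const_diff: "P d k l dvd [:b:] - [:c:] \<Longrightarrow> b = c"
  using P_dvd_const[of d k l "b - c"] by simp

lemma P_dvd_trans: "P d k l dvd a - b \<Longrightarrow> P d k l dvd b - c \<Longrightarrow> P d k l dvd a - c"
  using dvd_add[of "P d k l" "a - b" "b - c"] by simp

lemma P_dvd_mult_diff:
  assumes "P d k l dvd a - b" "P d k l dvd a' - b'"
  shows "P d k l dvd a * a' - b * b'"
proof -
  have "a * a' - b * b' = (a - b) * a' + b * (a' - b')" by (simp add: algebra_simps)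
  then show ?thesis using assms by simp
qed

lemma P_dvd_add_diff: "P d k l dvd a - b \<Longrightarrow> P d k l dvd a' - b' \<Longrightarrow> P d k l dvd (a + a') - (b + b')"
  using dvd_add[of "P d k l" "a - b" "a' - b'"] by (simp add: algebra_simps)

text \<open>Leading terms multiply without cancellation, so the embedding by \<open>grd\<close>
  excludes zero divisors.\<close>

lemma P_prime:
  assumes "k > 0" "P d k l dvd f * g" "\<not> P d k l dvd f"
  shows "P d k l dvd g"
proof (rule ccontr)
  assume g: "\<not> P d k l dvd g"
  obtain \<epsilon> :: real where \<epsilon>: "0 < \<epsilon>" "\<epsilon> \<notin> \<rat>" using small_irrational by blast
  note z = grd_eq_0_iff[OF \<epsilon> assms(1)]
  have nz: "grd d k l \<epsilon> f \<noteq> 0" "grd d k l \<epsilon> g \<noteq> 0" using assms(3) g by (simp_all add: z)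
  from level_exists[OF nz(1)] obtain w where w: "level w (grd d k l \<epsilon> f)" by blast
  from level_exists[OF nz(2)] obtain w' where w': "level w' (grd d k l \<epsilon> g)" by blast
  from level_mult[OF w w'] have "grd d k l \<epsilon> (f * g) \<noteq> 0"
    by (auto simp: level_def rhom_mult[OF rhom_grd])
  then show False using assms(2) by (simp add: z)
qed

text \<open>On \<open>X\<close> one has \<open>y = - r / x^d\<close>, so a power of \<open>x\<close>
  moves every class into \<open>\<complex>[x, z, t]\<close>.\<close>

lemma clear_denominator: "\<exists>n b. P d k l dvd [:Xb ^ n:] * f - [:b:]"
proof (induction f rule: poly4_gen_induct)
  case (const a)
  show ?case by (intro exI[of _ 0] exI[of _ "const3 a"]) (simp add: var_const_poly)
next
  case x
  show ?case by (intro exI[of _ 0] exI[of _ Xb]) (simp add: var_const_poly)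
next
  case z
  show ?case by (intro exI[of _ 0] exI[of _ Zv]) (simp add: var_const_poly)
next
  case t
  show ?case by (intro exI[of _ 0] exI[of _ Tv]) (simp add: var_const_poly)
next
  case y
  have "[:Xb ^ d:] * var_y - [:- Rb k l:] = P d k l" by (simp add: P_eq)
  then show ?case by (intro exI[of _ d] exI[of _ "- Rb k l"]) simp
next
  case (add p q)
  then obtain n b m c where "P d k l dvd [:Xb ^ n:] * p - [:b:]" "P d k l dvd [:Xb ^ m:] * q - [:c:]" by blast
  from P_dvd_add_diff[OF dvd_mult[OF this(1), of "[:Xb ^ m:]", unfolded right_diff_distrib] dvd_mult[OF this(2), of "[:Xb ^ n:]", unfolded right_diff_distrib]]
  have "P d k l dvd [:Xb ^ (n + m):] * (p + q) - [:Xb ^ m * b + Xb ^ n * c:]"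
    by (simp only: power_add const_poly_simps distrib_left distrib_right mult_ac)
  then show ?case by blast
next
  case (mult p q)
  then obtain n b m c where "P d k l dvd [:Xb ^ n:] * p - [:b:]" "P d k l dvd [:Xb ^ m:] * q - [:c:]" by blast
  from P_dvd_mult_diff[OF this] have "P d k l dvd [:Xb ^ (n + m):] * (p * q) - [:b * c:]"
    by (simp only: power_add const_poly_simps mult_ac)
  then show ?case by blast
qed

lemma restriction_to_subring:
  assumes d: "2 \<le> d" and kl: "2 \<le> k" "k < l" "coprime k l"
    and F: "rhom F" "\<And>c. F (const4 c) = const4 c" "P d k l dvd F (P d k l)"
    and G: "rhom G" "\<And>c. G (const4 c) = const4 c" "P d k l dvd G (P d k l)"
    and inv: "\<And>f. P d k l dvd F (G f) - f" "\<And>f. P d k l dvd G (F f) - f"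
  shows "\<exists>g. rhom g \<and> (\<forall>a. g (const3 a) = const3 a) \<and> (\<forall>b. P d k l dvd F [:b:] - [:g b:])"
proof -
  have kl0: "k > 0" "l > 0" using kl by simp_all
  have xn: "\<not> P d k l dvd var_x ^ d"
    using P_dvd_const[of d k l "Xb ^ d"] Xb_nz by (auto simp: var_const_poly const_poly_simps)
  note ci = conjugate_invariant[OF d kl _ F G inv]
  have one: "const4 1 = 1" "const4 0 = 0" by (simp_all add: rhom_1[OF rhom_const4] rhom_0[OF rhom_const4])
  obtain E where E: "elementary_action d k l E" "E var_x = [:var_x:]" "E var_z = [:var_z, const4 1 * var_x ^ d:]"
    "E var_t = [:var_t, const4 0 * var_x ^ d:]" using elementary_action_exists[OF kl0] by blast
  have nt: "\<not> P d k l dvd coeff (E var_z) 1" using xn by (simp add: E one)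
  obtain bx bt where b: "P d k l dvd F var_x - [:bx:]" "P d k l dvd F var_t - [:bt:]"
    using ci[OF E(1) nt, of var_x] ci[OF E(1) nt, of var_t] by (auto simp: E one)
  obtain E' where E': "elementary_action d k l E'" "E' var_x = [:var_x:]" "E' var_z = [:var_z, const4 0 * var_x ^ d:]"
    "E' var_t = [:var_t, const4 1 * var_x ^ d:]" using elementary_action_exists[OF kl0] by blast
  have nt': "\<not> P d k l dvd coeff (E' var_t) 1" using xn by (simp add: E' one)
  obtain bz where bz: "P d k l dvd F var_z - [:bz:]"
    using ci[OF E'(1) nt', of var_z] by (auto simp: E' one)
  define g where "g = hom3 const3 bx bz bt"
  have gr: "rhom g" unfolding g_def by (rule rhom_hom3[OF rhom_const3])
  have gg: "g (const3 a) = const3 a" "g Xb = bx" "g Zv = bz" "g Tv = bt" for a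
    using hom3_gen[OF rhom_const3, of bx bz bt] by (simp_all add: g_def const3_def[of a] Xb_def Zv_def Tv_def cst_def)
  have "P d k l dvd F [:b:] - [:g b:]" for b
  proof (induction b rule: poly3_gen_induct')
    case (add p q)
    from P_dvd_add_diff[OF this] show ?case by (simp only: const_poly_simps rhom_add[OF F(1)] rhom_add[OF gr])
  next
    case (mult p q)
    from P_dvd_mult_diff[OF this] show ?case by (simp only: const_poly_simps rhom_mult[OF F(1)] rhom_mult[OF gr])
  qed (use b bz F(2) in \<open>simp_all add: gg flip: var_const_poly\<close>)
  then show ?thesis using gr gg by blast
qed

text \<open>Clear the denominator of \<open>G y\<close> by \<open>x^n\<close> and apply
  \<open>F\<close>: \<open>g(x)^n y\<close> lies in \<open>\<complex>[x, z, t]\<close>, so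
  \<open>g(x)^n r\<close> is divisible by \<open>x^d\<close>. As \<open>r\<close> does not vanish
  modulo \<open>x\<close>, the image \<open>g(x)\<close> does.\<close>

lemma x_dvd_image:
  assumes d: "1 \<le> d" and l: "l > 0"
    and F: "rhom F" "P d k l dvd F (P d k l)" and g: "rhom g" "\<And>b. P d k l dvd F [:b:] - [:g b:]"
    and inv: "\<And>f. P d k l dvd F (G f) - f"
  shows "Xb dvd g Xb"
proof -
  obtain n b where nb: "P d k l dvd [:Xb ^ n:] * G var_y - [:b:]" using clear_denominator by blast
  have "P d k l dvd F ([:Xb ^ n:] * G var_y) - F [:b:]"
    using dvd_trans[OF F(2) rhom_dvd[OF F(1) nb]] by (simp add: rhom_diff[OF F(1)])
  then have 1: "P d k l dvd F ([:Xb ^ n:] * G var_y) - [:g b:]" using g(2) by (rule P_dvd_trans)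
  have "P d k l dvd F ([:Xb ^ n:] * G var_y) - [:g (Xb ^ n):] * var_y"
    unfolding rhom_mult[OF F(1)] by (rule P_dvd_mult_diff[OF g(2) inv])
  from P_dvd_trans[OF dvd_sub_swap[OF this] 1] have "P d k l dvd [:g (Xb ^ n):] * var_y - [:g b:]" .
  then have "P d k l dvd [:Xb ^ d:] * ([:g (Xb ^ n):] * var_y - [:g b:])" by (rule dvd_mult)
  moreover have "[:Xb ^ d:] * ([:g (Xb ^ n):] * var_y - [:g b:]) =
      [:g (Xb ^ n):] * P d k l - [:g (Xb ^ n) * Rb k l + Xb ^ d * g b:]"
    unfolding P_eq const_poly_simps by (simp only: algebra_simps)
  ultimately have "P d k l dvd [:g (Xb ^ n) * Rb k l + Xb ^ d * g b:]"
    by (metis dvd_diff_right_iff dvd_triv_right)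
  then have "g (Xb ^ n) * Rb k l + Xb ^ d * g b = 0" by (rule P_dvd_const)
  then have "at0 (g (Xb ^ n) * Rb k l + Xb ^ d * g b) = 0" by (simp only: rhom_0[OF rhom_at0])
  then have "at0 (g Xb) ^ n * R0 k l = 0"
    using d by (simp add: rhom_simps[OF rhom_at0] rhom_simps[OF g(1)] at0_Rb at0_gen power_0_left)
  then have "at0 (g Xb) = 0" using R0_nz[OF l] by auto
  then show ?thesis by (simp add: Xb_dvd_iff)
qed

text \<open>Apply \<open>F\<close> to \<open>P\<close> and compare the parts free of
  \<open>y\<close>: \<open>g(r)\<close> plus a multiple of \<open>g(x)^d\<close> is a multiple of
  \<open>r\<close>.\<close>

lemma preserves_ideal:
  assumes F: "rhom F" "P d k l dvd F (P d k l)" and g: "rhom g" "\<And>b. P d k l dvd F [:b:] - [:g b:]"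
    and x: "Xb dvd g Xb"
  shows "pres d k l g"
proof -
  obtain w where w: "g Xb = Xb * w" using x by (rule dvdE)
  have "P d k l dvd F (P d k l) - ([:g (Rb k l):] + [:g (Xb ^ d):] * F var_y)"
    unfolding P_eq rhom_add[OF F(1)] rhom_mult[OF F(1)] unfolding P_eq[symmetric]
    using g(2) by (intro P_dvd_add_diff P_dvd_mult_diff) simp_all
  from dvd_diff[OF F(2) this] have "P d k l dvd [:g (Rb k l):] + [:g (Xb ^ d):] * F var_y" by simp
  then obtain m where m: "[:g (Rb k l):] + [:g (Xb ^ d):] * F var_y = P d k l * m" by (rule dvdE)
  have "coeff ([:g (Rb k l):] + [:g (Xb ^ d):] * F var_y) 0 = g (Rb k l) + g (Xb ^ d) * coeff (F var_y) 0" by simp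
  moreover have "coeff (P d k l * m) 0 = Rb k l * coeff m 0" by (simp add: P_eq_pCons coeff_mult_0)
  ultimately have "g (Rb k l) + g (Xb ^ d) * coeff (F var_y) 0 = Rb k l * coeff m 0" by (simp only: m)
  then have "g (Rb k l) = Rb k l * coeff m 0 + Xb ^ d * (- (w ^ d * coeff (F var_y) 0))"
    by (simp add: rhom_power[OF g(1)] w power_mult_distrib algebra_simps eq_diff_eq)
  then show ?thesis unfolding pres_def by blast
qed

lemma unit_poly3:
  fixes p q :: poly3
  assumes "p * q = 1"
  shows "\<exists>c. p = const3 c"
proof -
  obtain a b where a: "p = [:a:]" "a * b = 1" using mult_eq_1_poly[OF assms] by blast
  obtain a' b' where a': "a = [:a':]" "a' * b' = 1" using mult_eq_1_poly[OF a(2)] by blast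
  obtain c where "a' = [:c:]" using mult_eq_1_poly[OF a'(2)] by blast
  then show ?thesis by (auto simp: a a' const3_def cst_def)
qed

lemma automorphism_extends:
  assumes d: "2 \<le> d" and kl: "2 \<le> k" "k < l" "coprime k l"
    and F: "rhom F" "\<And>c. F (const4 c) = const4 c" "P d k l dvd F (P d k l)"
    and G: "rhom G" "\<And>c. G (const4 c) = const4 c" "P d k l dvd G (P d k l)"
    and inv: "\<And>f. P d k l dvd F (G f) - f" "\<And>f. P d k l dvd G (F f) - f"
  shows "\<exists>\<Phi> \<Psi> c. rhom \<Phi> \<and> rhom \<Psi> \<and> (\<forall>a. \<Phi> (const4 a) = const4 a) \<and> (\<forall>f. \<Phi> (\<Psi> f) = f) \<and> (\<forall>f. \<Psi> (\<Phi> f) = f) \<and>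
     (\<forall>a. \<Psi> (const4 a) = const4 a) \<and> c \<noteq> 0 \<and> \<Phi> (P d k l) = const4 c * P d k l \<and> (\<forall>f. P d k l dvd \<Phi> f - F f)"
proof -
  obtain g where g: "rhom g" "\<And>a. g (const3 a) = const3 a" "\<And>b. P d k l dvd F [:b:] - [:g b:]"
    using restriction_to_subring[OF d kl F G inv] by blast
  obtain g' where g': "rhom g'" "\<And>a. g' (const3 a) = const3 a" "\<And>b. P d k l dvd G [:b:] - [:g' b:]"
    using restriction_to_subring[OF d kl G F inv(2,1)] by blast
  have comp: "h (h' b) = b" if F: "rhom F" "P d k l dvd F (P d k l)" and h: "\<And>b. P d k l dvd F [:b:] - [:h b:]"
    and h': "\<And>b. P d k l dvd G [:b:] - [:h' b:]" and inv: "\<And>f. P d k l dvd F (G f) - f" for F G h h' b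
  proof -
    have "P d k l dvd F (G [:b:]) - F [:h' b:]"
      using dvd_trans[OF F(2) rhom_dvd[OF F(1) h'[of b]]] by (simp only: rhom_diff[OF F(1)])
    from P_dvd_trans[OF P_dvd_trans[OF dvd_sub_swap[OF inv] this] h]
    have "P d k l dvd [:b:] - [:h (h' b):]" .
    then show ?thesis using P_dvd_const_diff by metis
  qed
  have gg: "g (g' b) = b" "g' (g b) = b" for b
    using comp[OF F(1,3) g(3) g'(3) inv(1)] comp[OF G(1,3) g'(3) g(3) inv(2)] by blast+
  have d1: "1 \<le> d" and l0: "l > 0" and k0: "k > 0" using d kl by simp_all
  have x: "Xb dvd g Xb" by (rule x_dvd_image[OF d1 l0 F(1,3) g(1,3) inv(1)])
  have x': "Xb dvd g' Xb" by (rule x_dvd_image[OF d1 l0 G(1,3) g'(1,3) inv(2)])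
  \<comment> \<open>Divisibility in both directions makes the cofactor of \<open>x\<close> a unit,
    hence a constant.\<close>
  have scal: "\<exists>c. h Xb = const3 c * Xb" if h: "rhom h" "Xb dvd h Xb" "Xb dvd h' Xb" "\<And>b. h (h' b) = b" for h h'
  proof -
    obtain w w' where w: "h Xb = Xb * w" "h' Xb = Xb * w'" using h(2,3) by (elim dvdE)
    have "h (h' Xb) = Xb * (w * h w')" unfolding w(2) rhom_mult[OF h(1)] w(1) by (simp only: mult.assoc)
    then have "Xb * (w * h w') = Xb * 1" by (simp add: h(4))
    then have "w * h w' = 1" using Xb_nz by (simp only: mult_left_cancel[OF Xb_nz])
    then show ?thesis using unit_poly3 w(1) by (metis mult.commute)
  qed
  obtain \<mu> \<mu>' where mu: "g Xb = const3 \<mu> * Xb" "g' Xb = const3 \<mu>' * Xb"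
    using scal[OF g(1) x x' gg(1)] scal[OF g'(1) x' x gg(2)] by blast
  have "extendable d k l g"
    by (rule extendable_automorphism[OF kl d g(1,2) mu(1) g'(1,2) mu(2) gg
        preserves_ideal[OF F(1,3) g(1,3) x] preserves_ideal[OF G(1,3) g'(1,3) x']])
  then obtain \<Phi> \<Psi> c where A: "rhom \<Phi>" "rhom \<Psi>" "\<And>a. \<Phi> (const4 a) = const4 a" "\<And>a. \<Psi> (const4 a) = const4 a"
    "\<And>f. \<Phi> (\<Psi> f) = f" "\<And>f. \<Psi> (\<Phi> f) = f" "c \<noteq> 0" "\<Phi> (P d k l) = const4 c * P d k l"
    "\<And>b. P d k l dvd \<Phi> [:b:] - [:g b:]"
    unfolding extendable_def by metis
  have const: "P d k l dvd \<Phi> [:b:] - F [:b:]" for b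
    by (rule P_dvd_trans[OF A(9) dvd_sub_swap[OF g(3)]])
  \<comment> \<open>Both maps send \<open>P\<close> into its ideal and agree on \<open>r\<close> and
    \<open>x^d\<close>, so they agree on \<open>x^d y\<close>; the factor from \<open>x^d\<close> is
    cancelled because \<open>P\<close> is prime.\<close>
  have y: "P d k l dvd \<Phi> var_y - F var_y"
  proof -
    have "P d k l dvd (\<Phi> [:Rb k l:] + \<Phi> [:Xb ^ d:] * \<Phi> var_y) - (F [:Rb k l:] + F [:Xb ^ d:] * F var_y)"
    proof -
      have "P d k l dvd \<Phi> (P d k l)" unfolding A(8) by simp
      from dvd_diff[OF this F(3)] show ?thesis
        unfolding P_eq[symmetric] rhom_add[OF A(1), symmetric] rhom_add[OF F(1), symmetric] rhom_mult[OF A(1), symmetric]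
          rhom_mult[OF F(1), symmetric] .
    qed
    from dvd_diff[OF this const[of "Rb k l"]] have "P d k l dvd \<Phi> [:Xb ^ d:] * \<Phi> var_y - F [:Xb ^ d:] * F var_y"
      by (simp add: algebra_simps)
    moreover have "P d k l dvd \<Phi> [:Xb ^ d:] * F var_y - F [:Xb ^ d:] * F var_y"
      by (rule P_dvd_mult_diff[OF const]) simp
    ultimately have "P d k l dvd \<Phi> [:Xb ^ d:] * \<Phi> var_y - \<Phi> [:Xb ^ d:] * F var_y"
      using P_dvd_trans dvd_sub_swap by blast
    then have "P d k l dvd \<Phi> [:Xb ^ d:] * (\<Phi> var_y - F var_y)" by (simp only: right_diff_distrib)
    moreover have "\<not> P d k l dvd \<Phi> [:Xb ^ d:]"
    proof
      assume "P d k l dvd \<Phi> [:Xb ^ d:]"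
      from dvd_diff[OF this A(9)[of "Xb ^ d"]] have "P d k l dvd [:g (Xb ^ d):]" by simp
      then have "g (Xb ^ d) = 0" by (rule P_dvd_const)
      then have "g' (g (Xb ^ d)) = 0" by (simp only: rhom_0[OF g'(1)])
      then show False using Xb_nz by (simp add: gg)
    qed
    ultimately show ?thesis by (rule P_prime[OF k0])
  qed
  have "P d k l dvd \<Phi> f - F f" for f
  proof (induction f rule: poly4_gen_induct)
    case (add p q)
    from P_dvd_add_diff[OF this] show ?case by (simp only: rhom_add[OF F(1)] rhom_add[OF A(1)])
  next
    case (mult p q)
    from P_dvd_mult_diff[OF this] show ?case by (simp only: rhom_mult[OF F(1)] rhom_mult[OF A(1)])
  qed (use const y in \<open>simp_all add: var_const_poly\<close>)
  then show ?thesis using A(1-8) by blast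
qed

section \<open>Passage between congruences modulo \<open>P\<close> and the quotient ring\<close>

lemma ring_simps:
  "carrier poly4_ring = UNIV" "a \<otimes>\<^bsub>poly4_ring\<^esub> b = a * b" "a \<oplus>\<^bsub>poly4_ring\<^esub> b = a + b" "\<one>\<^bsub>poly4_ring\<^esub> = 1"
  by (simp_all add: ring_of_type_algebra_def)

lemma I_X_eq: "I_X d k l = {f. P d k l dvd f}"
  by (auto simp: I_X_def cgenideal_def ring_simps dvd_def mult.commute)

lemma ideal_I_X: "ideal (I_X d k l) poly4_ring"
  unfolding I_X_def by (rule cring.cgenideal_ideal[OF cring_from_type_algebra]) (simp add: ring_simps)

lemma residue_class_eq_iff: "residue_class d k l f = residue_class d k l g \<longleftrightarrow> P d k l dvd f - g"
proof -
  have r: "residue_class d k l f = {h. P d k l dvd h - f}" for f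
    unfolding residue_class_def a_r_coset_def' I_X_eq ring_simps by (auto intro!: exI[of _ "_ - f"])
  show ?thesis
  proof
    assume "residue_class d k l f = residue_class d k l g"
    moreover have "f \<in> residue_class d k l f" by (simp add: r)
    ultimately show "P d k l dvd f - g" by (simp add: r)
  next
    assume fg: "P d k l dvd f - g"
    show "residue_class d k l f = residue_class d k l g"
      unfolding r using P_dvd_trans[OF _ fg] P_dvd_trans[OF _ dvd_sub_swap[OF fg]] by blast
  qed
qed

lemma coord_ring_hom:
  "residue_class d k l (f * g) = residue_class d k l f \<otimes>\<^bsub>coord_ring d k l\<^esub> residue_class d k l g"
  "residue_class d k l (f + g) = residue_class d k l f \<oplus>\<^bsub>coord_ring d k l\<^esub> residue_class d k l g"
  "residue_class d k l f \<in> carrier (coord_ring d k l)"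
  using ideal.rcos_ring_hom[OF ideal_I_X, of d k l]
  unfolding residue_class_def coord_ring_def by (auto simp: ring_hom_def ring_simps)

lemma carrier_coord_ring: "a \<in> carrier (coord_ring d k l) \<Longrightarrow> \<exists>f. a = residue_class d k l f"
  by (auto simp: coord_ring_def FactRing_def A_RCOSETS_def' residue_class_def ring_simps)

text \<open>Representatives are chosen only for the images of the four coordinates; by the universal
  property the lift is then a true homomorphism of the polynomial ring that fixes constants.\<close>

lemma lift_endomorphism:
  assumes "\<phi> \<in> ring_hom (coord_ring d k l) (coord_ring d k l)"
    "\<And>c. \<phi> (residue_class d k l (const4 c)) = residue_class d k l (const4 c)"
  shows "\<exists>F. rhom F \<and> (\<forall>c. F (const4 c) = const4 c) \<and> (\<forall>f. residue_class d k l (F f) = \<phi> (residue_class d k l f))"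
proof -
  let ?R = "coord_ring d k l" and ?r = "residue_class d k l"
  have h: "\<phi> (a \<otimes>\<^bsub>?R\<^esub> b) = \<phi> a \<otimes>\<^bsub>?R\<^esub> \<phi> b" "\<phi> (a \<oplus>\<^bsub>?R\<^esub> b) = \<phi> a \<oplus>\<^bsub>?R\<^esub> \<phi> b" "\<phi> a \<in> carrier ?R"
    if "a \<in> carrier ?R" "b \<in> carrier ?R" for a b
    using assms(1) that by (auto simp: ring_hom_def)
  have "\<exists>f. \<phi> (?r v) = ?r f" for v
    using h(3)[OF coord_ring_hom(3) coord_ring_hom(3)] by (rule carrier_coord_ring)
  then obtain s where s: "\<And>v. ?r (s v) = \<phi> (?r v)" by metis
  define F where "F = hom4 const4 (s var_x) (s var_z) (s var_t) (s var_y)"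
  have F: "rhom F" unfolding F_def by (rule rhom_hom4[OF rhom_const4])
  have Fg: "F (const4 c) = const4 c" "F var_x = s var_x" "F var_z = s var_z" "F var_t = s var_t" "F var_y = s var_y" for c
    by (simp_all only: F_def hom4_gen[OF rhom_const4])
  have "?r (F f) = \<phi> (?r f)" for f
    by (induction f rule: poly4_gen_induct)
      (simp_all add: Fg s assms(2) rhom_add[OF F] rhom_mult[OF F] coord_ring_hom h)
  then show ?thesis using F Fg by blast
qed

lemma lift_automorphism:
  assumes "\<phi> \<in> Aut_X d k l"
  shows "\<exists>F G. rhom F \<and> (\<forall>c. F (const4 c) = const4 c) \<and> P d k l dvd F (P d k l) \<and>
    rhom G \<and> (\<forall>c. G (const4 c) = const4 c) \<and> P d k l dvd G (P d k l) \<and>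
    (\<forall>f. P d k l dvd F (G f) - f) \<and> (\<forall>f. P d k l dvd G (F f) - f) \<and>
    (\<forall>f. residue_class d k l (F f) = \<phi> (residue_class d k l f))"
proof -
  let ?R = "coord_ring d k l" and ?r = "residue_class d k l"
  have iso: "\<phi> \<in> ring_iso ?R ?R" and c: "\<And>c. \<phi> (?r (const4 c)) = ?r (const4 c)"
    using assms by (auto simp: Aut_X_def alg_aut_def)
  have bij: "bij_betw \<phi> (carrier ?R) (carrier ?R)" and hom: "\<phi> \<in> ring_hom ?R ?R"
    using iso by (auto simp: ring_iso_def)
  define \<psi> where "\<psi> = inv_into (carrier ?R) \<phi>"
  have "ring ?R" unfolding coord_ring_def by (rule ideal.quotient_is_ring[OF ideal_I_X])
  then have hom': "\<psi> \<in> ring_hom ?R ?R"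
    unfolding \<psi>_def using ring_iso_set_sym[OF _ iso] by (auto simp: ring_iso_def)
  have inv: "\<psi> (\<phi> a) = a" "\<phi> (\<psi> a) = a" if "a \<in> carrier ?R" for a
    unfolding \<psi>_def using bij_betw_inv_into_left[OF bij that] bij_betw_inv_into_right[OF bij that] by blast+
  have c': "\<psi> (?r (const4 e)) = ?r (const4 e)" for e
    using inv(1)[OF coord_ring_hom(3)[where f = "const4 e"]] by (simp add: c)
  obtain F where F: "rhom F" "\<And>c. F (const4 c) = const4 c" "\<And>f. ?r (F f) = \<phi> (?r f)"
    using lift_endomorphism[OF hom c] by metis
  obtain G where G: "rhom G" "\<And>c. G (const4 c) = const4 c" "\<And>f. ?r (G f) = \<psi> (?r f)"
    using lift_endomorphism[OF hom' c'] by metis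
  have P0: "?r (P d k l) = ?r 0" by (simp add: residue_class_eq_iff)
  have "?r (F (P d k l)) = ?r (F 0)" "?r (G (P d k l)) = ?r (G 0)" by (simp_all only: F(3) G(3) P0)
  then have "P d k l dvd F (P d k l)" "P d k l dvd G (P d k l)"
    by (simp_all add: residue_class_eq_iff rhom_0[OF F(1)] rhom_0[OF G(1)])
  moreover have "?r (F (G f)) = ?r f" "?r (G (F f)) = ?r f" for f
    by (simp_all only: F(3) G(3) inv coord_ring_hom(3))
  then have "P d k l dvd F (G f) - f" "P d k l dvd G (F f) - f" for f
    by (simp_all only: residue_class_eq_iff)
  ultimately show ?thesis using F G by (intro exI[of _ F] exI[of _ G]) simp
qed

theorem theorem5p1:
  fixes d k l :: nat
  assumes "d \<ge> 2" and "2 \<le> k" and "k < l" and "coprime k l"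
  shows "\<forall>\<phi> \<in> Aut_X d k l. extends_to_A4 d k l \<phi>"
proof
  fix \<phi> assume "\<phi> \<in> Aut_X d k l"
  then obtain F G where F: "rhom F" "\<And>c. F (const4 c) = const4 c" "P d k l dvd F (P d k l)"
    and G: "rhom G" "\<And>c. G (const4 c) = const4 c" "P d k l dvd G (P d k l)"
    and inv: "\<And>f. P d k l dvd F (G f) - f" "\<And>f. P d k l dvd G (F f) - f"
    and \<phi>: "\<And>f. residue_class d k l (F f) = \<phi> (residue_class d k l f)"
    using lift_automorphism by metis
  obtain \<Phi> \<Psi> c where A: "rhom \<Phi>" "rhom \<Psi>" "\<And>a. \<Phi> (const4 a) = const4 a" "\<And>f. \<Phi> (\<Psi> f) = f" "\<And>f. \<Psi> (\<Phi> f) = f"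
    "\<And>a. \<Psi> (const4 a) = const4 a" "c \<noteq> 0" "\<Phi> (P d k l) = const4 c * P d k l" "\<And>f. P d k l dvd \<Phi> f - F f"
    using automorphism_extends[OF assms F G inv] by metis
  have "bij \<Phi>" by (rule o_bij[of \<Psi>]) (auto simp: A)
  then have "\<Phi> \<in> Aut_A4"
    by (simp add: Aut_A4_def alg_aut_def ring_iso_def ring_hom_def ring_simps A(3) rhom_simps[OF A(1)])
  moreover have "\<Phi> ` I_X d k l = I_X d k l"
  proof -
    have fwd: "P d k l dvd \<Phi> f" if "P d k l dvd f" for f
      using dvd_trans[OF _ rhom_dvd[OF A(1) that]] A(8) by simp
    have "P d k l = const4 c * \<Psi> (P d k l)"
      using A(5)[of "P d k l"] by (simp add: A(8) rhom_mult[OF A(2)] A(6))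
    then have "const4 (inverse c) * P d k l = const4 (inverse c * c) * \<Psi> (P d k l)"
      by (metis mult.assoc rhom_mult[OF rhom_const4])
    then have "\<Psi> (P d k l) = const4 (inverse c) * P d k l"
      using A(7) by (simp add: rhom_1[OF rhom_const4])
    then have "P d k l dvd \<Psi> (P d k l)" by simp
    then have bwd: "P d k l dvd \<Psi> f" if "P d k l dvd f" for f
      using dvd_trans[OF _ rhom_dvd[OF A(2) that]] by blast
    show ?thesis
    proof
      show "\<Phi> ` I_X d k l \<subseteq> I_X d k l" using fwd by (auto simp: I_X_eq)
      show "I_X d k l \<subseteq> \<Phi> ` I_X d k l"
      proof
        fix f assume "f \<in> I_X d k l"
        then have "\<Psi> f \<in> I_X d k l" using bwd by (simp add: I_X_eq)
        then show "f \<in> \<Phi> ` I_X d k l" using A(4)[of f] by (metis imageI)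
      qed
    qed
  qed
  moreover have "\<phi> (residue_class d k l f) = residue_class d k l (\<Phi> f)" for f
    unfolding \<phi>[symmetric] residue_class_eq_iff by (rule dvd_sub_swap[OF A(9)])
  ultimately show "extends_to_A4 d k l \<phi>" unfolding extends_to_A4_def by blast
qed

end
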